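(* Let $f$ be a $C^1$ map of a compact interval $I$ admitting an inducing scheme satisfying (H1)–(H5), and assume there is $c_9>0$ such that every $\mu\in\mathcal M(f,I)$ with $h_\mu(f)=0$ has Lyapunov exponent $\lambda(\mu)>c_9$. Then there exist $a>0$ and $b>0$ such that for every $t\in(-a,1+b)$, no measure $\mu\in\mathcal M(f,I)$ with $h_\mu(f)=0$ is an equilibrium measure for $\varphi_t=-t\log|df|$, i.e. no such $\mu$ satisfies $h_\mu(f)-t\lambda(\mu)=P_L(\varphi_t)$.
   Context: $f:I\to I$ is a $C^1$ map of a compact interval $I\subset\mathbb R$ with an inducing scheme: $S$ a countable collection of pairwise disjoint Borel subsets of $I$, $\tau:S\to\mathbb N$, $W=\bigcup_{J\in S}J$, $\tau(x)=\tau(J)$ on $J$; $\overline J$ closure; $f^{-\tau(J)}$ inverse branch of $f^{\tau(J)}|_J$; $F(x)=f^{\tau(x)}(x)$; $X=\bigcup_J\bigcup_{k<\tau(J)}f^kJ$; $(S^{\mathbb N},\sigma)$ the full shift on $S$ and $h$ the coding map sending $(a_k)$ to the unique point of $\overline{J_{a_0}}\cap\bigcap_{k\ge1}f^{-\tau(J_{a_0})}\circ\cdots\circ f^{-\tau(J_{a_{k-1}})}(\overline{J_{a_k}})$, $J_{[a_0,\dots,a_{n-1}]}=h([a_0,\dots,a_{n-1}])$. (H1) each $J$ has a connected open $U_J\supseteq J$ with $f^{\tau(J)}|_{U_J}$ a homeomorphism onto its image and $f^{\tau(J)}(J)=W$; (H2) for every sequence $(J_k)$ in $S$, $\overline{J_1}\cap\bigcap_{k\ge2}f^{-\tau(J_1)}\circ\cdots\circ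 f^{-\tau(J_{k-1})}(\overline{J_k})$ is one point; (H3) every $\sigma$-invariant Borel probability on $S^{\mathbb N}$ positive on open sets gives zero measure to $S^{\mathbb N}\setminus h^{-1}(W)$; (H4) $\mathrm{Leb}(W)>0$ and $\sum_{\tau(J)\ge n}\mathrm{Leb}(J)\le c_1^{-1}\lambda_1^{-n}$ ($c_1>0,\lambda_1>1$); (H5) $|dF(F^ix)/dF(F^iy)-1|\le c_2\lambda_2^{-n}$ for $n\ge1$, $x,y\in J_{[a_0,\dots,a_{n-1}]}$, $0\le i<n$. $\mathcal M(f,I)$: $f$-invariant ergodic Borel probability measures on $I$; $\lambda(\mu)=\int\log|df|\,d\mu$. $\mathcal M_L(f,X)$: the measures $\mathcal L(\nu)(E)=Q_\nu^{-1}\sum_J\sum_{k<\tau(J)}\nu(f^{-k}E\cap J)$ with $\nu$ an $F$-invariant ergodic Borel probability on $W$ and $Q_\nu=\sum_J\tau(J)\nu(J)<\infty$. $P_L(\varphi)=\sup_{\mu\in\mathcal M_L(f,X)}\{h_\mu(f)+\int\varphi\,d\mu\}$. *)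

theory Defs
  imports "HOL-Probability.Probability"
begin

text \<open>log as an extended real: log 0 = -infinity (used for log|df| at critical points).\<close>
definition eln :: "real \<Rightarrow> ereal" where
  "eln x = (if x > 0 then ereal (ln x) else - \<infinity>)"

definition eint :: "'a measure \<Rightarrow> ('a \<Rightarrow> ereal) \<Rightarrow> ereal" where
  "eint M g = enn2ereal (\<integral>\<^sup>+ x. e2ennreal (max 0 (g x)) \<partial>M)
              - enn2ereal (\<integral>\<^sup>+ x. e2ennreal (max 0 (- g x)) \<partial>M)"

definition lyap :: "(real \<Rightarrow> real) \<Rightarrow> real measure \<Rightarrow> ereal" where
  "lyap df \<mu> = eint \<mu> (\<lambda>x. eln \<bar>df x\<bar>)"

definition inv_erg_on :: "(real \<Rightarrow> real) \<Rightarrow> real set \<Rightarrow> real measure \<Rightarrow> bool" where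
  "inv_erg_on T A \<mu> \<longleftrightarrow>
     prob_space \<mu> \<and> sets \<mu> = sets (restrict_space borel A) \<and>
     (\<forall>B\<in>sets \<mu>. T -` B \<inter> A \<in> sets \<mu> \<and> emeasure \<mu> (T -` B \<inter> A) = emeasure \<mu> B) \<and>
     (\<forall>B\<in>sets \<mu>. T -` B \<inter> A = B \<longrightarrow> emeasure \<mu> B = 0 \<or> emeasure \<mu> B = 1)"

definition meas_partition :: "'a measure \<Rightarrow> 'a set set \<Rightarrow> bool" where
  "meas_partition \<mu> P \<longleftrightarrow> finite P \<and> P \<subseteq> sets \<mu> \<and> disjoint P \<and> \<Union>P = space \<mu>"

definition ent_fun :: "real \<Rightarrow> real" where
  "ent_fun p = (if p = 0 then 0 else - p * ln p)"

definition part_entropy :: "'a measure \<Rightarrow> 'a set set \<Rightarrow> real" where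
  "part_entropy \<mu> P = (\<Sum>A\<in>P. ent_fun (measure \<mu> A))"

definition iter_join :: "('a \<Rightarrow> 'a) \<Rightarrow> 'a measure \<Rightarrow> 'a set set \<Rightarrow> nat \<Rightarrow> 'a set set" where
  "iter_join T \<mu> P n = {space \<mu> \<inter> (\<Inter>i<n. (T ^^ i) -` (c i)) | c. \<forall>i<n. c i \<in> P}"

definition part_ks_entropy :: "('a \<Rightarrow> 'a) \<Rightarrow> 'a measure \<Rightarrow> 'a set set \<Rightarrow> real" where
  "part_ks_entropy T \<mu> P =
     lim (\<lambda>n. part_entropy \<mu> (iter_join T \<mu> P (Suc n)) / real (Suc n))"

definition ks_entropy :: "('a \<Rightarrow> 'a) \<Rightarrow> 'a measure \<Rightarrow> ereal" where
  "ks_entropy T \<mu> = (SUP P\<in>{P. meas_partition \<mu> P}. ereal (part_ks_entropy T \<mu> P))"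

definition ind_tau :: "real set set \<Rightarrow> (real set \<Rightarrow> nat) \<Rightarrow> real \<Rightarrow> nat" where
  "ind_tau S \<tau> x = \<tau> (THE J. J \<in> S \<and> x \<in> J)"

definition ind_F :: "(real \<Rightarrow> real) \<Rightarrow> real set set \<Rightarrow> (real set \<Rightarrow> nat) \<Rightarrow> real \<Rightarrow> real" where
  "ind_F f S \<tau> x = (f ^^ ind_tau S \<tau> x) x"

text \<open>Image of a set A under the inverse branch f^{-tau(J)} (extended to the closure of J).\<close>
definition brpre :: "(real \<Rightarrow> real) \<Rightarrow> (real set \<Rightarrow> nat) \<Rightarrow> real set \<Rightarrow> real set \<Rightarrow> real set" where
  "brpre f \<tau> J A = {x \<in> closure J. (f ^^ \<tau> J) x \<in> A}"

fun word_pre :: "(real \<Rightarrow> real) \<Rightarrow> (real set \<Rightarrow> nat) \<Rightarrow> real set list \<Rightarrow> real set \<Rightarrow> real set" where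
  "word_pre f \<tau> [] A = A"
| "word_pre f \<tau> (J # w) A = brpre f \<tau> J (word_pre f \<tau> w A)"

definition code_set :: "(real \<Rightarrow> real) \<Rightarrow> (real set \<Rightarrow> nat) \<Rightarrow> (nat \<Rightarrow> real set) \<Rightarrow> real set" where
  "code_set f \<tau> a = closure (a 0) \<inter> (\<Inter>k\<in>{1..}. word_pre f \<tau> (map a [0..<k]) (closure (a k)))"

definition code_map :: "(real \<Rightarrow> real) \<Rightarrow> (real set \<Rightarrow> nat) \<Rightarrow> (nat \<Rightarrow> real set) \<Rightarrow> real" where
  "code_map f \<tau> a = (THE x. x \<in> code_set f \<tau> a)"

text \<open>The full shift S^N, its cylinders and its Borel sigma-algebra (generated by the
  cylinders, which form a countable basis of the product topology since S is countable).\<close>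
definition seqs :: "'b set \<Rightarrow> (nat \<Rightarrow> 'b) set" where
  "seqs S = {a. \<forall>k. a k \<in> S}"

definition cyl :: "'b set \<Rightarrow> 'b list \<Rightarrow> (nat \<Rightarrow> 'b) set" where
  "cyl S w = {a \<in> seqs S. \<forall>i<length w. a i = w ! i}"

definition shift_space :: "'b set \<Rightarrow> (nat \<Rightarrow> 'b) measure" where
  "shift_space S = sigma (seqs S) {cyl S w | w. w \<in> lists S}"

definition shift :: "(nat \<Rightarrow> 'b) \<Rightarrow> (nat \<Rightarrow> 'b)" where
  "shift a = (\<lambda>k. a (Suc k))"

definition code_cyl :: "(real \<Rightarrow> real) \<Rightarrow> real set set \<Rightarrow> (real set \<Rightarrow> nat) \<Rightarrow> real set list \<Rightarrow> real set" where
  "code_cyl f S \<tau> w = code_map f \<tau> ` cyl S w"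

text \<open>Derivative of f^tau(J) at x (chain rule), i.e. dF on the branch J.\<close>
definition dF_br :: "(real \<Rightarrow> real) \<Rightarrow> (real \<Rightarrow> real) \<Rightarrow> (real set \<Rightarrow> nat) \<Rightarrow> real set \<Rightarrow> real \<Rightarrow> real" where
  "dF_br f df \<tau> J x = (\<Prod>k<\<tau> J. df ((f ^^ k) x))"

text \<open>F^i along the branch prescribed by the word w: f^(tau(w_0)+...+tau(w_{i-1})).\<close>
definition F_word :: "(real \<Rightarrow> real) \<Rightarrow> (real set \<Rightarrow> nat) \<Rightarrow> real set list \<Rightarrow> nat \<Rightarrow> real \<Rightarrow> real" where
  "F_word f \<tau> w i x = (f ^^ (\<Sum>k<i. \<tau> (w ! k))) x"

definition Q_nu :: "real set set \<Rightarrow> (real set \<Rightarrow> nat) \<Rightarrow> real measure \<Rightarrow> ennreal" where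
  "Q_nu S \<tau> \<nu> = (\<Sum>\<^sub>\<infinity>J\<in>S. of_nat (\<tau> J) * emeasure \<nu> J)"

definition lifted_measures :: "(real \<Rightarrow> real) \<Rightarrow> real set \<Rightarrow> real set set \<Rightarrow> (real set \<Rightarrow> nat) \<Rightarrow> real measure set" where
  "lifted_measures f I S \<tau> =
     {\<mu>. sets \<mu> = sets (restrict_space borel I) \<and>
        (\<exists>\<nu>. inv_erg_on (ind_F f S \<tau>) (\<Union>S) \<nu> \<and> Q_nu S \<tau> \<nu> < \<infinity> \<and>
             (\<forall>E\<in>sets \<mu>. emeasure \<mu> E =
                (\<Sum>\<^sub>\<infinity>J\<in>S. \<Sum>k<\<tau> J. emeasure \<nu> ((f ^^ k) -` E \<inter> J)) / Q_nu S \<tau> \<nu>))}"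

definition P_L :: "(real \<Rightarrow> real) \<Rightarrow> real set \<Rightarrow> real set set \<Rightarrow> (real set \<Rightarrow> nat) \<Rightarrow> (real \<Rightarrow> ereal) \<Rightarrow> ereal" where
  "P_L f I S \<tau> \<phi> = (SUP \<mu>\<in>lifted_measures f I S \<tau>. ks_entropy f \<mu> + eint \<mu> \<phi>)"

end

(*
The bound in (H5) is uniform in the position i inside the word, so dF is constant on every branch J.
Hence Lebesgue measure conditioned on W is F-invariant and Bernoulli (J has mass 1/|dF|), its lift mu
is an absolutely continuous f-invariant measure, and its exponent l, namely the entropy of the
partition S divided by the mean return time, is positive and finite.  The lift may identify points of
the tower, so instead of Abramov's formula we use Rokhlin's inequality h_mu(f) >= integral of ln|df| for
absolutely continuous invariant measures.  Then P_L(phi_t) >= (1 - t) l, whereas a zero entropy measure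
contributes -t times a number in (c9, B].
*)
theory Submission
  imports Defs
begin

text \<open>\<open>lifted_measures\<close> demands an ergodic \<open>nu\<close>, so the Bernoulli
  structure has to be turned into ergodicity: constant slopes make an invariant set independent of
  every cylinder, and (H2) together with compactness makes the cylinders generate the Borel sets of
  \<open>W\<close>. Rokhlin's inequality meets three obstacles: \<open>f\<close> may have critical
  points, the density \<open>D\<close> of \<open>mu\<close> may vanish or be unbounded, and
  \<open>ks_entropy\<close> sees finite partitions only. Dyadic partitions deal with them. On a
  piece away from the critical points the Jacobian of \<open>f\<close> with respect to
  \<open>mu\<close> is |df| (D o f) / D; its logarithm is cut off at height n, and replaced by 0 on
  the other pieces. Invariance forces the Jacobian to be at least 1, so these truncations increase
  with n, and the terms in \<open>D\<close> form a coboundary. The exponent is finite because |df|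
  is bounded, which controls the positive part of the logarithm, while the total expansion along a
  branch is at least 1, so that the integral of the negative part is at most that of the positive
  part.\<close>

section \<open>Entropy and Rokhlin's lower bound\<close>

text \<open>\<open>part_ks_entropy\<close> is a \<open>lim\<close>, which has an arbitrary value if
  the sequence diverges, so convergence must precede any bound on entropy. Nonnegativity keeps the
  infimum finite; division of n by a nearly optimal m does the rest.\<close>

lemma fekete_convergent:
  fixes u :: "nat \<Rightarrow> real"
  assumes sub: "\<And>m n. u (m + n) \<le> u m + u n" and nonneg: "\<And>n. 0 \<le> u n"
  shows "convergent (\<lambda>n. u (Suc n) / real (Suc n))"
proof -
  define L where "L = (INF n. u (Suc n) / real (Suc n))"
  have bdd: "bdd_below (range (\<lambda>n. u (Suc n) / real (Suc n)))"
    by (intro bdd_belowI[of _ 0]) (auto simp: nonneg)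
  have lower: "L \<le> u (Suc n) / real (Suc n)" for n
    unfolding L_def by (rule cINF_lower[OF bdd]) simp
  have "(\<lambda>n. u (Suc n) / real (Suc n)) \<longlonglongrightarrow> L"
  proof (rule LIMSEQ_I)
    fix r :: real assume r: "0 < r"
    have "\<exists>x\<in>range (\<lambda>n. u (Suc n) / real (Suc n)). x < L + r / 2"
      unfolding L_def using r by (intro cInf_lessD) auto
    then obtain k where k: "u (Suc k) / real (Suc k) < L + r / 2" by auto
    define m where "m = Suc k"
    have m: "0 < m" "u m < (L + r/2) * m"
      using k by (auto simp: m_def field_simps)
    define B where "B = (\<Sum>i<m. u i)"
    have B: "u i \<le> B" if "i < m" for i
      unfolding B_def using that by (intro member_le_sum) (auto simp: nonneg)
    have B0: "0 \<le> B" unfolding B_def by (intro sum_nonneg) (auto simp: nonneg)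
    have mult: "u (q * m + i) \<le> q * u m + u i" for q i
    proof (induction q)
      case (Suc q)
      have "u (Suc q * m + i) \<le> u m + u (q * m + i)"
        using sub[of m "q * m + i"] by (simp add: algebra_simps)
      with Suc show ?case by (simp add: algebra_simps)
    qed simp
    have upper: "u n \<le> (L + r/2) * n + \<bar>L + r/2\<bar> * m + B" for n
    proof -
      have e: "n = (n div m) * m + n mod m" by simp
      have "u n \<le> (n div m) * u m + u (n mod m)"
        using mult[of "n div m" "n mod m"] e by simp
      also have "\<dots> \<le> (n div m) * ((L + r/2) * m) + B"
        using m B[of "n mod m"] by (intro add_mono mult_left_mono) auto
      also have "(n div m) * ((L + r/2) * m) = (L + r/2) * (real n - real (n mod m))"
      proof -
        have "real n = real (n div m) * real m + real (n mod m)"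
          by (metis e of_nat_add of_nat_mult)
        then show ?thesis by (simp add: algebra_simps)
      qed
      also have "\<dots> \<le> (L + r/2) * n + \<bar>L + r/2\<bar> * m"
      proof -
        have "- ((L + r/2) * real (n mod m)) \<le> \<bar>L + r/2\<bar> * real (n mod m)"
          by (metis abs_ge_minus_self abs_mult abs_of_nat)
        also have "\<dots> \<le> \<bar>L + r/2\<bar> * m" using m by (intro mult_left_mono) auto
        finally show ?thesis by (simp add: algebra_simps)
      qed
      finally show ?thesis by simp
    qed
    define C where "C = \<bar>L + r/2\<bar> * m + B"
    obtain N :: nat where N: "C / (r/2) < N" using reals_Archimedean2 by blast
    show "\<exists>no. \<forall>n\<ge>no. norm (u (Suc n) / real (Suc n) - L) < r"
    proof (intro exI allI impI)
      fix n assume n: "N \<le> n"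
      have "C < (r/2) * N" using N r by (simp add: field_simps)
      also have "\<dots> \<le> (r/2) * real (Suc n)" using n r by (intro mult_left_mono) auto
      finally have "C < (r/2) * real (Suc n)" .
      then have "u (Suc n) < (L + r) * real (Suc n)"
        using upper[of "Suc n"] unfolding C_def by (simp only: distrib_right)
      then have "u (Suc n) / real (Suc n) < L + r" by (simp add: divide_less_eq)
      then show "norm (u (Suc n) / real (Suc n) - L) < r"
        using lower[of n] r by simp
    qed
  qed
  then show ?thesis by (rule convergentI)
qed

section \<open>Elementary entropy inequalities for finite partitions\<close>

definition cylset :: "('a \<Rightarrow> 'a) \<Rightarrow> 'a measure \<Rightarrow> nat \<Rightarrow> (nat \<Rightarrow> 'a set) \<Rightarrow> 'a set" where
  "cylset T \<mu> n c = space \<mu> \<inter> (\<Inter>i<n. (T ^^ i) -` (c i))"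

lemma ent_fun_nonneg: "0 \<le> p \<Longrightarrow> p \<le> 1 \<Longrightarrow> 0 \<le> ent_fun p"
  by (auto simp: ent_fun_def mult_nonneg_nonpos)

text \<open>This is ln y <= y - 1 at y = p exp(s). The additional factor p is cancelled after
  integration over a set of measure p, where the correction p exp(s) - 1 integrates to something
  nonpositive.\<close>

lemma ent_fun_ge:
  assumes "0 < p"
  shows "p * s - p * (p * exp s - 1) \<le> ent_fun p"
proof -
  have "ln (p * exp s) \<le> p * exp s - 1" using assms by (intro ln_le_minus_one) auto
  then have "s + ln p \<le> p * exp s - 1" using assms by (simp add: ln_mult)
  then have "p * (s + ln p) \<le> p * (p * exp s - 1)" using assms by (intro mult_left_mono) auto
  then show ?thesis using assms by (simp add: ent_fun_def algebra_simps)
qed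

text \<open>Again ln y <= y - 1, now at y = p q / a, with a the mass of an intersection and p, q
  those of the two sets. The error p q - a cancels when summed over two partitions.\<close>

lemma ent_fun_cross:
  assumes "0 \<le> a" "a \<le> p" "a \<le> q"
  shows "ent_fun a \<le> a * (- ln p) + a * (- ln q) + p * q - a"
proof (cases "a = 0")
  case False
  then have pos: "0 < a" "0 < p" "0 < q" using assms by auto
  have "ln (p * q / a) \<le> p * q / a - 1" using pos by (intro ln_le_minus_one) auto
  then have "a * (ln p + ln q - ln a) \<le> a * (p * q / a - 1)"
    using pos by (intro mult_left_mono) (auto simp: ln_div ln_mult)
  also have "a * (p * q / a - 1) = p * q - a" using pos by (simp add: right_diff_distrib)
  finally show ?thesis using pos by (simp add: ent_fun_def algebra_simps)
qed (use assms in \<open>auto simp: ent_fun_def\<close>)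

text \<open>Subadditivity of entropy under joins without conditional entropy: the logarithmic terms
  of \<open>ent_fun_cross\<close> sum to the two marginal entropies, and the error terms sum to 1 *
  1 - 1 = 0. Indexed families are used because distinct indices may give the same empty set.\<close>

lemma (in prob_space) sum_ent_fun_Int_le:
  assumes fin: "finite I" "finite K"
    and disj: "disjoint_family_on A I" "disjoint_family_on B K"
    and cov: "(\<Union>i\<in>I. A i) = space M" "(\<Union>k\<in>K. B k) = space M"
    and meas: "\<And>i. i \<in> I \<Longrightarrow> A i \<in> sets M" "\<And>k. k \<in> K \<Longrightarrow> B k \<in> sets M"
  shows "(\<Sum>x\<in>I \<times> K. ent_fun (prob (A (fst x) \<inter> B (snd x))))
     \<le> (\<Sum>i\<in>I. ent_fun (prob (A i))) + (\<Sum>k\<in>K. ent_fun (prob (B k)))"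
proof -
  have total: "(\<Sum>k\<in>K. prob (E \<inter> B k)) = prob E" if "E \<in> sets M" for E
  proof -
    have "prob E = prob (\<Union>k\<in>K. E \<inter> B k)"
      using cov(2) sets.sets_into_space[OF that] by (intro arg_cong[of _ _ prob]) blast
    also have "\<dots> = (\<Sum>k\<in>K. prob (E \<inter> B k))"
    proof (rule finite_measure_finite_Union[OF fin(2)])
      show "(\<lambda>k. E \<inter> B k) ` K \<subseteq> sets M" using meas(2) that by auto
      show "disjoint_family_on (\<lambda>k. E \<inter> B k) K"
        using disj(2) by (rule disjoint_family_on_bisimulation) auto
    qed
    finally show ?thesis by simp
  qed
  have total': "(\<Sum>i\<in>I. prob (A i \<inter> E)) = prob E" if "E \<in> sets M" for E
  proof -
    have "prob E = prob (\<Union>i\<in>I. A i \<inter> E)"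
      using cov(1) sets.sets_into_space[OF that] by (intro arg_cong[of _ _ prob]) blast
    also have "\<dots> = (\<Sum>i\<in>I. prob (A i \<inter> E))"
    proof (rule finite_measure_finite_Union[OF fin(1)])
      show "(\<lambda>i. A i \<inter> E) ` I \<subseteq> sets M" using meas(1) that by auto
      show "disjoint_family_on (\<lambda>i. A i \<inter> E) I"
        using disj(1) by (rule disjoint_family_on_bisimulation) auto
    qed
    finally show ?thesis by simp
  qed
  have sumA: "(\<Sum>i\<in>I. prob (A i)) = 1"
    using total'[OF sets.top] sets.sets_into_space[OF meas(1)] by (simp add: Int_absorb2 prob_space)
  have sumB: "(\<Sum>k\<in>K. prob (B k)) = 1"
    using total[OF sets.top] sets.sets_into_space[OF meas(2)] by (simp add: Int_absorb1 prob_space)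
  have le: "prob (A i \<inter> B k) \<le> prob (A i)" "prob (A i \<inter> B k) \<le> prob (B k)" if "i \<in> I" "k \<in> K" for i k
    using that meas by (auto intro!: finite_measure_mono)
  have "(\<Sum>x\<in>I \<times> K. ent_fun (prob (A (fst x) \<inter> B (snd x))))
      = (\<Sum>i\<in>I. \<Sum>k\<in>K. ent_fun (prob (A i \<inter> B k)))"
    by (simp add: sum.cartesian_product case_prod_beta)
  also have "\<dots> \<le> (\<Sum>i\<in>I. \<Sum>k\<in>K. prob (A i \<inter> B k) * (- ln (prob (A i))) + prob (A i \<inter> B k) * (- ln (prob (B k)))
      + prob (A i) * prob (B k) - prob (A i \<inter> B k))"
  proof (intro sum_mono)
    fix i k assume ik: "i \<in> I" "k \<in> K"
    show "ent_fun (prob (A i \<inter> B k)) \<le> prob (A i \<inter> B k) * (- ln (prob (A i)))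
        + prob (A i \<inter> B k) * (- ln (prob (B k))) + prob (A i) * prob (B k) - prob (A i \<inter> B k)"
      by (rule ent_fun_cross[OF _ le[OF ik]]) simp
  qed
  also have "\<dots> = (\<Sum>i\<in>I. (\<Sum>k\<in>K. prob (A i \<inter> B k)) * (- ln (prob (A i))))
      + (\<Sum>k\<in>K. (\<Sum>i\<in>I. prob (A i \<inter> B k)) * (- ln (prob (B k))))
      + (\<Sum>i\<in>I. prob (A i)) * (\<Sum>k\<in>K. prob (B k)) - (\<Sum>i\<in>I. \<Sum>k\<in>K. prob (A i \<inter> B k))"
  proof -
    have "(\<Sum>k\<in>K. (\<Sum>i\<in>I. prob (A i \<inter> B k)) * (- ln (prob (B k))))
        = (\<Sum>i\<in>I. \<Sum>k\<in>K. prob (A i \<inter> B k) * (- ln (prob (B k))))"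
      unfolding sum_distrib_right by (rule sum.swap)
    then show ?thesis
      by (simp only: sum.distrib sum_subtractf sum_distrib_right[of _ K] sum_product)
  qed
  also have "\<dots> = (\<Sum>i\<in>I. prob (A i) * (- ln (prob (A i)))) + (\<Sum>k\<in>K. prob (B k) * (- ln (prob (B k))))"
    using meas by (simp add: total total' sumA sumB)
  also have "\<dots> = (\<Sum>i\<in>I. ent_fun (prob (A i))) + (\<Sum>k\<in>K. ent_fun (prob (B k)))"
    by (intro arg_cong2[where f = "(+)"] sum.cong) (auto simp: ent_fun_def)
  finally show ?thesis .
qed

text \<open>In effect Jensen's inequality: the mean of \<open>s\<close> over \<open>C\<close> is at
  most the logarithm of the mean of exp(s), which is at most 1 / \<open>prob C\<close>. The bound
  \<open>K\<close> serves integrability.\<close>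

lemma (in prob_space) set_integral_le_ent_fun:
  assumes C [measurable]: "C \<in> sets M" and s [measurable]: "s \<in> borel_measurable M"
    and bd: "\<And>x. x \<in> space M \<Longrightarrow> \<bar>s x\<bar> \<le> K"
    and exp_le: "(\<integral>\<^sup>+x. ennreal (exp (s x)) * indicator C x \<partial>M) \<le> 1"
  shows "(\<integral>x\<in>C. s x \<partial>M) \<le> ent_fun (prob C)"
proof (cases "prob C = 0")
  case True
  then have "AE x in M. x \<notin> C" using C by (simp add: prob_eq_0)
  then have "(\<integral>x\<in>C. s x \<partial>M) = 0"
    unfolding set_lebesgue_integral_def
    by (intro integral_eq_zero_AE) (auto elim!: eventually_mono)
  then show ?thesis using True by (simp add: ent_fun_def)
next
  case False
  then have p: "0 < prob C" by (simp add: zero_less_measure_iff)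
  define p where "p = prob C"
  define a where "a x = indicat_real C x * s x" for x
  define e where "e x = indicat_real C x * exp (s x)" for x
  define i where "i x = indicat_real C x" for x
  have "integrable M s"
    using bd by (intro integrable_const_bound[of _ K]) auto
  then have a: "integrable M a"
    unfolding a_def using integrable_mult_indicator[OF C, of s] by simp
  have "integrable M (\<lambda>x. exp (s x))"
    using bd by (intro integrable_const_bound[of _ "exp K"]) fastforce+
  then have e: "integrable M e"
    unfolding e_def using integrable_mult_indicator[OF C, of "\<lambda>x. exp (s x)"] by simp
  have i: "integrable M i" "(\<integral>x. i x \<partial>M) = p"
    unfolding i_def p_def using emeasure_finite[of C] C
    by (auto intro!: integrable_real_indicator simp: less_top[symmetric])
  have "ennreal (\<integral>x. e x \<partial>M) = (\<integral>\<^sup>+x. ennreal (e x) \<partial>M)"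
    by (rule nn_integral_eq_integral[OF e, symmetric]) (simp add: e_def)
  also have "\<dots> = (\<integral>\<^sup>+x. ennreal (exp (s x)) * indicator C x \<partial>M)"
    by (intro nn_integral_cong) (simp add: e_def indicator_def)
  also have "\<dots> \<le> 1" by (rule exp_le)
  finally have e1: "(\<integral>x. e x \<partial>M) \<le> 1" by simp
  \<comment> \<open>The pointwise bound of \<open>ent_fun_ge\<close> is integrated over
    \<open>C\<close>; dividing by p and dropping the nonpositive correction gives the claim.\<close>
  have "p * (\<integral>x. a x \<partial>M) - p * (p * (\<integral>x. e x \<partial>M) - p)
      = (\<integral>x. p * a x - p * (p * e x - i x) \<partial>M)"
    using a e i by simp
  also have "\<dots> \<le> (\<integral>x. i x * ent_fun p \<partial>M)"
  proof (rule integral_mono)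
    show "p * a x - p * (p * e x - i x) \<le> i x * ent_fun p" for x
      using ent_fun_ge[OF p, of "s x"] by (simp add: a_def e_def i_def p_def indicator_def)
  qed (use a e i in simp_all)
  also have "\<dots> = p * ent_fun p" using i by simp
  finally have "p * ((\<integral>x. a x \<partial>M) - (p * (\<integral>x. e x \<partial>M) - p)) \<le> p * ent_fun p"
    by (simp add: right_diff_distrib)
  then have "(\<integral>x. a x \<partial>M) - (p * (\<integral>x. e x \<partial>M) - p) \<le> ent_fun p"
    using p unfolding p_def[symmetric] by (simp add: mult_le_cancel_left)
  moreover have "p * (\<integral>x. e x \<partial>M) \<le> p * 1"
    using e1 p by (intro mult_left_mono) (auto simp: p_def)
  ultimately have "(\<integral>x. a x \<partial>M) \<le> ent_fun p" by simp
  then show ?thesis by (simp add: set_lebesgue_integral_def a_def p_def)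
qed

section \<open>Measure-preserving maps and the entropy of a finite partition\<close>

locale mpt = prob_space M for M :: "'a measure" +
  fixes T :: "'a \<Rightarrow> 'a"
  assumes T_meas [measurable]: "T \<in> M \<rightarrow>\<^sub>M M"
    and T_distr: "distr M M T = M"
begin

lemma Tn_meas [measurable]: "T ^^ n \<in> M \<rightarrow>\<^sub>M M"
  by (induction n) (auto simp: id_def comp_def)

lemma Tn_space: "x \<in> space M \<Longrightarrow> (T ^^ n) x \<in> space M"
  using measurable_space[OF Tn_meas] .

lemma Tn_distr: "distr M M (T ^^ n) = M"
proof (induction n)
  case (Suc n)
  have "distr M M (T ^^ Suc n) = distr (distr M M (T ^^ n)) M T"
    using distr_distr[OF T_meas Tn_meas[of n]] by (simp only: funpow.simps)
  then show ?case using Suc T_distr by (simp del: funpow.simps)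
qed (simp add: id_def)

lemma prob_Tn:
  assumes "A \<in> sets M"
  shows "prob ((T ^^ n) -` A \<inter> space M) = prob A"
  using arg_cong[OF Tn_distr[of n], of "\<lambda>N. measure N A"] assms by (simp add: measure_distr)

lemma nn_integral_T:
  assumes "u \<in> borel_measurable M"
  shows "(\<integral>\<^sup>+x. u (T x) \<partial>M) = (\<integral>\<^sup>+x. u x \<partial>M)"
  using assms by (subst (2) T_distr[symmetric]) (simp add: nn_integral_distr)

lemma integral_T:
  fixes u :: "'a \<Rightarrow> real"
  assumes "u \<in> borel_measurable M"
  shows "(\<integral>x. u (T x) \<partial>M) = (\<integral>x. u x \<partial>M)"
  using assms by (subst (2) T_distr[symmetric]) (simp add: integral_distr)

lemma integral_Tn:
  fixes u :: "'a \<Rightarrow> real"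
  assumes "u \<in> borel_measurable M"
  shows "(\<integral>x. u ((T ^^ n) x) \<partial>M) = (\<integral>x. u x \<partial>M)"
  using assms by (subst (2) Tn_distr[of n, symmetric]) (simp add: integral_distr)

end

locale mpt_partition = mpt +
  fixes P :: "'a set set"
  assumes P: "meas_partition M P"
begin

lemma P_finite: "finite P" and P_sets: "A \<in> P \<Longrightarrow> A \<in> sets M"
  and P_disj: "disjoint P" and P_space: "\<Union>P = space M"
  using P by (auto simp: meas_partition_def)

text \<open>Extensional functions, so that there are finitely many words and two words agreeing
  below n are equal; \<open>iter_join\<close> lets its choice function be arbitrary beyond
  n.\<close>

definition words :: "nat \<Rightarrow> (nat \<Rightarrow> 'a set) set" where
  "words n = PiE {..<n} (\<lambda>_. P)"

lemma finite_words: "finite (words n)"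
  unfolding words_def by (intro finite_PiE) (auto simp: P_finite)

lemma wordsD: "c \<in> words n \<Longrightarrow> i < n \<Longrightarrow> c i \<in> P"
  by (auto simp: words_def)

lemma iter_join_eq: "iter_join T M P n = cylset T M n ` words n"
proof
  show "iter_join T M P n \<subseteq> cylset T M n ` words n"
  proof
    fix A assume "A \<in> iter_join T M P n"
    then obtain c where c: "A = cylset T M n c" "\<forall>i<n. c i \<in> P"
      by (auto simp: iter_join_def cylset_def)
    have "restrict c {..<n} \<in> words n" using c by (auto simp: words_def)
    moreover have "cylset T M n (restrict c {..<n}) = A" using c by (auto simp: cylset_def)
    ultimately show "A \<in> cylset T M n ` words n" by auto
  qed
  show "cylset T M n ` words n \<subseteq> iter_join T M P n"
    by (auto simp: iter_join_def cylset_def dest: wordsD)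
qed

lemma cylset_sets:
  assumes "\<And>i. i < n \<Longrightarrow> c i \<in> sets M"
  shows "cylset T M n c \<in> sets M"
proof -
  have "cylset T M n c = {x\<in>space M. \<forall>i<n. (T ^^ i) x \<in> c i}" by (auto simp: cylset_def)
  also have "\<dots> \<in> sets M"
  proof -
    have "{x\<in>space M. \<forall>i\<in>{..<n}. (T ^^ i) x \<in> c i} \<in> sets M"
    proof (intro sets.sets_Collect_finite_All)
      fix i assume "i \<in> {..<n}"
      then have "(T ^^ i) -` c i \<inter> space M \<in> sets M" using assms by (intro measurable_sets[OF Tn_meas]) auto
      also have "(T ^^ i) -` c i \<inter> space M = {x\<in>space M. (T ^^ i) x \<in> c i}" by auto
      finally show "{x\<in>space M. (T ^^ i) x \<in> c i} \<in> sets M" .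
    qed auto
    then show ?thesis by (simp only: Ball_def lessThan_iff)
  qed
  finally show ?thesis .
qed

lemma cyl_sets: "c \<in> words n \<Longrightarrow> cylset T M n c \<in> sets M"
  by (intro cylset_sets P_sets) (auto dest: wordsD)

lemma cyl_disj:
  assumes "c \<in> words n" "c' \<in> words n" "c \<noteq> c'"
  shows "cylset T M n c \<inter> cylset T M n c' = {}"
proof -
  obtain i where i: "i < n" "c i \<noteq> c' i"
    using assms unfolding words_def by (metis PiE_ext lessThan_iff)
  then have "c i \<inter> c' i = {}" using P_disj wordsD[OF assms(1)] wordsD[OF assms(2)]
    by (meson disjointD)
  then show ?thesis using i by (auto simp: cylset_def)
qed

lemma cyl_cover: "(\<Union>c\<in>words n. cylset T M n c) = space M"
proof
  show "space M \<subseteq> (\<Union>c\<in>words n. cylset T M n c)"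
  proof
    fix x assume x: "x \<in> space M"
    have "\<exists>A\<in>P. (T ^^ i) x \<in> A" for i using Tn_space[OF x, of i] P_space by auto
    then obtain c where c: "\<And>i. c i \<in> P" "\<And>i. (T ^^ i) x \<in> c i" by metis
    have "restrict c {..<n} \<in> words n" using c by (auto simp: words_def)
    moreover have "x \<in> cylset T M n (restrict c {..<n})" using c x by (auto simp: cylset_def)
    ultimately show "x \<in> (\<Union>c\<in>words n. cylset T M n c)" by blast
  qed
qed (auto simp: cylset_def)

text \<open>\<open>iter_join\<close> is a set of sets, so words with equal cylinders are merged in
  it. Distinct words have disjoint cylinders, hence only the empty one can be repeated, and its term
  is \<open>ent_fun 0 = 0\<close>.\<close>

lemma part_entropy_eq:
  "part_entropy M (iter_join T M P n) = (\<Sum>c\<in>words n. ent_fun (prob (cylset T M n c)))"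
  unfolding part_entropy_def iter_join_eq
proof (subst sum.reindex_nontrivial)
  fix c c' assume "c \<in> words n" "c' \<in> words n" "c \<noteq> c'" "cylset T M n c = cylset T M n c'"
  then have "cylset T M n c = {}" using cyl_disj[of c n c'] by auto
  then show "ent_fun (prob (cylset T M n c)) = 0" by (simp add: ent_fun_def)
qed (auto simp: finite_words)

lemma part_entropy_nonneg: "0 \<le> part_entropy M (iter_join T M P n)"
  unfolding part_entropy_eq by (intro sum_nonneg ent_fun_nonneg) auto

lemma mem_cylset: "x \<in> cylset T M n c \<longleftrightarrow> x \<in> space M \<and> (\<forall>i<n. (T ^^ i) x \<in> c i)"
  by (auto simp: cylset_def)

lemma cyl_add:
  "cylset T M (m + n) c = cylset T M m c \<inter> ((T ^^ m) -` cylset T M n (\<lambda>i. c (m + i)) \<inter> space M)"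
proof -
  have "(\<forall>i<m+n. Q i) \<longleftrightarrow> (\<forall>i<m. Q i) \<and> (\<forall>i<n. Q (m + i))" for Q :: "nat \<Rightarrow> bool"
    by (metis add_diff_inverse_nat nat_add_left_cancel_less trans_less_add1)
  note split = this
  have "(T ^^ (m + i)) x = (T ^^ i) ((T ^^ m) x)" for i x
    by (simp add: add.commute[of m] funpow_add)
  then show ?thesis
    by (auto simp only: mem_cylset split Int_iff vimage_eq set_eq_iff Tn_space)
qed

lemma cylset_cong: "(\<And>i. i < n \<Longrightarrow> c i = c' i) \<Longrightarrow> cylset T M n c = cylset T M n c'"
  by (auto simp: cylset_def)

text \<open>A word of length m + n is a pair of words; its cylinder is the first cylinder
  intersected with the preimage under T^m of the second, and invariance gives that preimage the same
  mass.\<close>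

lemma part_entropy_subadditive:
  "part_entropy M (iter_join T M P (m + n))
     \<le> part_entropy M (iter_join T M P m) + part_entropy M (iter_join T M P n)"
proof -
  \<comment> \<open>Concatenation of words; the value \<open>undefined\<close> from m + n on keeps
    the result extensional, hence in \<open>words (m + n)\<close>.\<close>
  define app where "app = (\<lambda>(w, v). \<lambda>i. if i < m then w i else if i < m + n then v (i - m) else (undefined :: 'a set))"
  define B where "B v = (T ^^ m) -` cylset T M n v \<inter> space M" for v
  have cyl: "cylset T M (m + n) (app (w, v)) = cylset T M m w \<inter> B v" for w v
  proof -
    have "cylset T M m (app (w, v)) = cylset T M m w"
      by (rule cylset_cong) (simp add: app_def)
    moreover have "cylset T M n (\<lambda>i. app (w, v) (m + i)) = cylset T M n v"
      by (rule cylset_cong) (simp add: app_def)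
    ultimately show ?thesis by (simp add: cyl_add B_def)
  qed
  have "part_entropy M (iter_join T M P (m + n))
      = (\<Sum>x\<in>words m \<times> words n. ent_fun (prob (cylset T M (m + n) (app x))))"
    unfolding part_entropy_eq
  proof (rule sum.reindex_bij_witness[where j = "\<lambda>c. (restrict c {..<m}, restrict (\<lambda>i. c (m + i)) {..<n})" and i = app])
    fix c assume c: "c \<in> words (m + n)"
    show eq: "app (restrict c {..<m}, restrict (\<lambda>i. c (m + i)) {..<n}) = c"
    proof
      fix i show "app (restrict c {..<m}, restrict (\<lambda>i. c (m + i)) {..<n}) i = c i"
        using c PiE_arb[of c "{..<m + n}" "\<lambda>_. P" i] by (cases "i < m + n") (auto simp: app_def words_def)
    qed
    show "(restrict c {..<m}, restrict (\<lambda>i. c (m + i)) {..<n}) \<in> words m \<times> words n"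
      using c by (auto simp: words_def)
    show "ent_fun (prob (cylset T M (m + n) (app (restrict c {..<m}, restrict (\<lambda>i. c (m + i)) {..<n}))))
         = ent_fun (prob (cylset T M (m + n) c))" by (simp only: eq)
  next
    fix x assume x: "x \<in> words m \<times> words n"
    show "(restrict (app x) {..<m}, restrict (\<lambda>i. app x (m + i)) {..<n}) = x"
    proof -
      have "restrict (app x) {..<m} = fst x"
      proof
        fix i show "restrict (app x) {..<m} i = fst x i"
          using x PiE_arb[of "fst x" "{..<m}" "\<lambda>_. P" i]
          by (cases "i < m") (auto simp: app_def words_def case_prod_beta)
      qed
      moreover have "restrict (\<lambda>i. app x (m + i)) {..<n} = snd x"
      proof
        fix i show "restrict (\<lambda>i. app x (m + i)) {..<n} i = snd x i"
          using x PiE_arb[of "snd x" "{..<n}" "\<lambda>_. P" i]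
          by (cases "i < n") (auto simp: app_def words_def case_prod_beta)
      qed
      ultimately show ?thesis by simp
    qed
    show "app x \<in> words (m + n)"
    proof -
      have "app x i \<in> P" if "i < m + n" for i
        using x that by (cases "i < m") (auto simp: app_def words_def case_prod_beta)
      moreover have "app x i = undefined" if "\<not> i < m + n" for i
        using that by (auto simp: app_def case_prod_beta)
      ultimately show ?thesis unfolding words_def by (intro PiE_I) auto
    qed
  qed
  also have "\<dots> = (\<Sum>x\<in>words m \<times> words n. ent_fun (prob (cylset T M m (fst x) \<inter> B (snd x))))"
    by (intro sum.cong) (auto simp: cyl)
  also have "\<dots> \<le> (\<Sum>w\<in>words m. ent_fun (prob (cylset T M m w))) + (\<Sum>v\<in>words n. ent_fun (prob (B v)))"
  proof (rule sum_ent_fun_Int_le)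
    show "disjoint_family_on (cylset T M m) (words m)"
      using cyl_disj by (auto simp: disjoint_family_on_def)
    show "disjoint_family_on B (words n)"
      using cyl_disj by (auto simp: disjoint_family_on_def B_def set_eq_iff)
    show "(\<Union>v\<in>words n. B v) = space M"
      unfolding B_def vimage_UN[symmetric] UN_extend_simps(4)[symmetric]
      using cyl_cover[of n] Tn_space[of _ m] by auto
    show "B v \<in> sets M" if "v \<in> words n" for v
      unfolding B_def using cyl_sets[OF that] by (intro measurable_sets[OF Tn_meas])
  qed (auto simp: finite_words cyl_cover cyl_sets)
  also have "(\<Sum>v\<in>words n. ent_fun (prob (B v))) = (\<Sum>v\<in>words n. ent_fun (prob (cylset T M n v)))"
    unfolding B_def by (intro sum.cong refl) (simp add: prob_Tn cyl_sets)
  finally show ?thesis by (simp add: part_entropy_eq)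
qed

lemma part_ks_entropy_ge:
  assumes "\<And>n. real n * l \<le> part_entropy M (iter_join T M P n)"
  shows "l \<le> part_ks_entropy T M P"
proof -
  let ?H = "\<lambda>n. part_entropy M (iter_join T M P (Suc n)) / real (Suc n)"
  have "convergent ?H"
    by (rule fekete_convergent) (auto simp: part_entropy_subadditive part_entropy_nonneg)
  then have "?H \<longlonglongrightarrow> part_ks_entropy T M P"
    unfolding part_ks_entropy_def by (simp add: convergent_LIMSEQ_iff)
  moreover have "l \<le> ?H n" for n
    using assms[of "Suc n"] by (subst le_divide_eq) (simp add: mult.commute)
  ultimately show ?thesis by (auto intro: LIMSEQ_le_const)
qed

text \<open>Hypothesis \<open>G\<close> says that exp(g) is dominated by the Jacobian of
  \<open>T\<close> on each atom: if \<open>T\<close> is injective on \<open>A\<close>, integrating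
  the Jacobian times u o T over \<open>A\<close> gives the integral of u over the image. Peeling off
  the first letter then bounds the weight exp of the Birkhoff sum over one cylinder by the total
  mass.\<close>

lemma nn_integral_cyl_le_1:
  assumes g [measurable]: "g \<in> borel_measurable M"
    and G: "\<And>A u. A \<in> P \<Longrightarrow> u \<in> borel_measurable M \<Longrightarrow>
        (\<integral>\<^sup>+x. ennreal (exp (g x)) * u (T x) * indicator A x \<partial>M) \<le> (\<integral>\<^sup>+x. u x \<partial>M)"
    and "\<And>i. i < n \<Longrightarrow> c i \<in> P"
  shows "(\<integral>\<^sup>+x. ennreal (exp (\<Sum>i<n. g ((T ^^ i) x))) * indicator (cylset T M n c) x \<partial>M) \<le> 1"
  using assms(3)
proof (induction n arbitrary: c)
  case 0
  have "cylset T M 0 c = space M" by (simp add: cylset_def)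
  then show ?case by (simp add: emeasure_space_1)
next
  case (Suc n)
  \<comment> \<open>The remaining factor of the integrand: the tail of the Birkhoff sum on the
    cylinder of the shifted word. Composed with \<open>T\<close> it is the function to which
    \<open>G\<close> applies.\<close>
  let ?u = "\<lambda>x. ennreal (exp (\<Sum>i<n. g ((T ^^ i) x))) * indicator (cylset T M n (\<lambda>i. c (Suc i))) x"
  have cs: "cylset T M n (\<lambda>i. c (Suc i)) \<in> sets M"
    using Suc.prems by (intro cylset_sets P_sets) auto
  then have u: "?u \<in> borel_measurable M" by measurable
  have "cylset T M (Suc n) c = c 0 \<inter> (T -` cylset T M n (\<lambda>i. c (Suc i)) \<inter> space M)"
    using cyl_add[of 1 n c] Suc.prems[of 0] sets.sets_into_space[OF P_sets]
    by (auto simp: cylset_def)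
  then have "(\<integral>\<^sup>+x. ennreal (exp (\<Sum>i<Suc n. g ((T ^^ i) x))) * indicator (cylset T M (Suc n) c) x \<partial>M)
      = (\<integral>\<^sup>+x. ennreal (exp (g x)) * ?u (T x) * indicator (c 0) x \<partial>M)"
    by (intro nn_integral_cong)
       (auto simp: sum.lessThan_Suc_shift exp_add ennreal_mult funpow_Suc_right indicator_def
             simp del: sum.lessThan_Suc funpow.simps)
  also have "\<dots> \<le> (\<integral>\<^sup>+x. ?u x \<partial>M)" using Suc.prems u by (intro G) auto
  also have "\<dots> \<le> 1" using Suc.prems by (intro Suc.IH) auto
  finally show ?case .
qed

text \<open>Rokhlin's lower bound: instead of conditional entropies it uses only the inequality
  \<open>s \<le> ln (1/p) + (p e\<^sup>s - 1)\<close> on each cylinder of measure \<open>p\<close>, with \<open>s\<close> the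
  Birkhoff sum of \<open>g\<close>.\<close>

lemma part_entropy_ge:
  assumes g [measurable]: "g \<in> borel_measurable M" and bd: "\<And>x. x \<in> space M \<Longrightarrow> \<bar>g x\<bar> \<le> K"
    and G: "\<And>A u. A \<in> P \<Longrightarrow> u \<in> borel_measurable M \<Longrightarrow>
        (\<integral>\<^sup>+x. ennreal (exp (g x)) * u (T x) * indicator A x \<partial>M) \<le> (\<integral>\<^sup>+x. u x \<partial>M)"
  shows "real n * (\<integral>x. g x \<partial>M) \<le> part_entropy M (iter_join T M P n)"
proof -
  define s where "s x = (\<Sum>i<n. g ((T ^^ i) x))" for x
  have s_meas [measurable]: "s \<in> borel_measurable M" unfolding s_def by measurable
  have s_bd: "\<bar>s x\<bar> \<le> real n * K" if "x \<in> space M" for x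
  proof -
    have "\<bar>s x\<bar> \<le> (\<Sum>i<n. \<bar>g ((T ^^ i) x)\<bar>)" unfolding s_def by (rule sum_abs)
    also have "\<dots> \<le> (\<Sum>i<n. K)" using that by (intro sum_mono bd Tn_space)
    finally show ?thesis by simp
  qed
  have int_s: "integrable M s"
    using s_bd by (intro integrable_const_bound[of _ "real n * K"]) auto
  have int_g: "integrable M (\<lambda>x. g ((T ^^ i) x))" for i
    using bd Tn_space by (intro integrable_const_bound[of _ K]) auto
  have int_es: "integrable M (\<lambda>x. exp (s x))"
    using s_bd by (intro integrable_const_bound[of _ "exp (real n * K)"]) fastforce+
  have "real n * (\<integral>x. g x \<partial>M) = (\<Sum>i<n. \<integral>x. g ((T ^^ i) x) \<partial>M)"
    by (simp add: integral_Tn)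
  also have "\<dots> = (\<integral>x. s x \<partial>M)"
    unfolding s_def using int_g by (simp add: Bochner_Integration.integral_sum)
  also have "\<dots> = (\<Sum>c\<in>words n. \<integral>x\<in>cylset T M n c. s x \<partial>M)"
  proof -
    have "(\<integral>x. s x \<partial>M) = (\<integral>x\<in>(\<Union>c\<in>words n. cylset T M n c). s x \<partial>M)"
      unfolding cyl_cover using int_s by (simp add: set_integral_space)
    also have "\<dots> = (\<Sum>c\<in>words n. \<integral>x\<in>cylset T M n c. s x \<partial>M)"
    proof (rule set_integral_finite_Union)
      show "disjoint_family_on (cylset T M n) (words n)"
        using cyl_disj by (auto simp: disjoint_family_on_def)
      fix c assume "c \<in> words n"
      then show "set_integrable M (cylset T M n c) s" "cylset T M n c \<in> sets M"
        using int_s cyl_sets integrable_mult_indicator unfolding set_integrable_def by blast+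
    qed (rule finite_words)
    finally show ?thesis .
  qed
  also have "\<dots> \<le> (\<Sum>c\<in>words n. ent_fun (prob (cylset T M n c)))"
  proof (rule sum_mono)
    fix c assume c: "c \<in> words n"
    show "(\<integral>x\<in>cylset T M n c. s x \<partial>M) \<le> ent_fun (prob (cylset T M n c))"
    proof (rule set_integral_le_ent_fun[OF cyl_sets[OF c] s_meas s_bd])
      show "(\<integral>\<^sup>+x. ennreal (exp (s x)) * indicator (cylset T M n c) x \<partial>M) \<le> 1"
        unfolding s_def using wordsD[OF c] by (intro nn_integral_cyl_le_1 g G)
    qed
  qed
  finally show ?thesis by (simp add: part_entropy_eq)
qed

lemma ks_entropy_ge:
  assumes "g \<in> borel_measurable M" "\<And>x. x \<in> space M \<Longrightarrow> \<bar>g x\<bar> \<le> K"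
    and "\<And>A u. A \<in> P \<Longrightarrow> u \<in> borel_measurable M \<Longrightarrow>
        (\<integral>\<^sup>+x. ennreal (exp (g x)) * u (T x) * indicator A x \<partial>M) \<le> (\<integral>\<^sup>+x. u x \<partial>M)"
  shows "ereal (\<integral>x. g x \<partial>M) \<le> ks_entropy T M"
proof -
  have "real n * (\<integral>x. g x \<partial>M) \<le> part_entropy M (iter_join T M P n)" for n
    by (rule part_entropy_ge[OF assms(1,2)]) (simp_all add: assms(3))
  then have "ereal (\<integral>x. g x \<partial>M) \<le> ereal (part_ks_entropy T M P)"
    using part_ks_entropy_ge by simp
  also have "\<dots> \<le> ks_entropy T M"
    unfolding ks_entropy_def using P by (intro SUP_upper) auto
  finally show ?thesis .
qed

end

section \<open>Change of variables and absolutely continuous invariant measures\<close>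

text \<open>The change of variables theorem for the constant function 1, that is, the area formula.
  Boundedness of the image makes 1 integrable on it.\<close>

lemma nn_integral_abs_deriv:
  fixes g g' :: "real \<Rightarrow> real"
  assumes A: "A \<in> sets lebesgue"
    and der: "\<And>x. x \<in> A \<Longrightarrow> (g has_real_derivative g' x) (at x within A)"
    and inj: "inj_on g A" and bd: "bounded (g ` A)"
  shows "(\<integral>\<^sup>+x. ennreal \<bar>g' x\<bar> * indicator A x \<partial>lborel) = emeasure lebesgue (g ` A)"
proof -
  have "g differentiable_on A"
    using der unfolding differentiable_on_def by (auto simp: real_differentiable_def)
  then have "g ` A \<in> sets lebesgue"
    by (intro differentiable_image_in_sets_lebesgue A) auto
  then have lm: "g ` A \<in> lmeasurable" by (intro bounded_set_imp_lmeasurable bd)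
  then have "(\<lambda>x. 1::real) absolutely_integrable_on g ` A"
    by (intro nonnegative_absolutely_integrable_1 integrable_on_const) auto
  moreover have "integral (g ` A) (\<lambda>x. 1::real) = measure lebesgue (g ` A)"
    using lm by (simp add: lmeasure_integral)
  ultimately have "(\<lambda>x. \<bar>g' x\<bar> * 1) absolutely_integrable_on A \<and>
      integral A (\<lambda>x. \<bar>g' x\<bar> * 1) = measure lebesgue (g ` A)"
    by (subst has_absolute_integral_change_of_variables_1'[OF A der inj]) auto
  then have "((\<lambda>x. \<bar>g' x\<bar>) has_integral measure lebesgue (g ` A)) A"
    by (auto simp: has_integral_iff absolutely_integrable_on_def)
  then have "(\<integral>\<^sup>+x. ennreal \<bar>g' x\<bar> * indicator A x \<partial>lborel) = ennreal (measure lebesgue (g ` A))"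
    by (intro nn_integral_has_integral_lebesgue') auto
  also have "\<dots> = emeasure lebesgue (g ` A)"
    using lm by (simp add: emeasure_eq_measure2)
  finally show ?thesis .
qed

text \<open>Both sides are integrals of \<open>u\<close> against Borel measures: the image under
  \<open>g\<close> of |g'| times Lebesgue measure on \<open>A\<close>, and Lebesgue measure on the
  image of \<open>A\<close>. The area formula on the part of \<open>A\<close> mapped into
  \<open>B\<close> shows that they agree on every Borel \<open>B\<close>, so no integrability of
  \<open>u\<close> is required.\<close>

lemma nn_integral_substitution_inj:
  fixes g g' :: "real \<Rightarrow> real" and u :: "real \<Rightarrow> ennreal"
  assumes A: "A \<in> sets borel"
    and g: "g \<in> borel_measurable (restrict_space borel A)"
    and g': "g' \<in> borel_measurable (restrict_space borel A)"
    and der: "\<And>x. x \<in> A \<Longrightarrow> (g has_real_derivative g' x) (at x within A)"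
    and inj: "inj_on g A" and bd: "bounded (g ` A)" and im: "g ` A \<in> sets borel"
    and u: "u \<in> borel_measurable borel"
  shows "(\<integral>\<^sup>+x. ennreal \<bar>g' x\<bar> * u (g x) * indicator A x \<partial>lborel)
       = (\<integral>\<^sup>+y. u y * indicator (g ` A) y \<partial>lborel)"
proof -
  let ?R = "restrict_space lborel A"
  have A': "A \<inter> space lborel \<in> sets lborel" using A by simp
  have setsR: "sets ?R = sets (restrict_space borel A)"
    by (simp add: sets_restrict_space)
  have g1 [measurable]: "g \<in> ?R \<rightarrow>\<^sub>M borel" and g2 [measurable]: "g' \<in> ?R \<rightarrow>\<^sub>M borel"
    using g g' by (simp_all add: measurable_cong_sets[OF setsR refl])
  define K where "K = distr (density ?R (\<lambda>x. ennreal \<bar>g' x\<bar>)) lborel g"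
  have "K = density lborel (indicator (g ` A))"
  proof (rule measure_eqI)
    fix B assume "B \<in> sets K"
    then have B [measurable]: "B \<in> sets borel" by (simp add: K_def)
    have AB: "A \<inter> g -` B \<in> sets borel"
    proof -
      have "g -` B \<inter> space ?R \<in> sets ?R" using g1 B by (rule measurable_sets)
      then show ?thesis using A by (simp add: sets_restrict_space_iff space_restrict_space Int_commute)
    qed
    have "emeasure K B = (\<integral>\<^sup>+x. ennreal \<bar>g' x\<bar> * indicator (g -` B \<inter> space ?R) x \<partial>?R)"
      unfolding K_def by (subst emeasure_distr) (auto simp: emeasure_density)
    also have "\<dots> = (\<integral>\<^sup>+x. ennreal \<bar>g' x\<bar> * indicator (A \<inter> g -` B) x \<partial>lborel)"
      using A by (subst nn_integral_restrict_space) (auto intro!: nn_integral_cong simp: indicator_def space_restrict_space)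
    also have "\<dots> = emeasure lebesgue (g ` (A \<inter> g -` B))"
    proof (rule nn_integral_abs_deriv)
      show "A \<inter> g -` B \<in> sets lebesgue" using AB by simp
      show "(g has_real_derivative g' x) (at x within A \<inter> g -` B)" if "x \<in> A \<inter> g -` B" for x
        using der[of x] that by (auto intro: DERIV_subset)
      show "inj_on g (A \<inter> g -` B)" using inj by (rule inj_on_subset) auto
      show "bounded (g ` (A \<inter> g -` B))" using bd by (rule bounded_subset) auto
    qed
    also have "g ` (A \<inter> g -` B) = g ` A \<inter> B" by auto
    also have "emeasure lebesgue (g ` A \<inter> B) = emeasure (density lborel (indicator (g ` A))) B"
      using im by (simp add: emeasure_density nn_integral_indicator Int_commute indicator_inter_arith[symmetric])
    finally show "emeasure K B = emeasure (density lborel (indicator (g ` A))) B" .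
  qed (simp add: K_def)
  moreover have "(\<integral>\<^sup>+y. u y \<partial>K) = (\<integral>\<^sup>+x. ennreal \<bar>g' x\<bar> * u (g x) * indicator A x \<partial>lborel)"
    unfolding K_def using u A by (subst nn_integral_distr) (auto simp: nn_integral_density nn_integral_restrict_space)
  moreover have "(\<integral>\<^sup>+y. u y \<partial>density lborel (indicator (g ` A))) = (\<integral>\<^sup>+y. u y * indicator (g ` A) y \<partial>lborel)"
    using u im by (subst nn_integral_density) (auto simp: mult.commute)
  ultimately show ?thesis by simp
qed

lemma inj_on_deriv_nonzero:
  fixes f df :: "real \<Rightarrow> real"
  assumes der: "\<And>x. x \<in> {a..b} \<Longrightarrow> (f has_real_derivative df x) (at x within {a..b})"
    and nz: "\<And>x. x \<in> {a..b} \<Longrightarrow> df x \<noteq> 0"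
  shows "inj_on f {a..b}"
proof (rule linorder_inj_onI)
  fix x y assume xy: "x < y" "x \<in> {a..b}" "y \<in> {a..b}"
  show "f x \<noteq> f y"
  proof
    assume eq: "f x = f y"
    have D: "(f has_real_derivative df z) (at z within {a..b})" if "z \<in> {x..y}" for z
      using der that xy by auto
    have "continuous_on {x..y} f"
      unfolding continuous_on_eq_continuous_within
    proof
      fix z assume z: "z \<in> {x..y}"
      show "continuous (at z within {x..y}) f"
        by (rule continuous_within_subset[OF DERIV_continuous[OF D[OF z]]]) (use xy in auto)
    qed
    moreover have "(f has_derivative (\<lambda>h. df z * h)) (at z)" if "x < z" "z < y" for z
    proof -
      have "at z within {a..b} = at z" using that xy by (intro at_within_Icc_at) auto
      then show ?thesis using D[of z] that by (simp add: has_field_derivative_def)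
    qed
    ultimately obtain z where z: "x < z" "z < y" "(\<lambda>h. df z * h) = (\<lambda>v. 0)"
      using Rolle_deriv[OF xy(1) eq, of "\<lambda>z h. df z * h"] by blast
    then have "df z * 1 = 0" by metis
    then show False using nz[of z] z(1,2) xy by auto
  qed
qed (auto simp: linorder_linear)

text \<open>On a compact set the inverse of a continuous injection is continuous, and the image of
  \<open>E\<close> is a preimage under this inverse.\<close>

lemma image_borel_of_continuous_inj:
  fixes f :: "'a::metric_space \<Rightarrow> 'b::metric_space"
  assumes H: "compact H" and f: "continuous_on H f" and inj: "inj_on f H"
    and E: "E \<in> sets borel" "E \<subseteq> H"
  shows "f ` E \<in> sets borel"
proof -
  let ?g = "inv_into H f"
  have "continuous_on (f ` H) ?g"
    using f H by (rule continuous_on_inv) (use inj in auto)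
  then have "?g \<in> borel_measurable (restrict_space borel (f ` H))"
    by (rule borel_measurable_continuous_on_restrict)
  then have "?g -` E \<inter> space (restrict_space borel (f ` H)) \<in> sets (restrict_space borel (f ` H))"
    using E(1) by (rule measurable_sets)
  moreover have "f ` H \<in> sets borel"
    using compact_continuous_image[OF f H] by (intro borel_closed compact_imp_closed)
  ultimately have "?g -` E \<inter> f ` H \<in> sets borel"
    by (simp add: sets_restrict_space_iff space_restrict_space)
  also have "?g -` E \<inter> f ` H = f ` E"
    using inj E by (force simp: image_iff inv_into_f_f)
  finally show ?thesis .
qed

section \<open>C1 interval maps and dyadic pieces free of critical points\<close>

locale C1_interval_map =
  fixes c d :: real and f df :: "real \<Rightarrow> real"
  assumes f_maps: "f ` {c..d} \<subseteq> {c..d}"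
    and f_deriv: "\<And>x. x \<in> {c..d} \<Longrightarrow> (f has_real_derivative df x) (at x within {c..d})"
    and df_cont: "continuous_on {c..d} df"
begin

lemma f_in: "x \<in> {c..d} \<Longrightarrow> f x \<in> {c..d}"
  using f_maps by blast

lemma f_cont: "continuous_on {c..d} f"
  unfolding continuous_on_eq_continuous_within by (blast intro: DERIV_continuous f_deriv)

lemma df_borel: "df \<in> borel_measurable (restrict_space borel {c..d})"
  by (rule borel_measurable_continuous_on_restrict[OF df_cont])

definition piece :: "nat \<Rightarrow> int \<Rightarrow> real set" where
  "piece n k = {x \<in> {c..d}. \<lfloor>2 ^ n * x\<rfloor> = k}"

text \<open>The half-open pieces partition the interval; their closed hulls are compact intervals,
  as needed for Rolle's theorem and for continuity of the inverse.\<close>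

definition clpiece :: "nat \<Rightarrow> int \<Rightarrow> real set" where
  "clpiece n k = {max c (k / 2 ^ n) .. min d ((k + 1) / 2 ^ n)}"

definition good :: "nat \<Rightarrow> int \<Rightarrow> bool" where
  "good n k \<longleftrightarrow> (\<forall>y\<in>clpiece n k. df y \<noteq> 0)"

lemma piece_subset_clpiece: "piece n k \<subseteq> clpiece n k"
proof
  fix x assume x: "x \<in> piece n k"
  then have "real_of_int k \<le> 2 ^ n * x" "2 ^ n * x \<le> real_of_int k + 1"
    unfolding piece_def by auto
  then show "x \<in> clpiece n k"
    using x by (auto simp: clpiece_def piece_def field_simps)
qed

lemma clpiece_subset: "clpiece n k \<subseteq> {c..d}"
  by (auto simp: clpiece_def)

lemma piece_subset: "piece n k \<subseteq> {c..d}"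
  by (auto simp: piece_def)

lemma floor_borel: "(\<lambda>x::real. \<lfloor>2 ^ n * x\<rfloor>) \<in> borel \<rightarrow>\<^sub>M count_space UNIV"
  by measurable

lemma piece_borel [measurable]: "piece n k \<in> sets borel"
proof -
  have "(\<lambda>x::real. \<lfloor>2 ^ n * x\<rfloor>) -` {k} \<inter> space borel \<in> sets borel"
    by (rule measurable_sets[OF floor_borel]) simp
  moreover have "piece n k = {c..d} \<inter> ((\<lambda>x::real. \<lfloor>2 ^ n * x\<rfloor>) -` {k} \<inter> space borel)"
    by (auto simp: piece_def)
  ultimately show ?thesis by auto
qed

lemma good_inj: "good n k \<Longrightarrow> inj_on f (clpiece n k)"
  unfolding clpiece_def
  by (rule inj_on_deriv_nonzero[where df = df])
     (use clpiece_subset[of n k] in \<open>auto simp: good_def clpiece_def intro: DERIV_subset[OF f_deriv]\<close>)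

lemma image_piece_borel:
  assumes "good n k" "E \<in> sets borel" "E \<subseteq> piece n k"
  shows "f ` E \<in> sets borel"
proof (rule image_borel_of_continuous_inj[OF _ _ good_inj[OF assms(1)] assms(2)])
  show "compact (clpiece n k)" by (simp add: clpiece_def)
  show "continuous_on (clpiece n k) f" using f_cont clpiece_subset by (rule continuous_on_subset)
  show "E \<subseteq> clpiece n k" using assms(3) piece_subset_clpiece by blast
qed

text \<open>A dyadic piece lies in its parent, so goodness is inherited under refinement. This makes
  the truncated log Jacobians defined below increase with the level.\<close>

lemma good_Suc:
  fixes x :: real
  assumes "good n \<lfloor>2 ^ n * x\<rfloor>"
  shows "good (Suc n) \<lfloor>2 ^ Suc n * x\<rfloor>"
proof -
  let ?j = "\<lfloor>2 ^ n * x\<rfloor>" and ?k = "\<lfloor>2 * (2 ^ n * x)\<rfloor>"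
  have "2 * ?j \<le> ?k" "?k + 1 \<le> 2 * (?j + 1)"
    by (simp_all add: le_floor_iff) linarith+
  then have "real_of_int (2 * ?j) \<le> ?k" "real_of_int (?k + 1) \<le> real_of_int (2 * (?j + 1))"
    by (simp_all only: of_int_le_iff)
  then have "2 * real_of_int ?j \<le> ?k" "real_of_int ?k + 1 \<le> 2 * (real_of_int ?j + 1)"
    by simp_all
  then have "real_of_int ?j / 2 ^ n \<le> ?k / 2 ^ Suc n" "(real_of_int ?k + 1) / 2 ^ Suc n \<le> (real_of_int ?j + 1) / 2 ^ n"
    by (simp_all add: divide_le_eq pos_le_divide_eq)
  then have "clpiece (Suc n) ?k \<subseteq> clpiece n ?j" by (auto simp: clpiece_def)
  then show ?thesis using assms by (auto simp: good_def mult.assoc)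
qed

lemma good_mono:
  fixes x :: real
  assumes "good m \<lfloor>2 ^ m * x\<rfloor>" "m \<le> n"
  shows "good n \<lfloor>2 ^ n * x\<rfloor>"
  using assms(2,1) by (induction rule: dec_induct) (simp_all only: good_Suc)

text \<open>Continuity of \<open>df\<close> keeps it nonzero within some distance e of x, and a
  closed piece of length 2^(-m) < e around x lies within that distance.\<close>

lemma good_eventually:
  assumes x: "x \<in> {c..d}" and nz: "df x \<noteq> 0"
  shows "\<exists>m. good m \<lfloor>2 ^ m * x\<rfloor>"
proof -
  have "\<exists>e>0. \<forall>y\<in>{c..d}. dist y x < e \<longrightarrow> dist (df y) (df x) < \<bar>df x\<bar>"
    using df_cont x nz unfolding continuous_on_iff by (metis zero_less_abs_iff)
  then obtain e where e: "0 < e" "\<And>y. y \<in> {c..d} \<Longrightarrow> dist y x < e \<Longrightarrow> dist (df y) (df x) < \<bar>df x\<bar>"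
    by auto
  obtain m where m: "1 / e < 2 ^ m" using real_arch_pow[of 2 "1 / e"] by auto
  have "df y \<noteq> 0" if y: "y \<in> clpiece m \<lfloor>2 ^ m * x\<rfloor>" for y
  proof -
    let ?k = "\<lfloor>2 ^ m * x\<rfloor>"
    have "real_of_int ?k \<le> 2 ^ m * x" "2 ^ m * x \<le> real_of_int ?k + 1" by linarith+
    moreover have "real_of_int ?k \<le> 2 ^ m * y" "2 ^ m * y \<le> real_of_int ?k + 1"
      using y by (auto simp: clpiece_def field_simps)
    ultimately have "\<bar>2 ^ m * y - 2 ^ m * x\<bar> \<le> 1" by linarith
    then have "\<bar>2 ^ m * (y - x)\<bar> \<le> 1" by (simp add: right_diff_distrib)
    then have "2 ^ m * \<bar>y - x\<bar> \<le> 1" by (simp add: abs_mult)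
    moreover have "1 < 2 ^ m * e" using m e by (simp add: field_simps)
    ultimately have "2 ^ m * \<bar>y - x\<bar> < 2 ^ m * e" by linarith
    then have "dist y x < e" by (simp add: dist_real_def)
    then have "dist (df y) (df x) < \<bar>df x\<bar>" using e y clpiece_subset by blast
    then show ?thesis by (auto simp: dist_real_def)
  qed
  then show ?thesis unfolding good_def by blast
qed

lemma meas_partition_pieces:
  assumes "sets M = sets (restrict_space borel {c..d})"
  shows "meas_partition M (piece n ` {\<lfloor>2 ^ n * c\<rfloor>..\<lfloor>2 ^ n * d\<rfloor>})"
  unfolding meas_partition_def
proof (intro conjI)
  have sp: "space M = {c..d}" using sets_eq_imp_space_eq[OF assms] by (simp add: space_restrict_space)
  show "piece n ` {\<lfloor>2 ^ n * c\<rfloor>..\<lfloor>2 ^ n * d\<rfloor>} \<subseteq> sets M"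
    using piece_borel piece_subset by (auto simp: assms sets_restrict_space_iff)
  show "disjoint (piece n ` {\<lfloor>2 ^ n * c\<rfloor>..\<lfloor>2 ^ n * d\<rfloor>})"
    by (auto simp: disjoint_def piece_def)
  show "\<Union> (piece n ` {\<lfloor>2 ^ n * c\<rfloor>..\<lfloor>2 ^ n * d\<rfloor>}) = space M"
    unfolding sp by (auto simp: piece_def intro!: floor_mono mult_left_mono)
qed simp

end

section \<open>Rokhlin's inequality for absolutely continuous invariant measures\<close>

locale ac_invariant_measure = C1_interval_map + mpt M f for M :: "real measure" +
  fixes D :: "real \<Rightarrow> real"
  assumes sets_M: "sets M = sets (restrict_space borel {c..d})"
    and D_borel: "D \<in> borel_measurable (restrict_space borel {c..d})"
    and D_nonneg: "\<And>x. 0 \<le> D x"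
    and M_density: "M = density (restrict_space lborel {c..d}) D"
begin

abbreviation "L \<equiv> restrict_space lborel {c..d}"

lemma sets_L: "sets L = sets (restrict_space borel {c..d})"
  by (simp add: sets_restrict_space)

lemma space_M: "space M = {c..d}"
  using sets_eq_imp_space_eq[OF sets_M] by (simp add: space_restrict_space)

lemma meas_L: "borel_measurable L = borel_measurable (restrict_space borel {c..d})"
  by (rule measurable_cong_sets[OF sets_L refl])

lemma meas_M: "borel_measurable M = borel_measurable (restrict_space borel {c..d})"
  by (rule measurable_cong_sets[OF sets_M refl])

lemma f_L [measurable]: "f \<in> L \<rightarrow>\<^sub>M L"
  using T_meas by (simp add: measurable_cong_sets[OF sets_M sets_M] measurable_cong_sets[OF sets_L sets_L])

lemma D_L [measurable]: "D \<in> borel_measurable L"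
  using D_borel by (simp add: meas_L)

lemma df_L [measurable]: "df \<in> borel_measurable L"
  using df_borel by (simp add: meas_L)

lemma piece_L [measurable]: "piece n k \<in> sets L"
  using piece_borel piece_subset by (simp add: sets_L sets_restrict_space_iff)

lemma nn_integral_M:
  "u \<in> borel_measurable L \<Longrightarrow> (\<integral>\<^sup>+x. u x \<partial>M) = (\<integral>\<^sup>+x. ennreal (D x) * u x \<partial>L)"
  by (subst M_density, subst nn_integral_density) auto

lemma nn_integral_substitution:
  assumes good: "good n k" and E: "E \<in> sets borel" "E \<subseteq> piece n k" and u: "u \<in> borel_measurable L"
  shows "(\<integral>\<^sup>+x. ennreal \<bar>df x\<bar> * u (f x) * indicator E x \<partial>L) = (\<integral>\<^sup>+y. u y * indicator (f ` E) y \<partial>L)"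
proof -
  have EI: "E \<subseteq> {c..d}" using E piece_subset by blast
  \<comment> \<open>\<open>u\<close> is measurable on the interval only; extending it by zero
    changes nothing, since \<open>f\<close> maps the interval into itself.\<close>
  have u': "(\<lambda>x. u x * indicator {c..d} x) \<in> borel_measurable borel"
    using u by (simp add: meas_L borel_measurable_restrict_space_iff_ennreal)
  have "(\<integral>\<^sup>+x. ennreal \<bar>df x\<bar> * u (f x) * indicator E x \<partial>L)
      = (\<integral>\<^sup>+x. ennreal \<bar>df x\<bar> * (u (f x) * indicator {c..d} (f x)) * indicator E x \<partial>lborel)"
    using EI f_in by (subst nn_integral_restrict_space) (auto intro!: nn_integral_cong simp: indicator_def)
  also have "\<dots> = (\<integral>\<^sup>+y. (u y * indicator {c..d} y) * indicator (f ` E) y \<partial>lborel)"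
  proof (rule nn_integral_substitution_inj[OF E(1) _ _ _ _ _ _ u'])
    show "f \<in> borel_measurable (restrict_space borel E)"
      using continuous_on_subset[OF f_cont EI] by (rule borel_measurable_continuous_on_restrict)
    show "df \<in> borel_measurable (restrict_space borel E)"
      using continuous_on_subset[OF df_cont EI] by (rule borel_measurable_continuous_on_restrict)
    show "inj_on f E"
      using good_inj[OF good] E piece_subset_clpiece by (meson inj_on_subset order_trans)
    show "bounded (f ` E)"
      by (rule bounded_subset[OF bounded_closed_interval[of c d]]) (use EI f_in in auto)
    show "f ` E \<in> sets borel" using good E by (rule image_piece_borel)
    show "(f has_real_derivative df x) (at x within E)" if "x \<in> E" for x
      using f_deriv[of x] EI that by (blast intro: DERIV_subset)
  qed
  also have "\<dots> = (\<integral>\<^sup>+y. u y * indicator (f ` E) y \<partial>L)"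
    by (subst nn_integral_restrict_space) (auto intro!: nn_integral_cong simp: indicator_def)
  finally show ?thesis .
qed

text \<open>Invariance makes the Jacobian at least one, since \<open>M E \<le> M (f -` f ` E) = M (f ` E)\<close>.\<close>

lemma AE_density_le_piece:
  assumes good: "good n k"
  shows "AE x in L. x \<in> piece n k \<longrightarrow> D x \<le> \<bar>df x\<bar> * D (f x)"
proof -
  define E where "E = {x \<in> space L. x \<in> piece n k \<and> \<bar>df x\<bar> * D (f x) < D x}"
  have EL [measurable]: "E \<in> sets L" unfolding E_def by measurable
  have E: "E \<in> sets borel" "E \<subseteq> piece n k"
    using EL by (auto simp: sets_L sets_restrict_space_iff E_def)
  have fE: "f ` E \<in> sets M"
    using image_piece_borel[OF good E] E(2) piece_subset f_in by (fastforce simp: sets_M sets_restrict_space_iff)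
  \<comment> \<open>\<open>E\<close> collects the violations. Change of variables makes the integral
    of \<open>?l\<close> the mass of the image of \<open>E\<close>, and that of \<open>?r\<close> is
    the mass of \<open>E\<close>. As \<open>?l <= ?r\<close> pointwise and the integral of
    \<open>?l\<close> is finite, the reverse inequality of integrals leaves no room for strictness
    on a set of positive measure.\<close>
  let ?l = "\<lambda>x. ennreal \<bar>df x\<bar> * ennreal (D (f x)) * indicator E x" and ?r = "\<lambda>x. ennreal (D x) * indicator E x"
  have l: "(\<integral>\<^sup>+x. ?l x \<partial>L) = emeasure M (f ` E)"
    using nn_integral_substitution[OF good E, of "\<lambda>x. ennreal (D x)"] fE
    by (subst M_density) (simp add: emeasure_density M_density)
  have r: "(\<integral>\<^sup>+x. ?r x \<partial>L) = emeasure M E"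
    by (subst M_density) (simp add: emeasure_density)
  have "emeasure M E \<le> emeasure M (f -` (f ` E) \<inter> space M)"
    using E(2) piece_subset measurable_sets[OF T_meas fE] by (intro emeasure_mono) (auto simp: space_M)
  also have "\<dots> = emeasure M (f ` E)"
    using fE emeasure_distr[OF T_meas fE] by (simp add: T_distr)
  finally have le: "(\<integral>\<^sup>+x. ?r x \<partial>L) \<le> (\<integral>\<^sup>+x. ?l x \<partial>L)" using l r by simp
  have "AE x in L. ?r x \<le> ?l x"
  proof (rule ccontr)
    assume "\<not> (AE x in L. ?r x \<le> ?l x)"
    moreover have "AE x in L. ?l x \<le> ?r x"
      by (rule AE_I2) (auto simp: E_def indicator_def ennreal_mult[symmetric] D_nonneg intro!: ennreal_leI)
    moreover have "(\<integral>\<^sup>+x. ?l x \<partial>L) \<noteq> \<infinity>" unfolding l by simp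
    ultimately have "(\<integral>\<^sup>+x. ?l x \<partial>L) < (\<integral>\<^sup>+x. ?r x \<partial>L)"
      by (intro nn_integral_less) auto
    then show False using le by simp
  qed
  with AE_space show ?thesis
  proof eventually_elim
    case (elim x)
    show ?case
    proof (rule ccontr)
      assume "\<not> ?case"
      then have x: "x \<in> E" "\<bar>df x\<bar> * D (f x) < D x" using elim(1) by (auto simp: E_def)
      then have "ennreal (D x) \<le> ennreal (\<bar>df x\<bar> * D (f x))"
        using elim(2) D_nonneg by (simp add: ennreal_mult)
      then show False using x(2) D_nonneg[of x] mult_nonneg_nonneg[OF abs_ge_zero D_nonneg, of "df x" "f x"]
          by (auto simp: ennreal_le_iff2)
    qed
  qed
qed

text \<open>The Jacobian of \<open>f\<close> with respect to \<open>M\<close>, by comparing the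
  densities at x and at f(x). Where \<open>D\<close> vanishes the quotient takes the default value
  0, but this happens on an \<open>M\<close>-null set.\<close>

definition jac :: "real \<Rightarrow> real" where
  "jac x = \<bar>df x\<bar> * D (f x) / D x"

text \<open>The cap n gives the boundedness needed in the entropy estimate for finite partitions.
  The floor 0 costs nothing on good pieces, where the Jacobian is almost surely at least 1; on the
  other pieces the value 0 is chosen because invariance alone then suffices. The cap and the dyadic
  level share the index n, so both limits are taken at once.\<close>

definition trunc_ln_jac :: "nat \<Rightarrow> real \<Rightarrow> real" where
  "trunc_ln_jac n x = (if good n \<lfloor>2 ^ n * x\<rfloor> then max 0 (min (real n) (ln (jac x))) else 0)"

lemma jac_L [measurable]: "jac \<in> borel_measurable L"
  unfolding jac_def by measurable

lemma trunc_ln_jac_L [measurable]: "trunc_ln_jac n \<in> borel_measurable L"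
proof -
  have "(\<lambda>x::real. \<lfloor>2 ^ n * x\<rfloor>) \<in> L \<rightarrow>\<^sub>M count_space UNIV"
    using floor_borel[of n] by (intro measurable_restrict_space1) simp
  then have "Measurable.pred L (\<lambda>x. good n \<lfloor>2 ^ n * x\<rfloor>)"
    by (rule measurable_compose) simp
  then show ?thesis unfolding trunc_ln_jac_def by measurable
qed

lemma trunc_ln_jac_bounds: "0 \<le> trunc_ln_jac n x" "\<bar>trunc_ln_jac n x\<bar> \<le> real n"
  by (auto simp: trunc_ln_jac_def)

text \<open>On a bad piece the weight is 1 and invariance applies. On a good piece exp of the
  truncation is at most \<open>jac\<close>, so D times the weight is at most |df| (D o f), and
  change of variables yields the integral of \<open>u\<close> over the image of the piece, at most
  the whole integral.\<close>

lemma trunc_ln_jac_inequality: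
  assumes u: "u \<in> borel_measurable M"
  shows "(\<integral>\<^sup>+x. ennreal (exp (trunc_ln_jac n x)) * u (f x) * indicator (piece n k) x \<partial>M) \<le> (\<integral>\<^sup>+x. u x \<partial>M)"
proof (cases "good n k")
  case False
  then have "(\<integral>\<^sup>+x. ennreal (exp (trunc_ln_jac n x)) * u (f x) * indicator (piece n k) x \<partial>M)
      \<le> (\<integral>\<^sup>+x. u (f x) \<partial>M)"
    by (intro nn_integral_mono) (auto simp: trunc_ln_jac_def piece_def indicator_def)
  also have "\<dots> = (\<integral>\<^sup>+x. u x \<partial>M)" by (rule nn_integral_T[OF u])
  finally show ?thesis .
next
  case True
  have uL [measurable]: "u \<in> borel_measurable L" using u by (simp add: meas_L meas_M)
  have "(\<integral>\<^sup>+x. ennreal (exp (trunc_ln_jac n x)) * u (f x) * indicator (piece n k) x \<partial>M)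
      = (\<integral>\<^sup>+x. ennreal (D x) * (ennreal (exp (trunc_ln_jac n x)) * u (f x) * indicator (piece n k) x) \<partial>L)"
    by (intro nn_integral_M) measurable
  also have "\<dots> \<le> (\<integral>\<^sup>+x. ennreal \<bar>df x\<bar> * (ennreal (D (f x)) * u (f x)) * indicator (piece n k) x \<partial>L)"
  proof (rule nn_integral_mono_AE)
    show "AE x in L. ennreal (D x) * (ennreal (exp (trunc_ln_jac n x)) * u (f x) * indicator (piece n k) x)
       \<le> ennreal \<bar>df x\<bar> * (ennreal (D (f x)) * u (f x)) * indicator (piece n k) x"
      using AE_density_le_piece[OF True]
    proof eventually_elim
      case (elim x)
      show ?case
      proof (cases "x \<in> piece n k \<and> 0 < D x")
        case x: True
        then have "1 \<le> jac x" using elim by (simp add: jac_def)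
        then have "exp (trunc_ln_jac n x) \<le> exp (ln (jac x))"
          unfolding trunc_ln_jac_def by (subst exp_le_cancel_iff) auto
        also have "\<dots> = jac x" using \<open>1 \<le> jac x\<close> by simp
        finally have "D x * exp (trunc_ln_jac n x) \<le> \<bar>df x\<bar> * D (f x)"
          using x by (simp add: jac_def field_simps)
        then have "ennreal (D x) * ennreal (exp (trunc_ln_jac n x)) \<le> ennreal \<bar>df x\<bar> * ennreal (D (f x))"
          using D_nonneg by (simp add: ennreal_mult[symmetric] ennreal_leI)
        then have "ennreal (D x) * ennreal (exp (trunc_ln_jac n x)) * u (f x)
            \<le> ennreal \<bar>df x\<bar> * ennreal (D (f x)) * u (f x)"
          by (rule mult_right_mono) simp
        then show ?thesis using x by (simp add: mult.assoc)
      next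
        case False
        then have "x \<notin> piece n k \<or> D x = 0" using D_nonneg[of x] by auto
        then show ?thesis by auto
      qed
    qed
  qed
  also have "\<dots> = (\<integral>\<^sup>+y. ennreal (D y) * u y * indicator (f ` piece n k) y \<partial>L)"
    using nn_integral_substitution[OF True piece_borel order_refl, of "\<lambda>y. ennreal (D y) * u y"] by simp
  also have "\<dots> \<le> (\<integral>\<^sup>+y. ennreal (D y) * u y \<partial>L)"
    by (intro nn_integral_mono) (auto simp: indicator_def)
  also have "\<dots> = (\<integral>\<^sup>+y. u y \<partial>M)" by (rule nn_integral_M[symmetric]) measurable
  finally show ?thesis .
qed

lemma ks_entropy_ge_trunc: "ereal (\<integral>x. trunc_ln_jac n x \<partial>M) \<le> ks_entropy f M"
proof -
  interpret mpt_partition M f "piece n ` {\<lfloor>2 ^ n * c\<rfloor>..\<lfloor>2 ^ n * d\<rfloor>}"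
    by unfold_locales (rule meas_partition_pieces[OF sets_M])
  show ?thesis
  proof (rule ks_entropy_ge)
    show "trunc_ln_jac n \<in> borel_measurable M"
      using trunc_ln_jac_L by (simp add: meas_L meas_M)
    show "\<bar>trunc_ln_jac n x\<bar> \<le> real n" for x by (rule trunc_ln_jac_bounds)
  qed (auto intro!: trunc_ln_jac_inequality)
qed

lemma AE_M: "(AE x in M. Q x) \<longleftrightarrow> (AE x in L. 0 < D x \<longrightarrow> Q x)"
  by (subst M_density, subst AE_density) auto

text \<open>A measure with density \<open>D\<close> does not charge the zeros of \<open>D\<close>;
  invariance carries this over to D o f. Hence ln D and ln (D o f) are proper almost
  everywhere.\<close>

lemma AE_D_pos: "AE x in M. 0 < D x \<and> 0 < D (f x)"
proof -
  have D: "AE x in M. 0 < D x" by (simp add: AE_M)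
  have [measurable]: "D \<in> borel_measurable M" using D_L by (simp add: meas_L meas_M)
  have "AE x in M. 0 < D (f x)"
    using D by (subst (asm) T_distr[symmetric], subst (asm) AE_distr_iff) auto
  with D show ?thesis by simp
qed

text \<open>A coboundary has integral zero as soon as it is integrable, although \<open>v\<close> itself need not
  be: truncate \<open>v\<close>.\<close>

lemma integral_coboundary:
  fixes v :: "real \<Rightarrow> real"
  assumes v [measurable]: "v \<in> borel_measurable M"
    and int: "integrable M (\<lambda>x. v (f x) - v x)"
  shows "(\<integral>x. v (f x) - v x \<partial>M) = 0"
proof -
  define w where "w n x = max (- real n) (min (real n) (v x))" for n x
  have w [measurable]: "w n \<in> borel_measurable M" for n unfolding w_def by measurable
  have w_int: "integrable M (w n)" "integrable M (\<lambda>x. w n (f x))" for n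
    by (intro integrable_const_bound[of _ "real n"]; auto simp: w_def)+
  have zero: "(\<integral>x. w n (f x) - w n x \<partial>M) = 0" for n
    using w_int by (simp add: integral_T)
  have "(\<lambda>n. \<integral>x. w n (f x) - w n x \<partial>M) \<longlonglongrightarrow> (\<integral>x. v (f x) - v x \<partial>M)"
  proof (rule integral_dominated_convergence[where w = "\<lambda>x. \<bar>v (f x) - v x\<bar>"])
    show "AE x in M. (\<lambda>n. w n (f x) - w n x) \<longlonglongrightarrow> v (f x) - v x"
    proof (rule AE_I2)
      fix x
      have "(\<lambda>n. w n y) \<longlonglongrightarrow> v y" for y
      proof (rule tendsto_eventually)
        obtain N :: nat where "\<bar>v y\<bar> < real N" using reals_Archimedean2 by blast
        then have "w n y = v y" if "N \<le> n" for n
        proof -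
          have "real N \<le> real n" using that by simp
          then show ?thesis using \<open>\<bar>v y\<bar> < real N\<close> unfolding w_def by linarith
        qed
        then show "\<forall>\<^sub>F n in sequentially. w n y = v y" by (auto simp: eventually_sequentially)
      qed
      then show "(\<lambda>n. w n (f x) - w n x) \<longlonglongrightarrow> v (f x) - v x" by (intro tendsto_diff)
    qed
    \<comment> \<open>Clamping to [-n, n] is 1-Lipschitz, so increments of \<open>w n\<close> are
      dominated by the integrable increment of \<open>v\<close>.\<close>
    show "AE x in M. norm (w n (f x) - w n x) \<le> \<bar>v (f x) - v x\<bar>" for n
      by (rule AE_I2) (auto simp: w_def)
  qed (use int in auto)
  then show ?thesis by (simp add: zero LIMSEQ_const_iff)
qed

text \<open>If the entropy is infinite there is nothing to prove. Otherwise it bounds the integrals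
  of all truncations, which increase almost everywhere to ln \<open>jac\<close>, so ln
  \<open>jac\<close> is integrable with integral at most the entropy. It differs from ln |df| by a
  coboundary.\<close>

theorem rokhlin_inequality:
  assumes nz: "AE x in M. df x \<noteq> 0" and int: "integrable M (\<lambda>x. ln \<bar>df x\<bar>)"
  shows "ereal (\<integral>x. ln \<bar>df x\<bar> \<partial>M) \<le> ks_entropy f M"
proof (cases "ks_entropy f M")
  case (real h)
  let ?g = "\<lambda>n x. trunc_ln_jac n x" and ?G = "\<lambda>x. ln (jac x)"
  have [measurable]: "?g n \<in> borel_measurable M" "D \<in> borel_measurable M" "jac \<in> borel_measurable M" for n
    using trunc_ln_jac_L D_L jac_L by (simp_all add: meas_L meas_M)
  have g_int: "(\<integral>\<^sup>+x. ennreal (?g n x) \<partial>M) \<le> ennreal h" for n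
  proof -
    have "integrable M (?g n)"
      using trunc_ln_jac_bounds by (intro integrable_const_bound[of _ "real n"]) auto
    then have "(\<integral>\<^sup>+x. ennreal (?g n x) \<partial>M) = ennreal (\<integral>x. ?g n x \<partial>M)"
      by (rule nn_integral_eq_integral) (simp add: trunc_ln_jac_bounds)
    also have "\<dots> \<le> ennreal h" using ks_entropy_ge_trunc[of n] real by (simp add: ennreal_leI)
    finally show ?thesis .
  qed
  have h0: "0 \<le> h"
    using ks_entropy_ge_trunc[of 0] real
      Bochner_Integration.integral_nonneg[of M "trunc_ln_jac 0"] trunc_ln_jac_bounds(1) by fastforce
  have "AE x in M. \<forall>n k. x \<in> piece n k \<longrightarrow> good n k \<longrightarrow> D x \<le> \<bar>df x\<bar> * D (f x)"
    unfolding AE_all_countable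
  proof (intro allI)
    fix n k show "AE x in M. x \<in> piece n k \<longrightarrow> good n k \<longrightarrow> D x \<le> \<bar>df x\<bar> * D (f x)"
    proof (cases "good n k")
      case True
      show ?thesis unfolding AE_M using AE_density_le_piece[OF True] by eventually_elim auto
    qed simp
  qed
  with AE_space nz AE_D_pos
  have ae: "AE x in M. 0 \<le> ?G x \<and> ?G x = ln \<bar>df x\<bar> + (ln (D (f x)) - ln (D x)) \<and> (\<lambda>n. ?g n x) \<longlonglongrightarrow> ?G x
      \<and> incseq (\<lambda>n. ?g n x)"
  proof eventually_elim
    case (elim x)
    then have x: "x \<in> {c..d}" by (simp add: space_M)
    obtain m where m: "good m \<lfloor>2 ^ m * x\<rfloor>" using good_eventually[OF x] elim by blast
    then have "D x \<le> \<bar>df x\<bar> * D (f x)" using elim(4) x by (auto simp: piece_def)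
    then have "1 \<le> jac x" using elim by (simp add: jac_def)
    then have G0: "0 \<le> ?G x" by simp
    have "(\<lambda>n. ?g n x) \<longlonglongrightarrow> ?G x"
    proof (rule tendsto_eventually)
      obtain N :: nat where N: "?G x < real N" using reals_Archimedean2 by blast
      have "?g n x = ?G x" if "max m N \<le> n" for n
      proof -
        have "real N \<le> real n" using that by simp
        then show ?thesis using good_mono[OF m, of n] that N G0 by (simp add: trunc_ln_jac_def)
      qed
      then show "\<forall>\<^sub>F n in sequentially. ?g n x = ?G x" unfolding eventually_sequentially by blast
    qed
    moreover have "incseq (\<lambda>n. ?g n x)"
    proof (rule incseq_SucI)
      fix n show "?g n x \<le> ?g (Suc n) x"
        using good_Suc[of n x] unfolding trunc_ln_jac_def by (cases "good n \<lfloor>2 ^ n * x\<rfloor>") auto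
    qed
    moreover have "?G x = ln \<bar>df x\<bar> + (ln (D (f x)) - ln (D x))"
      using elim by (simp add: jac_def ln_div ln_mult)
    ultimately show ?case using G0 by blast
  qed
  have "(\<integral>\<^sup>+x. ennreal (?G x) \<partial>M) = (\<integral>\<^sup>+x. (SUP n. ennreal (?g n x)) \<partial>M)"
  proof (rule nn_integral_cong_AE)
    show "AE x in M. ennreal (?G x) = (SUP n. ennreal (?g n x))"
      using ae
    proof eventually_elim
      case (elim x)
      then have "(\<lambda>n. ennreal (?g n x)) \<longlonglongrightarrow> ennreal (?G x)" by (intro tendsto_ennrealI) auto
      moreover have "incseq (\<lambda>n. ennreal (?g n x))"
        using elim by (auto simp: incseq_def ennreal_leI)
      ultimately show ?case by (metis LIMSEQ_SUP LIMSEQ_unique)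
    qed
  qed
  also have "\<dots> = (SUP n. \<integral>\<^sup>+x. ennreal (?g n x) \<partial>M)"
  proof (rule nn_integral_monotone_convergence_SUP_AE)
    show "AE x in M. ennreal (?g n x) \<le> ennreal (?g (Suc n) x)" for n
      using ae by eventually_elim (simp add: incseq_Suc_iff ennreal_leI)
  qed measurable
  also have "\<dots> \<le> ennreal h" using g_int by (rule SUP_least)
  finally have G_le: "(\<integral>\<^sup>+x. ennreal (?G x) \<partial>M) \<le> ennreal h" .
  have G_pos: "AE x in M. 0 \<le> ?G x" using ae by eventually_elim simp
  have G_int: "integrable M ?G"
    using G_le G_pos by (intro integrableI_nonneg) (auto simp: order_le_less_trans)
  have "(\<integral>x. ?G x \<partial>M) \<le> h"
    using G_le h0 nn_integral_eq_integral[OF G_int G_pos] by simp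
  moreover have "(\<integral>x. ?G x \<partial>M) = (\<integral>x. ln \<bar>df x\<bar> \<partial>M)"
  proof -
    \<comment> \<open>ln D itself need not be integrable; its increment along \<open>f\<close> is,
      being the difference of ln \<open>jac\<close> and ln |df|.\<close>
    let ?v = "\<lambda>x. ln (D x)"
    have cob: "AE x in M. ?G x - ln \<bar>df x\<bar> = ?v (f x) - ?v x" using ae by eventually_elim simp
    have int_diff: "integrable M (\<lambda>x. ?G x - ln \<bar>df x\<bar>)" using G_int int by simp
    have "integrable M (\<lambda>x. ?v (f x) - ?v x)"
      by (rule integrable_cong_AE_imp[OF int_diff]) (use cob in \<open>auto elim!: eventually_mono\<close>)
    then have "(\<integral>x. ?v (f x) - ?v x \<partial>M) = 0" by (intro integral_coboundary) auto
    moreover have "(\<integral>x. ?G x - ln \<bar>df x\<bar> \<partial>M) = (\<integral>x. ?v (f x) - ?v x \<partial>M)"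
      using cob int_diff by (intro integral_cong_AE) auto
    ultimately show ?thesis using G_int int by simp
  qed
  ultimately show ?thesis using real by simp
next
  case MInf
  then show ?thesis using ks_entropy_ge_trunc[of 0] by simp
qed simp

end

section \<open>Branches of the induced map\<close>

text \<open>The lift and its normalization are defined by \<open>infsum\<close>; as integrals over a
  counting measure they admit monotone convergence and exchange with countable sums.\<close>

lemma infsum_ennreal_eq_nn_integral:
  fixes g :: "'a \<Rightarrow> ennreal"
  assumes "countable A"
  shows "infsum g A = (\<integral>\<^sup>+x. g x \<partial>count_space A)"
proof (rule antisym)
  have "sum g F \<le> (\<integral>\<^sup>+x. g x \<partial>count_space A)" if "finite F" "F \<subseteq> A" for F
  proof -
    have "sum g F = (\<integral>\<^sup>+x. g x * indicator F x \<partial>count_space A)"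
      using that by (subst nn_integral_count_space'[of F]) (auto simp: indicator_def)
    also have "\<dots> \<le> (\<integral>\<^sup>+x. g x \<partial>count_space A)"
      by (intro nn_integral_mono) (auto simp: indicator_def)
    finally show ?thesis .
  qed
  then show "infsum g A \<le> (\<integral>\<^sup>+x. g x \<partial>count_space A)"
    by (subst nonneg_infsum_complete) (auto intro!: SUP_least)
  show "(\<integral>\<^sup>+x. g x \<partial>count_space A) \<le> infsum g A"
  proof (cases "finite A")
    case True
    then show ?thesis by (simp add: nn_integral_count_space_finite)
  next
    case False
    let ?e = "from_nat_into A"
    have bij: "bij_betw ?e UNIV A" using assms False by (rule bij_betw_from_nat_into)
    have "(\<integral>\<^sup>+x. g x \<partial>count_space A) = (\<Sum>n. g (?e n))"
      using nn_integral_bij_count_space[OF bij, of g] by (simp add: nn_integral_count_space_nat)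
    also have "\<dots> = (SUP n. \<Sum>i<n. g (?e i))" by (rule suminf_eq_SUP)
    also have "\<dots> \<le> infsum g A"
    proof (rule SUP_least)
      fix n
      have "(\<Sum>i<n. g (?e i)) = sum g (?e ` {..<n})"
        using bij by (subst sum.reindex) (auto simp: bij_betw_def intro: inj_on_subset)
      also have "\<dots> \<le> infsum g A"
        by (subst nonneg_infsum_complete)
           (use bij in \<open>auto simp: bij_betw_def intro!: SUP_upper\<close>)
      finally show "(\<Sum>i<n. g (?e i)) \<le> infsum g A" .
    qed
    finally show ?thesis .
  qed
qed

context C1_interval_map
begin

lemma funpow_in: "x \<in> {c..d} \<Longrightarrow> (f ^^ k) x \<in> {c..d}"
  by (induction k) (simp_all only: funpow.simps comp_apply f_in id_apply)

lemma funpow_deriv: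
  assumes x: "x \<in> {c..d}"
  shows "((f ^^ k) has_real_derivative (\<Prod>i<k. df ((f ^^ i) x))) (at x within {c..d})"
proof (induction k)
  case (Suc k)
  have "(f has_real_derivative df ((f ^^ k) x)) (at ((f ^^ k) x) within (f ^^ k) ` {c..d})"
    by (rule DERIV_subset[OF f_deriv[OF funpow_in[OF x]]]) (blast intro: funpow_in)
  from DERIV_image_chain[OF this Suc.IH] show ?case
    by (simp only: funpow.simps prod.lessThan_Suc mult.commute)
qed (simp add: id_def)

lemma funpow_cont: "continuous_on {c..d} (f ^^ k)"
  unfolding continuous_on_eq_continuous_within by (blast intro: DERIV_continuous funpow_deriv)

lemma funpow_vimage_borel:
  assumes "A \<in> sets borel" "A \<subseteq> {c..d}" "B \<in> sets borel"
  shows "A \<inter> (f ^^ k) -` B \<in> sets borel"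
proof -
  have "f ^^ k \<in> borel_measurable (restrict_space borel A)"
    by (rule borel_measurable_continuous_on_restrict[OF continuous_on_subset[OF funpow_cont assms(2)]])
  from measurable_sets[OF this assms(3)] show ?thesis
    using assms(1) by (simp add: sets_restrict_space_iff space_restrict_space Int_commute)
qed

end

section \<open>Coding of the inducing scheme and constancy of the derivative on branches\<close>

locale inducing_scheme = C1_interval_map +
  fixes S :: "real set set" and \<tau> :: "real set \<Rightarrow> nat"
  assumes S_countable: "countable S"
    and S_disjoint: "disjoint S"
    and S_borel: "\<And>J. J \<in> S \<Longrightarrow> J \<in> sets borel" "\<And>J. J \<in> S \<Longrightarrow> J \<subseteq> {c..d}"
    and tau_pos: "\<And>J. J \<in> S \<Longrightarrow> 1 \<le> \<tau> J"
    and branch_inj: "\<And>J. J \<in> S \<Longrightarrow> inj_on (f ^^ \<tau> J) J"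
    and branch_onto: "\<And>J. J \<in> S \<Longrightarrow> (f ^^ \<tau> J) ` J = \<Union>S"
    and code_unique: "\<And>a. a \<in> seqs S \<Longrightarrow> \<exists>!x. x \<in> code_set f \<tau> a"
    and base_pos: "0 < emeasure lborel (\<Union>S)"
    and tail: "\<exists>c1>0. \<exists>l1>1. \<forall>n::nat.
                (\<Sum>\<^sub>\<infinity>J\<in>{J\<in>S. n \<le> \<tau> J}. emeasure lborel J) \<le> ennreal (1 / (c1 * l1 ^ n))"
    and distortion: "\<exists>c2>0. \<exists>l2>1. \<forall>n\<ge>1. \<forall>w\<in>lists S. length w = n \<longrightarrow>
               (\<forall>x\<in>code_cyl f S \<tau> w. \<forall>y\<in>code_cyl f S \<tau> w. \<forall>i<n.
                  \<bar>dF_br f df \<tau> (w ! i) (F_word f \<tau> w i x) / dF_br f df \<tau> (w ! i) (F_word f \<tau> w i y) - 1\<bar>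
                    \<le> c2 / l2 ^ n)"
begin

abbreviation "W \<equiv> \<Union>S"
abbreviation "F \<equiv> ind_F f S \<tau>"

lemma W_borel [measurable]: "W \<in> sets borel"
  using S_countable S_borel by (intro sets.countable_Union) auto

lemma W_subset: "W \<subseteq> {c..d}"
  using S_borel by blast

lemma mem_unique: "J \<in> S \<Longrightarrow> K \<in> S \<Longrightarrow> x \<in> J \<Longrightarrow> x \<in> K \<Longrightarrow> J = K"
  using S_disjoint by (auto simp: disjoint_def)

lemma F_eq: "J \<in> S \<Longrightarrow> x \<in> J \<Longrightarrow> F x = (f ^^ \<tau> J) x"
proof -
  assume J: "J \<in> S" "x \<in> J"
  have "(THE K. K \<in> S \<and> x \<in> K) = J"
  proof (rule the_equality)
    show "K = J" if "K \<in> S \<and> x \<in> K" for K using mem_unique[of K J x] that J by simp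
  qed (use J in simp)
  then show ?thesis by (simp add: ind_F_def ind_tau_def)
qed

lemma F_W: "x \<in> W \<Longrightarrow> F x \<in> W"
  using F_eq branch_onto by fastforce

lemma Fn_W: "x \<in> W \<Longrightarrow> (F ^^ n) x \<in> W"
  by (induction n) (simp_all only: funpow.simps comp_apply F_W id_apply)

definition itin :: "real \<Rightarrow> nat \<Rightarrow> real set" where
  "itin x k = (SOME J. J \<in> S \<and> (F ^^ k) x \<in> J)"

lemma itin:
  assumes "x \<in> W"
  shows "itin x k \<in> S" "(F ^^ k) x \<in> itin x k"
proof -
  have "\<exists>J. J \<in> S \<and> (F ^^ k) x \<in> J" using Fn_W[OF assms, of k] by blast
  from someI_ex[OF this] show "itin x k \<in> S" "(F ^^ k) x \<in> itin x k"
    by (simp_all add: itin_def)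
qed

lemma word_preI:
  assumes "\<And>i. i < k \<Longrightarrow> a i \<in> S" "\<And>i. i < k \<Longrightarrow> (F ^^ i) x \<in> a i" "(F ^^ k) x \<in> A"
  shows "x \<in> word_pre f \<tau> (map a [0..<k]) A"
  using assms
proof (induction k arbitrary: a x)
  case (Suc k)
  have eq: "map a [0..<Suc k] = a 0 # map (\<lambda>i. a (Suc i)) [0..<k]"
    by (rule nth_equalityI) (auto simp: nth_Cons' simp del: upt_Suc)
  have shift: "(F ^^ i) (F x) = (F ^^ Suc i) x" for i by (simp only: funpow_Suc_right comp_apply)
  have "F x \<in> word_pre f \<tau> (map (\<lambda>i. a (Suc i)) [0..<k]) A"
    by (rule Suc.IH; (simp only: shift)?; rule Suc.prems; simp)
  moreover have "x \<in> a 0" "a 0 \<in> S" using Suc.prems(1)[of 0] Suc.prems(2)[of 0] by auto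
  ultimately show ?case
    unfolding eq using F_eq closure_subset by (auto simp: brpre_def)
qed simp

lemma code_setI:
  assumes "a \<in> seqs S" "\<And>k. (F ^^ k) x \<in> a k"
  shows "x \<in> code_set f \<tau> a"
proof -
  have "(F ^^ k) x \<in> closure (a k)" for k using assms(2) closure_subset by blast
  moreover from this[of 0] have "x \<in> closure (a 0)" by simp
  ultimately show ?thesis
    using assms by (auto simp: code_set_def seqs_def intro!: word_preI)
qed

text \<open>A point whose \<open>F\<close>-orbit follows \<open>a\<close> satisfies all the
  conditions defining the coded point, which is unique by (H2).\<close>

lemma code_map_eq:
  assumes "a \<in> seqs S" "\<And>k. (F ^^ k) x \<in> a k"
  shows "code_map f \<tau> a = x"
  unfolding code_map_def using code_setI[OF assms] code_unique[OF assms(1)] by (rule the1_equality[rotated])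

text \<open>(H5) speaks of images of cylinders under the coding map. A point of \<open>W\<close> is
  coded by its own itinerary, so following \<open>w\<close> is enough to enter that image.\<close>

lemma code_cylI:
  assumes w: "w \<in> lists S" and x: "x \<in> W" "\<And>i. i < length w \<Longrightarrow> (F ^^ i) x \<in> w ! i"
  shows "x \<in> code_cyl f S \<tau> w"
proof -
  have a: "itin x \<in> seqs S" using itin[OF x(1)] by (simp add: seqs_def)
  have "itin x i = w ! i" if "i < length w" for i
    using mem_unique[OF itin(1)[OF x(1)] _ itin(2)[OF x(1)] x(2)[OF that]] w that
    by (auto simp: in_lists_conv_set)
  then have "itin x \<in> cyl S w" using a by (simp add: cyl_def)
  moreover have "code_map f \<tau> (itin x) = x" by (rule code_map_eq[OF a itin(2)[OF x(1)]])
  ultimately show ?thesis unfolding code_cyl_def by (metis imageI)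
qed

lemma F_word_eq:
  assumes "\<And>k. k < i \<Longrightarrow> w ! k \<in> S" "\<And>k. k < i \<Longrightarrow> (F ^^ k) x \<in> w ! k"
  shows "F_word f \<tau> w i x = (F ^^ i) x"
  using assms
proof (induction i)
  case (Suc i)
  then have "F_word f \<tau> w i x = (F ^^ i) x" by simp
  then have "F_word f \<tau> w (Suc i) x = (f ^^ \<tau> (w ! i)) ((F ^^ i) x)"
    unfolding F_word_def by (simp add: add.commute[of _ "\<tau> _"] funpow_add)
  also have "\<dots> = F ((F ^^ i) x)" using Suc.prems[of i] by (metis F_eq lessI)
  finally show ?case by simp
qed (simp add: F_word_def)

text \<open>The branch on J maps onto \<open>W\<close>, which contains J, so it can be inverted
  inside J any number of times. Thus any point of J can be placed at the last position of a long
  word J...J, where (H5) can be tested.\<close>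

lemma preimage_in_branch:
  assumes J: "J \<in> S" and x: "x \<in> J"
  shows "\<exists>z\<in>J. (\<forall>i\<le>n. (F ^^ i) z \<in> J) \<and> (F ^^ n) z = x"
proof (induction n)
  case (Suc n)
  then obtain z where z: "z \<in> J" "\<And>i. i \<le> n \<Longrightarrow> (F ^^ i) z \<in> J" "(F ^^ n) z = x" by blast
  have "z \<in> (f ^^ \<tau> J) ` J" using branch_onto[OF J] z(1) J by blast
  then obtain y where y: "y \<in> J" "F y = z" using F_eq[OF J] by auto
  have shift: "(F ^^ Suc i) y = (F ^^ i) z" for i using y(2) by (simp only: funpow_Suc_right comp_apply)
  have "(F ^^ i) y \<in> J" if "i \<le> Suc n" for i
  proof (cases i)
    case (Suc j)
    then show ?thesis using shift[of j] z(2)[of j] that by (simp del: funpow.simps)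
  qed (use y in simp)
  moreover have "(F ^^ Suc n) y = x" using shift[of n] z(3) by (simp only:)
  ultimately show ?case using y(1) by blast
qed (use x in auto)

text \<open>The distortion bound does not depend on the position \<open>i\<close> inside the word, so letting the
  length of the word tend to infinity while looking at its last letter forces the derivative to be
  constant on each branch.\<close>

lemma dF_br_constant:
  assumes J: "J \<in> S" and x: "x \<in> J" and y: "y \<in> J"
  shows "dF_br f df \<tau> J x = dF_br f df \<tau> J y" "dF_br f df \<tau> J y \<noteq> 0"
proof -
  obtain c2 l2 where c2: "0 < c2" "1 < l2" and bound: "\<And>n w x y i. n \<ge> 1 \<Longrightarrow> w \<in> lists S \<Longrightarrow> length w = n \<Longrightarrow>
      x \<in> code_cyl f S \<tau> w \<Longrightarrow> y \<in> code_cyl f S \<tau> w \<Longrightarrow> i < n \<Longrightarrow>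
      \<bar>dF_br f df \<tau> (w ! i) (F_word f \<tau> w i x) / dF_br f df \<tau> (w ! i) (F_word f \<tau> w i y) - 1\<bar> \<le> c2 / l2 ^ n"
    using distortion by (metis (no_types, lifting))
  let ?q = "dF_br f df \<tau> J x / dF_br f df \<tau> J y"
  have "\<bar>?q - 1\<bar> \<le> c2 / l2 ^ Suc n" for n
  proof -
    \<comment> \<open>Length n + 1 and position i = n: the compared points at this position are x
      and y themselves, while the bound is c2 / l2^(n+1).\<close>
    let ?w = "replicate (Suc n) J"
    have w: "?w \<in> lists S" using J by auto
    have *: "\<exists>z. z \<in> code_cyl f S \<tau> ?w \<and> F_word f \<tau> ?w n z = v" if v: "v \<in> J" for v
    proof -
      obtain z where z: "z \<in> J" "\<forall>i\<le>n. (F ^^ i) z \<in> J" "(F ^^ n) z = v"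
        using preimage_in_branch[OF J v] by blast
      have "z \<in> code_cyl f S \<tau> ?w"
        by (rule code_cylI[OF w]) (use z J in \<open>auto simp del: replicate.simps\<close>)
      moreover have "F_word f \<tau> ?w n z = v"
        using z J by (subst F_word_eq) (auto simp del: replicate.simps)
      ultimately show ?thesis by blast
    qed
    obtain zx where zx: "zx \<in> code_cyl f S \<tau> ?w" "F_word f \<tau> ?w n zx = x" using *[OF x] by blast
    obtain zy where zy: "zy \<in> code_cyl f S \<tau> ?w" "F_word f \<tau> ?w n zy = y" using *[OF y] by blast
    have "?w ! n = J" by (rule nth_replicate) simp
    then show ?thesis using bound[OF _ w _ zx(1) zy(1), of "Suc n" n] zx(2) zy(2) by simp
  qed
  moreover have "(\<lambda>n. c2 / l2 ^ Suc n) \<longlonglongrightarrow> 0"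
    using tendsto_mult_right_zero[OF LIMSEQ_Suc[OF LIMSEQ_inverse_realpow_zero[OF c2(2)]], of c2]
    by (simp add: divide_inverse)
  ultimately have "\<bar>?q - 1\<bar> \<le> 0" by (intro LIMSEQ_le_const) auto
  \<comment> \<open>Division by zero gives 0, so a quotient equal to 1 also shows that the
    derivative does not vanish.\<close>
  then have "?q = 1" by simp
  then show "dF_br f df \<tau> J x = dF_br f df \<tau> J y" "dF_br f df \<tau> J y \<noteq> 0"
    by (auto simp: divide_eq_1_iff)
qed

definition slope :: "real set \<Rightarrow> real" where
  "slope J = \<bar>dF_br f df \<tau> J (SOME x. x \<in> J)\<bar>"

lemma W_nonempty: "W \<noteq> {}"
  using base_pos by (metis emeasure_empty less_irrefl)

lemma slope:
  assumes J: "J \<in> S" and x: "x \<in> J"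
  shows "\<bar>dF_br f df \<tau> J x\<bar> = slope J" "0 < slope J"
proof -
  have "(SOME x. x \<in> J) \<in> J" using x by (rule someI)
  from dF_br_constant[OF J x this] show "\<bar>dF_br f df \<tau> J x\<bar> = slope J" "0 < slope J"
    by (simp_all add: slope_def)
qed

lemma branch_nonempty: "J \<in> S \<Longrightarrow> J \<noteq> {}"
  using branch_onto[of J] W_nonempty by auto

lemma slope_pos: "J \<in> S \<Longrightarrow> 0 < slope J"
  using slope(2) branch_nonempty by blast

lemma df_nonzero:
  assumes "J \<in> S" "x \<in> J" "k < \<tau> J"
  shows "df ((f ^^ k) x) \<noteq> 0"
proof -
  have "dF_br f df \<tau> J x \<noteq> 0" using slope[OF assms(1,2)] by linarith
  then show ?thesis
    unfolding dF_br_def using assms(3) by (metis finite_lessThan lessThan_iff prod_zero_iff)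
qed

text \<open>The area formula with constant Jacobian: the branch expands Lebesgue measure by exactly
  \<open>slope J\<close>, with no distortion constant.\<close>

lemma emeasure_preimage_branch:
  assumes J: "J \<in> S" and B: "B \<in> sets borel"
  shows "ennreal (slope J) * emeasure lborel (J \<inter> (f ^^ \<tau> J) -` B) = emeasure lborel (W \<inter> B)"
proof -
  let ?A = "J \<inter> (f ^^ \<tau> J) -` B"
  have A: "?A \<in> sets borel" by (rule funpow_vimage_borel[OF S_borel[OF J] B])
  have "ennreal (slope J) * emeasure lborel ?A
      = (\<integral>\<^sup>+x. ennreal \<bar>\<Prod>i<\<tau> J. df ((f ^^ i) x)\<bar> * indicator ?A x \<partial>lborel)"
    using A slope(1)[OF J]
    by (subst nn_integral_cmult_indicator[symmetric])
       (auto intro!: nn_integral_cong simp: indicator_def dF_br_def)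
  also have "\<dots> = emeasure lebesgue ((f ^^ \<tau> J) ` ?A)"
  proof (rule nn_integral_abs_deriv)
    show "?A \<in> sets lebesgue" using A by simp
    show "((f ^^ \<tau> J) has_real_derivative (\<Prod>i<\<tau> J. df ((f ^^ i) x))) (at x within ?A)" if "x \<in> ?A" for x
      by (rule DERIV_subset[OF funpow_deriv]) (use that S_borel[OF J] in auto)
    show "inj_on (f ^^ \<tau> J) ?A" using branch_inj[OF J] by (rule inj_on_subset) auto
    show "bounded ((f ^^ \<tau> J) ` ?A)"
      by (rule bounded_subset[OF bounded_closed_interval[of c d]])
         (use branch_onto[OF J] W_subset in blast)
  qed
  also have "(f ^^ \<tau> J) ` ?A = (f ^^ \<tau> J) ` J \<inter> B" by auto
  also have "\<dots> = W \<inter> B" by (simp only: branch_onto[OF J])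
  finally show ?thesis using B by simp
qed

lemma emeasure_branch:
  assumes "J \<in> S"
  shows "ennreal (slope J) * emeasure lborel J = emeasure lborel W"
  using emeasure_preimage_branch[OF assms, of UNIV] by simp

lemma emeasure_W_finite: "emeasure lborel W < \<infinity>"
  using emeasure_mono[OF W_subset, of lborel]
  by (rule order_le_less_trans) (simp_all add: emeasure_lborel_Icc_eq)

text \<open>f^k is injective on J because f^tau factors through it, and its derivative has no zero
  there because the derivative of f^tau has none. A nonzero density with zero integral over the
  preimage forces the preimage to be null. This gives absolute continuity of every level of the
  lift.\<close>

lemma null_set_preimage:
  assumes J: "J \<in> S" and k: "k \<le> \<tau> J" and E: "E \<in> sets borel" "emeasure lborel E = 0"
  shows "emeasure lborel (J \<inter> (f ^^ k) -` E) = 0"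
proof -
  let ?A = "J \<inter> (f ^^ k) -` E" and ?g' = "\<lambda>x. \<Prod>i<k. df ((f ^^ i) x)"
  have A: "?A \<in> sets borel" by (rule funpow_vimage_borel[OF S_borel[OF J] E(1)])
  have AI: "?A \<subseteq> {c..d}" using S_borel[OF J] by auto
  have "(\<integral>\<^sup>+x. ennreal \<bar>?g' x\<bar> * indicator ?A x \<partial>lborel) = emeasure lebesgue ((f ^^ k) ` ?A)"
  proof (rule nn_integral_abs_deriv)
    show "?A \<in> sets lebesgue" using A by simp
    show "((f ^^ k) has_real_derivative ?g' x) (at x within ?A)" if "x \<in> ?A" for x
      by (rule DERIV_subset[OF funpow_deriv]) (use that AI in auto)
    have "inj_on (f ^^ k) J"
    proof (rule inj_onI)
      fix x y assume xy: "x \<in> J" "y \<in> J" "(f ^^ k) x = (f ^^ k) y"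
      have "f ^^ \<tau> J = (f ^^ (\<tau> J - k)) \<circ> (f ^^ k)" using k by (simp add: funpow_add[symmetric])
      then have "(f ^^ \<tau> J) x = (f ^^ \<tau> J) y" using xy by simp
      then show "x = y" using branch_inj[OF J] xy by (auto dest: inj_onD)
    qed
    then show "inj_on (f ^^ k) ?A" by (rule inj_on_subset) auto
    show "bounded ((f ^^ k) ` ?A)"
      by (rule bounded_subset[OF bounded_closed_interval[of c d]]) (use AI funpow_in in blast)
  qed
  also have "\<dots> \<le> emeasure lebesgue E" using E by (intro emeasure_mono) auto
  also have "\<dots> = 0" using E by simp
  finally have "(\<integral>\<^sup>+x. ennreal \<bar>?g' x\<bar> * indicator ?A x \<partial>lborel) = 0" by simp
  moreover have "(\<lambda>x. ennreal \<bar>?g' x\<bar> * indicator ?A x) \<in> borel_measurable lborel"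
  proof -
    have "continuous_on {c..d} (\<lambda>x. df ((f ^^ i) x))" for i
      by (rule continuous_on_compose2[OF df_cont funpow_cont]) (blast intro: funpow_in)
    then have "continuous_on ?A (\<lambda>x. \<bar>?g' x\<bar>)"
      by (intro continuous_intros) (rule continuous_on_subset[OF _ AI])
    then have "(\<lambda>x. \<bar>?g' x\<bar>) \<in> borel_measurable (restrict_space borel ?A)"
      by (rule borel_measurable_continuous_on_restrict)
    then have "(\<lambda>x. ennreal \<bar>?g' x\<bar>) \<in> borel_measurable (restrict_space borel ?A)" by simp
    then show ?thesis
      using A by (subst (asm) borel_measurable_restrict_space_iff_ennreal) auto
  qed
  ultimately have "AE x in lborel. ennreal \<bar>?g' x\<bar> * indicator ?A x = 0"
    by (simp add: nn_integral_0_iff_AE)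
  then have "AE x in lborel. x \<notin> ?A"
  proof eventually_elim
    case (elim x)
    have "?g' x \<noteq> 0" if "x \<in> ?A" using df_nonzero[OF J, of x] that k by auto
    then show ?case using elim by (auto simp: indicator_def split: if_splits)
  qed
  then have "?A \<in> null_sets lborel" using A by (subst AE_iff_null_sets) auto
  then show ?thesis by auto
qed

end

section \<open>Normalized Lebesgue measure on the base\<close>

context inducing_scheme
begin

lemma F_vimage_eq: "F -` B \<inter> W = (\<Union>J\<in>S. J \<inter> (f ^^ \<tau> J) -` B)"
proof
  show "F -` B \<inter> W \<subseteq> (\<Union>J\<in>S. J \<inter> (f ^^ \<tau> J) -` B)"
  proof
    fix x assume "x \<in> F -` B \<inter> W"
    then obtain J where "J \<in> S" "x \<in> J" "F x \<in> B" by blast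
    then show "x \<in> (\<Union>J\<in>S. J \<inter> (f ^^ \<tau> J) -` B)" using F_eq[of J x] by auto
  qed
  show "(\<Union>J\<in>S. J \<inter> (f ^^ \<tau> J) -` B) \<subseteq> F -` B \<inter> W"
    using F_eq by fastforce
qed

lemma F_vimage_branch: "J \<in> S \<Longrightarrow> J \<inter> F -` B = J \<inter> (f ^^ \<tau> J) -` B"
  using F_eq by fastforce

lemma branch_vimage_borel: "J \<in> S \<Longrightarrow> B \<in> sets borel \<Longrightarrow> J \<inter> F -` B \<in> sets borel"
  by (simp add: F_vimage_branch funpow_vimage_borel S_borel)

lemma F_vimage_borel:
  assumes "B \<in> sets borel"
  shows "F -` B \<inter> W \<in> sets borel"
  unfolding F_vimage_eq
proof (rule sets.countable_UN'[OF S_countable], rule image_subsetI)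
  fix J assume "J \<in> S"
  then show "J \<inter> (f ^^ \<tau> J) -` B \<in> sets borel"
    using assms by (intro funpow_vimage_borel[OF S_borel])
qed

lemma emeasure_split:
  assumes "B \<in> sets borel"
  shows "emeasure lborel (W \<inter> B) = (\<integral>\<^sup>+J. emeasure lborel (J \<inter> B) \<partial>count_space S)"
proof -
  have "W \<inter> B = (\<Union>J\<in>S. J \<inter> B)" by blast
  moreover have "disjoint_family_on (\<lambda>J. J \<inter> B) S"
    using S_disjoint by (auto simp: disjoint_family_on_def disjoint_def)
  moreover have "J \<inter> B \<in> sets lborel" if "J \<in> S" for J
    using S_borel(1)[OF that] assms by simp
  ultimately show ?thesis
    using emeasure_UN_countable[of S "\<lambda>J. J \<inter> B" lborel] S_countable by simp
qed

text \<open>The preimage of B in branch J has measure Leb(J) Leb(B) / Leb(W), since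
  \<open>slope J\<close> is Leb(W) / Leb(J). The sum over J is taken after multiplication by Leb(W),
  to avoid quotients.\<close>

lemma emeasure_F_vimage:
  assumes B: "B \<in> sets borel" "B \<subseteq> W"
  shows "emeasure lborel (F -` B \<inter> W) = emeasure lborel B"
proof -
  have WB: "W \<inter> B = B" using B by blast
  have "emeasure lborel (F -` B \<inter> W) * emeasure lborel W
      = (\<integral>\<^sup>+J. emeasure lborel (J \<inter> (F -` B \<inter> W)) \<partial>count_space S) * emeasure lborel W"
    using emeasure_split[OF F_vimage_borel[OF B(1)]] by (simp add: Int_absorb1 inf_commute)
  also have "\<dots> = (\<integral>\<^sup>+J. emeasure lborel (J \<inter> (F -` B \<inter> W)) * emeasure lborel W \<partial>count_space S)"
    by (rule nn_integral_multc[symmetric]) simp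
  also have "\<dots> = (\<integral>\<^sup>+J. emeasure lborel J * emeasure lborel B \<partial>count_space S)"
  proof (rule nn_integral_cong)
    fix J assume "J \<in> space (count_space S)"
    then have J: "J \<in> S" by simp
    have eq: "J \<inter> (F -` B \<inter> W) = J \<inter> (f ^^ \<tau> J) -` B"
      using F_vimage_branch[OF J, of B] J by blast
    have "emeasure lborel (J \<inter> (F -` B \<inter> W)) * emeasure lborel W
        = emeasure lborel J * (ennreal (slope J) * emeasure lborel (J \<inter> (f ^^ \<tau> J) -` B))"
      unfolding eq emeasure_branch[OF J, symmetric] by (simp add: mult_ac)
    also have "\<dots> = emeasure lborel J * emeasure lborel B"
      using emeasure_preimage_branch[OF J B(1)] by (simp add: WB)
    finally show "emeasure lborel (J \<inter> (F -` B \<inter> W)) * emeasure lborel W = emeasure lborel J * emeasure lborel B" .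
  qed
  also have "\<dots> = (\<integral>\<^sup>+J. emeasure lborel J \<partial>count_space S) * emeasure lborel B"
    by (rule nn_integral_multc) simp
  also have "(\<integral>\<^sup>+J. emeasure lborel J \<partial>count_space S) = emeasure lborel W"
    using emeasure_split[of UNIV] by simp
  finally have "emeasure lborel W * emeasure lborel (F -` B \<inter> W) = emeasure lborel W * emeasure lborel B"
    by (simp add: mult.commute)
  then show ?thesis
    using base_pos emeasure_W_finite by (subst (asm) ennreal_mult_cancel_left) auto
qed

definition nu :: "real measure" where
  "nu = scale_measure (1 / emeasure lborel W) (restrict_space lborel W)"

lemma sets_nu: "sets nu = sets (restrict_space borel W)"
  by (simp add: nu_def sets_restrict_space)

lemma space_nu: "space nu = W"
  using sets_eq_imp_space_eq[OF sets_nu] by (simp add: space_restrict_space)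

lemma in_sets_nu: "B \<in> sets nu \<longleftrightarrow> B \<in> sets borel \<and> B \<subseteq> W"
  by (auto simp: sets_nu sets_restrict_space_iff)

lemma emeasure_nu: "B \<in> sets borel \<Longrightarrow> B \<subseteq> W \<Longrightarrow> emeasure nu B = emeasure lborel B / emeasure lborel W"
  by (simp add: nu_def emeasure_restrict_space divide_ennreal_def mult.commute)

lemma prob_space_nu: "prob_space nu"
  using base_pos emeasure_W_finite
  by (intro prob_spaceI) (simp add: space_nu emeasure_nu ennreal_divide_self)

text \<open>Cylinders inside \<open>W\<close>, cut out by actual \<open>F\<close>-orbits. The sets
  \<open>code_cyl\<close> are built from closures of branches and may contain coded points outside
  \<open>W\<close>.\<close>

fun cylinder :: "real set list \<Rightarrow> real set" where
  "cylinder [] = W"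
| "cylinder (J # w) = J \<inter> F -` cylinder w"

lemma cylinder_borel: "w \<in> lists S \<Longrightarrow> cylinder w \<in> sets borel"
  by (induction w) (auto intro: branch_vimage_borel)

lemma cylinder_subset: "w \<in> lists S \<Longrightarrow> cylinder w \<subseteq> W"
  by (cases w) auto

text \<open>Since branches are disjoint, two words either disagree somewhere, with disjoint
  cylinders, or one extends the other. With the empty set added, cylinders form a pi-system.\<close>

lemma cylinder_Int:
  "w \<in> lists S \<Longrightarrow> v \<in> lists S \<Longrightarrow> cylinder w \<inter> cylinder v = {} \<or> (\<exists>u\<in>lists S. cylinder w \<inter> cylinder v = cylinder u)"
proof (induction w arbitrary: v)
  case Nil
  then show ?case using cylinder_subset[of v] by (auto simp: Int_absorb1)
next
  case (Cons J w)
  show ?case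
  proof (cases v)
    case Nil
    then show ?thesis using cylinder_subset[of "J # w"] Cons.prems by (metis cylinder.simps(1) inf.absorb1)
  next
    case v: (Cons K v')
    show ?thesis
    proof (cases "J = K")
      case True
      have eq: "cylinder (J # w) \<inter> cylinder v = J \<inter> F -` (cylinder w \<inter> cylinder v')"
        using v True by auto
      have "w \<in> lists S" "v' \<in> lists S" "J \<in> S" using Cons.prems v by auto
      with Cons.IH[of v'] consider "cylinder w \<inter> cylinder v' = {}"
        | u where "u \<in> lists S" "cylinder w \<inter> cylinder v' = cylinder u" by blast
      then show ?thesis
      proof cases
        case 1
        then show ?thesis unfolding eq by simp
      next
        case 2
        then have "J # u \<in> lists S" "cylinder (J # w) \<inter> cylinder v = cylinder (J # u)"
          unfolding eq using \<open>J \<in> S\<close> by auto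
        then show ?thesis by blast
      qed
    next
      case False
      then show ?thesis using mem_unique[of J K] Cons.prems v by auto
    qed
  qed
qed

lemma cylinder_itin:
  assumes x: "x \<in> W"
  shows "x \<in> cylinder (map (itin x) [0..<n])"
proof -
  have "x \<in> cylinder (map a [0..<n])" if "x \<in> W" "\<And>i. a i \<in> S" "\<And>i. (F ^^ i) x \<in> a i" for a
    using that
  proof (induction n arbitrary: x a)
    case (Suc n)
    have eq: "map a [0..<Suc n] = a 0 # map (\<lambda>i. a (Suc i)) [0..<n]"
      by (rule nth_equalityI) (auto simp: nth_Cons' simp del: upt_Suc)
    have shift: "(F ^^ i) (F x) = (F ^^ Suc i) x" for i by (simp only: funpow_Suc_right comp_apply)
    have "F x \<in> cylinder (map (\<lambda>i. a (Suc i)) [0..<n])"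
      by (rule Suc.IH; (simp only: shift)?; (rule Suc.prems F_W)+)
    moreover have "x \<in> a 0" using Suc.prems(3)[of 0] by simp
    ultimately show ?case unfolding eq by simp
  qed simp
  then show ?thesis using x itin[OF x] by blast
qed

lemma cylinder_orbit:
  assumes "y \<in> cylinder w" "i < length w"
  shows "(F ^^ i) y \<in> w ! i"
  using assms
proof (induction w arbitrary: y i)
  case (Cons J w)
  show ?case
  proof (cases i)
    case (Suc j)
    then have "(F ^^ j) (F y) \<in> w ! j" using Cons by auto
    then show ?thesis using Suc by (simp add: funpow_swap1)
  qed (use Cons in auto)
qed simp

lemma closed_word_pre:
  assumes "w \<in> lists S" "closed A"
  shows "closed (word_pre f \<tau> w A)"
  using assms
proof (induction w rule: list.induct)
  case (Cons J w)
  have J: "J \<in> S" using Cons.prems(1) by auto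
  have "closure J \<subseteq> {c..d}" by (rule closure_minimal[OF S_borel(2)[OF J]]) simp
  then have "continuous_on (closure J) (f ^^ \<tau> J)" by (rule continuous_on_subset[OF funpow_cont])
  then have "closed (closure J \<inter> (f ^^ \<tau> J) -` word_pre f \<tau> w A)"
    using Cons by (intro continuous_closed_preimage) auto
  moreover have "closure J \<inter> (f ^^ \<tau> J) -` word_pre f \<tau> w A = word_pre f \<tau> (J # w) A"
    by (auto simp: brpre_def)
  ultimately show ?case by simp
qed simp

text \<open>By compactness, uniqueness of the coded point makes cylinders shrink to points.\<close>

lemma cylinder_shrinks:
  assumes x: "x \<in> W" and U: "open U" "x \<in> U"
  shows "\<exists>n. cylinder (map (itin x) [0..<n]) \<subseteq> U"
proof (rule ccontr)
  assume "\<not> ?thesis"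
  then have "\<forall>n. \<exists>y. y \<in> cylinder (map (itin x) [0..<n]) \<and> y \<notin> U" by blast
  then obtain y where y: "\<And>n. y n \<in> cylinder (map (itin x) [0..<n])" "\<And>n. y n \<notin> U" by metis
  let ?a = "itin x"
  have a: "?a i \<in> S" for i using itin[OF x] by blast
  have lst: "map ?a [0..<n] \<in> lists S" for n using a by auto
  have yI: "y n \<in> {c..d}" for n using y(1)[of n] cylinder_subset[OF lst[of n]] W_subset by blast
  then obtain z r where zr: "strict_mono r" "(y \<circ> r) \<longlonglongrightarrow> z"
    using compact_Icc[of c d] unfolding compact_def by metis
  have orb: "(F ^^ i) (y n) \<in> ?a i" if "i < n" for i n
    using cylinder_orbit[OF y(1)[of n], of i] that by simp
  have mem: "y n \<in> word_pre f \<tau> (map ?a [0..<k]) (closure (?a k))" if "k < n" for k n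
  proof (rule word_preI)
    show "(F ^^ i) (y n) \<in> ?a i" if "i < k" for i using orb[of i n] that \<open>k < n\<close> by simp
    show "(F ^^ k) (y n) \<in> closure (?a k)" using orb[OF that] closure_subset by blast
  qed (rule a)
  \<comment> \<open>For fixed k the points y n with n > k satisfy the k-th coding condition, and
    this condition is closed, so the limit inherits it. Hence z is the coded point x, although it
    stays outside the open set U.\<close>
  have z: "z \<in> word_pre f \<tau> (map ?a [0..<k]) (closure (?a k))" for k
  proof (rule closed_sequentially[OF closed_word_pre[OF lst closed_closure]])
    show "(\<lambda>n. (y \<circ> r) (n + Suc k)) \<longlonglongrightarrow> z" using zr(2) by (rule LIMSEQ_ignore_initial_segment)
    fix n show "(y \<circ> r) (n + Suc k) \<in> word_pre f \<tau> (map ?a [0..<k]) (closure (?a k))"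
    proof -
      have "k < r (n + Suc k)" using seq_suble[OF zr(1), of "n + Suc k"] by simp
      then show ?thesis
        using mem by simp
    qed
  qed
  have seqs: "?a \<in> seqs S" using a by (simp add: seqs_def)
  have "z \<in> code_set f \<tau> ?a" using z z[of 0] by (auto simp: code_set_def)
  moreover have "x \<in> code_set f \<tau> ?a" using seqs itin(2)[OF x] by (rule code_setI)
  ultimately have "z = x" using code_unique[OF seqs] by blast
  moreover have "z \<notin> U"
  proof
    assume "z \<in> U"
    then have "\<forall>\<^sub>F n in sequentially. (y \<circ> r) n \<in> U" using zr(2) U(1) by (intro topological_tendstoD)
    then show False using y(2) by (auto simp: eventually_sequentially)
  qed
  ultimately show False using U by simp
qed

text \<open>As cylinders shrink to points, the trace on \<open>W\<close> of an open set is the union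
  of the cylinders inside it, and there are countably many words over the countable
  \<open>S\<close>.\<close>

lemma sets_nu_cylinders: "sets nu = sigma_sets W (insert {} (cylinder ` lists S))"
proof -
  let ?E = "insert {} (cylinder ` lists S)"
  have EP: "?E \<subseteq> Pow W" using cylinder_subset by blast
  have id: "(\<lambda>x. x) \<in> measurable (sigma W ?E) borel"
  proof (rule borel_measurableI)
    fix U :: "real set" assume U: "open U"
    let ?w = "{w \<in> lists S. cylinder w \<subseteq> U}"
    have "U \<inter> W = (\<Union>w\<in>?w. cylinder w)"
    proof
      show "U \<inter> W \<subseteq> (\<Union>w\<in>?w. cylinder w)"
      proof
        fix x assume x: "x \<in> U \<inter> W"
        then obtain n where "cylinder (map (itin x) [0..<n]) \<subseteq> U" using cylinder_shrinks[of x U] U by blast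
        moreover have "map (itin x) [0..<n] \<in> lists S" using itin(1)[of x] x by auto
        ultimately show "x \<in> (\<Union>w\<in>?w. cylinder w)" using cylinder_itin[of x n] x by blast
      qed
    qed (use cylinder_subset in blast)
    moreover have "(\<Union>w\<in>?w. cylinder w) \<in> sigma_sets W ?E"
    proof -
      have "countable ?w" using S_countable by (intro countable_subset[OF _ countable_lists]) auto
      then have "(\<Union>w\<in>?w. cylinder w) \<in> sets (sigma W ?E)"
        using EP by (intro sets.countable_UN') auto
      then show ?thesis using EP by simp
    qed
    ultimately show "(\<lambda>x. x) -` U \<inter> space (sigma W ?E) \<in> sets (sigma W ?E)"
      using EP by simp
  qed
  show ?thesis
  proof
    show "sets nu \<subseteq> sigma_sets W ?E"
    proof
      fix B assume B: "B \<in> sets nu"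
      then have "(\<lambda>x. x) -` B \<inter> space (sigma W ?E) \<in> sets (sigma W ?E)"
        using measurable_sets[OF id, of B] by (simp add: in_sets_nu)
      then show "B \<in> sigma_sets W ?E" using EP B by (simp add: in_sets_nu Int_absorb2)
    qed
    have "cylinder w \<in> sets nu" if "w \<in> lists S" for w
      unfolding in_sets_nu using cylinder_borel[OF that] cylinder_subset[OF that] by simp
    then have "?E \<subseteq> sets nu" by blast
    then show "sigma_sets W ?E \<subseteq> sets nu"
      using sets.sigma_sets_subset[of ?E nu] by (simp add: space_nu)
  qed
qed

text \<open>Invariance turns J intersected with B into the pullback of B along branch J. Prefixing a
  letter J therefore divides both sides by the same \<open>slope J\<close>.\<close>

lemma cylinder_invariant_independent:
  assumes B: "B \<in> sets borel" "B \<subseteq> W" "F -` B \<inter> W = B" and w: "w \<in> lists S"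
  shows "emeasure lborel (cylinder w \<inter> B) * emeasure lborel W = emeasure lborel (cylinder w) * emeasure lborel B"
  using w
proof (induction w)
  case Nil
  then show ?case using B by (simp add: Int_absorb1 mult.commute)
next
  case (Cons J w)
  then have J: "J \<in> S" and w: "w \<in> lists S" by auto
  have "J \<inter> B = J \<inter> F -` B" using B(3) J by blast
  then have "cylinder (J # w) \<inter> B = J \<inter> F -` (cylinder w \<inter> B)" by auto
  then have 1: "cylinder (J # w) \<inter> B = J \<inter> (f ^^ \<tau> J) -` (cylinder w \<inter> B)"
    by (simp only: F_vimage_branch[OF J])
  have 2: "cylinder (J # w) = J \<inter> (f ^^ \<tau> J) -` cylinder w"
    by (simp only: cylinder.simps F_vimage_branch[OF J])
  have c: "cylinder w \<in> sets borel" "W \<inter> cylinder w = cylinder w"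
    using cylinder_borel[OF w] cylinder_subset[OF w] by auto
  have s1: "ennreal (slope J) * emeasure lborel (cylinder (J # w) \<inter> B) = emeasure lborel (cylinder w \<inter> B)"
    unfolding 1 using c B by (subst emeasure_preimage_branch[OF J]) (auto simp: inf_assoc[symmetric])
  have s2: "ennreal (slope J) * emeasure lborel (cylinder (J # w)) = emeasure lborel (cylinder w)"
    unfolding 2 using c by (subst emeasure_preimage_branch[OF J]) auto
  have "ennreal (slope J) * (emeasure lborel (cylinder (J # w) \<inter> B) * emeasure lborel W)
      = emeasure lborel (cylinder w \<inter> B) * emeasure lborel W"
    unfolding s1[symmetric] by (simp add: mult_ac)
  also have "\<dots> = emeasure lborel (cylinder w) * emeasure lborel B" using Cons.IH by simp
  also have "\<dots> = ennreal (slope J) * (emeasure lborel (cylinder (J # w)) * emeasure lborel B)"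
    unfolding s2[symmetric] by (simp add: mult_ac)
  finally show ?case using slope_pos[OF J] by (subst (asm) ennreal_mult_cancel_left) auto
qed

text \<open>The sides of the independence identity, as functions of the cylinder, are finite
  measures that agree on a generating pi-system. So they agree at B itself, giving Leb(B) Leb(W) =
  Leb(B)^2.\<close>

lemma invariant_set_trivial:
  assumes B: "B \<in> sets borel" "B \<subseteq> W" "F -` B \<inter> W = B"
  shows "emeasure lborel B = 0 \<or> emeasure lborel B = emeasure lborel W"
proof -
  let ?E = "insert {} (cylinder ` lists S)"
  let ?M = "density (restrict_space lborel W) (\<lambda>x. emeasure lborel W * indicator B x)"
  let ?N = "density (restrict_space lborel W) (\<lambda>x. emeasure lborel B)"
  have setsR: "A \<in> sets (restrict_space lborel W) \<longleftrightarrow> A \<in> sets borel \<and> A \<subseteq> W" for A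
    by (auto simp: sets_restrict_space_iff)
  have BR [measurable]: "B \<in> sets (restrict_space lborel W)" using B setsR by blast
  have M: "emeasure ?M A = emeasure lborel (A \<inter> B) * emeasure lborel W" if A: "A \<in> sets borel" "A \<subseteq> W" for A
  proof -
    have AR: "A \<in> sets (restrict_space lborel W)" using A setsR by blast
    have "emeasure ?M A = (\<integral>\<^sup>+x. emeasure lborel W * indicator (A \<inter> B) x \<partial>restrict_space lborel W)"
      using AR by (subst emeasure_density) (auto intro!: nn_integral_cong simp: indicator_def)
    also have "\<dots> = emeasure lborel W * emeasure (restrict_space lborel W) (A \<inter> B)"
      using AR by (intro nn_integral_cmult_indicator) auto
    also have "emeasure (restrict_space lborel W) (A \<inter> B) = emeasure lborel (A \<inter> B)"
      using A by (subst emeasure_restrict_space) auto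
    finally show ?thesis by (simp add: mult.commute)
  qed
  have N: "emeasure ?N A = emeasure lborel A * emeasure lborel B" if A: "A \<in> sets borel" "A \<subseteq> W" for A
  proof -
    have AR: "A \<in> sets (restrict_space lborel W)" using A setsR by blast
    have "emeasure ?N A = emeasure lborel B * emeasure (restrict_space lborel W) A"
      using AR by (subst emeasure_density) (auto simp: nn_integral_cmult_indicator)
    also have "emeasure (restrict_space lborel W) A = emeasure lborel A"
      using A by (subst emeasure_restrict_space) auto
    finally show ?thesis by (simp add: mult.commute)
  qed
  have "?M = ?N"
  proof (rule measure_eqI_generator_eq[where \<Omega> = W and E = ?E and A = "\<lambda>_. W"])
    show "Int_stable ?E"
    proof (rule Int_stableI)
      fix X Y assume "X \<in> ?E" "Y \<in> ?E"
      then consider "X = {} \<or> Y = {}"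
        | w v where "w \<in> lists S" "v \<in> lists S" "X = cylinder w" "Y = cylinder v"
        by (auto simp only: insert_iff image_iff)
      then show "X \<inter> Y \<in> ?E"
      proof cases
        case 2
        then show ?thesis using cylinder_Int[of w v] by (metis imageI insertCI)
      qed auto
    qed
    show "?E \<subseteq> Pow W" using cylinder_subset by blast
    show "emeasure ?M X = emeasure ?N X" if X: "X \<in> ?E" for X
    proof (cases "X = {}")
      case False
      then obtain w where w: "w \<in> lists S" "X = cylinder w" using X by blast
      show ?thesis
        unfolding w(2) M[OF cylinder_borel[OF w(1)] cylinder_subset[OF w(1)]]
          N[OF cylinder_borel[OF w(1)] cylinder_subset[OF w(1)]]
        by (rule cylinder_invariant_independent[OF B w(1)])
    qed simp
    have "sets (restrict_space lborel W) = sigma_sets W ?E"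
      using sets_nu_cylinders by (simp add: nu_def)
    then show "sets ?M = sigma_sets W ?E" "sets ?N = sigma_sets W ?E" by simp_all
    show "range (\<lambda>_. W) \<subseteq> ?E" using cylinder.simps(1) by blast
    show "emeasure ?M W \<noteq> \<infinity>"
      using emeasure_W_finite M[of W] emeasure_mono[OF B(2), of lborel] B(2)
      by (auto simp: Int_absorb1 ennreal_mult_eq_top_iff top_unique)
  qed simp
  then have "emeasure lborel B * emeasure lborel W = emeasure lborel B * emeasure lborel B"
    using M[of B] N[of B] B by simp
  moreover have "emeasure lborel B < \<infinity>"
    using emeasure_mono[OF B(2), of lborel] emeasure_W_finite by auto
  ultimately show ?thesis by (subst (asm) ennreal_mult_cancel_left) auto
qed

lemma inv_erg_nu: "inv_erg_on F W nu"
  unfolding inv_erg_on_def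
proof (intro conjI ballI impI)
  fix B assume "B \<in> sets nu"
  then have B: "B \<in> sets borel" "B \<subseteq> W" by (simp_all add: in_sets_nu)
  show F: "F -` B \<inter> W \<in> sets nu" using F_vimage_borel[OF B(1)] by (simp add: in_sets_nu)
  show "emeasure nu (F -` B \<inter> W) = emeasure nu B"
    using F_vimage_borel[OF B(1)] B by (simp add: emeasure_nu emeasure_F_vimage)
  assume "F -` B \<inter> W = B"
  then show "emeasure nu B = 0 \<or> emeasure nu B = 1"
    using invariant_set_trivial[OF B] base_pos emeasure_W_finite B
    by (auto simp: emeasure_nu ennreal_divide_self)
qed (simp_all add: prob_space_nu sets_nu)

end

section \<open>The lifted measure\<close>

text \<open>Induction on nonnegative measurable functions; in the limit step monotone convergence is
  applied in each component, in the finite inner sum and in the outer sum.\<close>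

lemma nn_integral_count_space_mixture:
  fixes K :: "'i \<Rightarrow> nat \<Rightarrow> 'a measure" and t :: "'i \<Rightarrow> nat"
  assumes setsK: "\<And>i k. i \<in> A \<Longrightarrow> sets (K i k) = sets N"
    and emN: "\<And>E. E \<in> sets N \<Longrightarrow> emeasure N E = (\<integral>\<^sup>+i. (\<Sum>k<t i. emeasure (K i k) E) \<partial>count_space A)"
    and u: "u \<in> borel_measurable N"
  shows "(\<integral>\<^sup>+x. u x \<partial>N) = (\<integral>\<^sup>+i. (\<Sum>k<t i. \<integral>\<^sup>+x. u x \<partial>K i k) \<partial>count_space A)"
proof -
  have measK: "v \<in> borel_measurable (K i k)" if "v \<in> borel_measurable N" "i \<in> A" for v :: "'a \<Rightarrow> ennreal" and i k
    using that by (simp add: measurable_cong_sets[OF setsK[OF that(2)] refl])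
  have spK: "space (K i k) = space N" if "i \<in> A" for i k
    using sets_eq_imp_space_eq[OF setsK[OF that]] .
  show ?thesis
    using u
  proof (induction rule: borel_measurable_induct)
    case (cong u v)
    have "(\<integral>\<^sup>+x. u x \<partial>K i k) = (\<integral>\<^sup>+x. v x \<partial>K i k)" if "i \<in> A" for i k
      using cong(3) spK[OF that] by (intro nn_integral_cong) simp
    then have "(\<integral>\<^sup>+i. (\<Sum>k<t i. \<integral>\<^sup>+x. u x \<partial>K i k) \<partial>count_space A)
        = (\<integral>\<^sup>+i. (\<Sum>k<t i. \<integral>\<^sup>+x. v x \<partial>K i k) \<partial>count_space A)"
      by (intro nn_integral_cong) simp
    moreover have "(\<integral>\<^sup>+x. u x \<partial>N) = (\<integral>\<^sup>+x. v x \<partial>N)"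
      using cong(3) by (intro nn_integral_cong) simp
    ultimately show ?case using cong(4) by simp
  next
    case (set E)
    have "(\<integral>\<^sup>+i. (\<Sum>k<t i. \<integral>\<^sup>+x. indicator E x \<partial>K i k) \<partial>count_space A)
        = (\<integral>\<^sup>+i. (\<Sum>k<t i. emeasure (K i k) E) \<partial>count_space A)"
      using set setsK by (intro nn_integral_cong sum.cong refl nn_integral_indicator) auto
    then show ?case using set emN by simp
  next
    case (mult u a)
    have "(\<integral>\<^sup>+i. (\<Sum>k<t i. \<integral>\<^sup>+x. a * u x \<partial>K i k) \<partial>count_space A)
        = (\<integral>\<^sup>+i. a * (\<Sum>k<t i. \<integral>\<^sup>+x. u x \<partial>K i k) \<partial>count_space A)"
      using mult by (intro nn_integral_cong) (simp add: nn_integral_cmult measK sum_distrib_left)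
    then show ?case using mult by (simp add: nn_integral_cmult)
  next
    case (add u v)
    have "(\<integral>\<^sup>+i. (\<Sum>k<t i. \<integral>\<^sup>+x. v x + u x \<partial>K i k) \<partial>count_space A)
        = (\<integral>\<^sup>+i. (\<Sum>k<t i. \<integral>\<^sup>+x. v x \<partial>K i k) + (\<Sum>k<t i. \<integral>\<^sup>+x. u x \<partial>K i k) \<partial>count_space A)"
      using add by (intro nn_integral_cong) (simp add: nn_integral_add measK sum.distrib)
    then show ?case using add by (simp add: nn_integral_add)
  next
    case (seq U)
    have incU: "incseq (\<lambda>n. U n x)" for x using seq(3) by (auto simp: incseq_def le_fun_def)
    have SUPf: "(SUP n. U n) = (\<lambda>x. SUP n. U n x)" by (rule ext) (simp add: image_comp)
    have "(\<integral>\<^sup>+i. (\<Sum>k<t i. \<integral>\<^sup>+x. (SUP n. U n x) \<partial>K i k) \<partial>count_space A)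
        = (\<integral>\<^sup>+i. (SUP n. \<Sum>k<t i. \<integral>\<^sup>+x. U n x \<partial>K i k) \<partial>count_space A)"
    proof (rule nn_integral_cong)
      fix i assume "i \<in> space (count_space A)"
      then have i: "i \<in> A" by simp
      have "(\<Sum>k<t i. \<integral>\<^sup>+x. (SUP n. U n x) \<partial>K i k) = (\<Sum>k<t i. SUP n. \<integral>\<^sup>+x. U n x \<partial>K i k)"
        using seq(1,3) i by (intro sum.cong refl nn_integral_monotone_convergence_SUP) (auto simp: measK)
      also have "\<dots> = (SUP n. \<Sum>k<t i. \<integral>\<^sup>+x. U n x \<partial>K i k)"
        using incU by (intro incseq_sumI2[THEN ennreal_SUP_sum[symmetric], symmetric] ennreal_SUP_sum[symmetric])
          (auto simp: incseq_def intro!: nn_integral_mono)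
      finally show "(\<Sum>k<t i. \<integral>\<^sup>+x. (SUP n. U n x) \<partial>K i k) = (SUP n. \<Sum>k<t i. \<integral>\<^sup>+x. U n x \<partial>K i k)" .
    qed
    also have "\<dots> = (SUP n. \<integral>\<^sup>+i. (\<Sum>k<t i. \<integral>\<^sup>+x. U n x \<partial>K i k) \<partial>count_space A)"
    proof (rule nn_integral_monotone_convergence_SUP)
      show "incseq (\<lambda>n i. \<Sum>k<t i. \<integral>\<^sup>+x. U n x \<partial>K i k)"
        using incU by (auto simp: incseq_def le_fun_def intro!: sum_mono nn_integral_mono)
    qed simp
    also have "\<dots> = (SUP n. \<integral>\<^sup>+x. U n x \<partial>N)" by (simp only: seq.IH)
    also have "\<dots> = (\<integral>\<^sup>+x. (SUP n. U n x) \<partial>N)"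
      using seq(1,3) by (intro nn_integral_monotone_convergence_SUP[symmetric]) auto
    finally show ?case by (simp only: SUPf)
  qed
qed

context inducing_scheme
begin

definition Q :: ennreal where
  "Q = (\<integral>\<^sup>+J. of_nat (\<tau> J) * emeasure nu J \<partial>count_space S)"

lemma Q_nu_eq: "Q_nu S \<tau> nu = Q"
  unfolding Q_nu_def Q_def by (rule infsum_ennreal_eq_nn_integral[OF S_countable])

lemma branch_nu: "J \<in> S \<Longrightarrow> J \<in> sets nu"
  using S_borel by (auto simp: in_sets_nu)

lemma branch_Int_space_nu: "J \<in> S \<Longrightarrow> J \<inter> space nu = J"
  by (auto simp: space_nu)

text \<open>Write tau(J) as the number of n with n + 1 <= tau(J) and exchange the sums:
  \<open>Q\<close> times Leb(W) is the sum of the tails in (H4), bounded by a geometric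
  series.\<close>

lemma Q_finite: "Q < \<infinity>"
proof -
  obtain c1 l1 :: real where cl: "c1 > 0" "l1 > 1" and tl: "\<And>n::nat. (\<Sum>\<^sub>\<infinity>J\<in>{J\<in>S. n \<le> \<tau> J}. emeasure lborel J) \<le> ennreal (1 / (c1 * l1 ^ n))"
    using tail by blast
  have tl': "(\<integral>\<^sup>+J. emeasure lborel J * indicator {J\<in>S. n \<le> \<tau> J} J \<partial>count_space S) \<le> ennreal (1 / (c1 * l1 ^ n))" for n
  proof -
    have "countable {J\<in>S. n \<le> \<tau> J}" using S_countable by (rule countable_subset[rotated]) auto
    then have "(\<Sum>\<^sub>\<infinity>J\<in>{J\<in>S. n \<le> \<tau> J}. emeasure lborel J) = (\<integral>\<^sup>+J. emeasure lborel J \<partial>count_space {J\<in>S. n \<le> \<tau> J})"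
      by (rule infsum_ennreal_eq_nn_integral)
    also have "\<dots> = (\<integral>\<^sup>+J. emeasure lborel J * indicator {J\<in>S. n \<le> \<tau> J} J \<partial>count_space S)"
      by (subst (1 2) nn_integral_count_space_indicator) (auto intro!: nn_integral_cong simp: indicator_def)
    finally show ?thesis using tl[of n] by simp
  qed
  have tau: "of_nat (\<tau> J) = (\<Sum>n. indicator {J\<in>S. Suc n \<le> \<tau> J} J :: ennreal)" if "J \<in> S" for J
  proof -
    have "(\<Sum>n. indicator {J\<in>S. Suc n \<le> \<tau> J} J :: ennreal) = (\<Sum>n<\<tau> J. indicator {J\<in>S. Suc n \<le> \<tau> J} J)"
      by (rule suminf_finite) auto
    also have "\<dots> = (\<Sum>n<\<tau> J. 1)" using that by (intro sum.cong) auto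
    finally show ?thesis by simp
  qed
  have "Q = (\<integral>\<^sup>+J. of_nat (\<tau> J) * emeasure lborel J / emeasure lborel W \<partial>count_space S)"
    unfolding Q_def
  proof (rule nn_integral_cong)
    fix J assume "J \<in> space (count_space S)"
    then have "J \<in> S" by simp
    then show "of_nat (\<tau> J) * emeasure nu J = of_nat (\<tau> J) * emeasure lborel J / emeasure lborel W"
      using emeasure_nu[OF S_borel(1), of J] by (simp add: Union_upper ennreal_times_divide)
  qed
  also have "\<dots> = (\<integral>\<^sup>+J. of_nat (\<tau> J) * emeasure lborel J \<partial>count_space S) / emeasure lborel W"
    by (rule nn_integral_divide) simp
  also have "(\<integral>\<^sup>+J. of_nat (\<tau> J) * emeasure lborel J \<partial>count_space S)
      = (\<integral>\<^sup>+J. (\<Sum>n. emeasure lborel J * indicator {J\<in>S. Suc n \<le> \<tau> J} J) \<partial>count_space S)"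
    by (intro nn_integral_cong) (simp add: tau mult.commute)
  also have "\<dots> = (\<Sum>n. \<integral>\<^sup>+J. emeasure lborel J * indicator {J\<in>S. Suc n \<le> \<tau> J} J \<partial>count_space S)"
    by (rule nn_integral_suminf) simp
  also have "\<dots> \<le> (\<Sum>n. ennreal (1 / (c1 * l1 ^ Suc n)))"
    by (intro suminf_le tl') auto
  also have "\<dots> = ennreal (\<Sum>n. 1 / (c1 * l1 ^ Suc n))"
  proof (rule suminf_ennreal2)
    show "0 \<le> 1 / (c1 * l1 ^ Suc n)" for n using cl by simp
    have "summable (\<lambda>n. (1 / (c1 * l1)) * (1 / l1) ^ n)"
      using cl by (intro summable_mult summable_geometric) simp
    moreover have "(1 / (c1 * l1)) * (1 / l1) ^ n = 1 / (c1 * l1 ^ Suc n)" for n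
      by (simp add: power_one_over)
    ultimately show "summable (\<lambda>n. 1 / (c1 * l1 ^ Suc n))" by (simp only:)
  qed
  finally have "Q \<le> ennreal (\<Sum>n. 1 / (c1 * l1 ^ Suc n)) / emeasure lborel W"
    by (simp add: divide_right_mono_ennreal)
  also have "\<dots> < \<infinity>"
    using base_pos unfolding less_top[symmetric] infinity_ennreal_def by (subst ennreal_divide_eq_top_iff) auto
  finally show ?thesis .
qed

abbreviation I where "I \<equiv> restrict_space borel {c..d}"

lemma in_sets_I: "E \<in> sets I \<longleftrightarrow> E \<in> sets borel \<and> E \<subseteq> {c..d}"
  by (auto simp: sets_restrict_space_iff)

lemma funpow_measurable_branch:
  assumes "J \<in> S"
  shows "f ^^ k \<in> restrict_space nu J \<rightarrow>\<^sub>M I"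
proof (rule measurable_restrict_space2)
  show "f ^^ k \<in> space (restrict_space nu J) \<rightarrow> {c..d}"
    using S_borel(2)[OF assms] funpow_in by (fastforce simp: space_restrict_space)
  show "f ^^ k \<in> restrict_space nu J \<rightarrow>\<^sub>M borel"
  proof (rule measurableI)
    fix B :: "real set" assume B: "B \<in> sets borel"
    have "(f ^^ k) -` B \<inter> space (restrict_space nu J) = J \<inter> (f ^^ k) -` B"
      using assms by (auto simp: space_restrict_space space_nu)
    moreover have "J \<inter> (f ^^ k) -` B \<in> sets nu"
      using funpow_vimage_borel[OF S_borel[OF assms] B] assms by (auto simp: in_sets_nu)
    ultimately show "(f ^^ k) -` B \<inter> space (restrict_space nu J) \<in> sets (restrict_space nu J)"
      using branch_nu[OF assms] by (simp add: sets_restrict_space_iff branch_Int_space_nu[OF assms])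
  qed simp
qed

definition level :: "real set \<Rightarrow> nat \<Rightarrow> real measure" where
  "level J k = distr (restrict_space nu J) I (f ^^ k)"

lemma sets_level: "sets (level J k) = sets I"
  by (simp add: level_def)

lemma emeasure_level:
  assumes J: "J \<in> S" and E: "E \<in> sets I"
  shows "emeasure (level J k) E = emeasure nu ((f ^^ k) -` E \<inter> J)"
proof -
  have eq: "(f ^^ k) -` E \<inter> space (restrict_space nu J) = (f ^^ k) -` E \<inter> J"
    using J by (auto simp: space_restrict_space space_nu)
  have "emeasure (level J k) E = emeasure (restrict_space nu J) ((f ^^ k) -` E \<inter> J)"
    unfolding level_def using emeasure_distr[OF funpow_measurable_branch[OF J] E] by (simp only: eq)
  also have "\<dots> = emeasure nu ((f ^^ k) -` E \<inter> J)"
    using branch_nu[OF J] by (intro emeasure_restrict_space) (auto simp: branch_Int_space_nu[OF J])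
  finally show ?thesis .
qed

text \<open>The lift before normalization: the mass of all floors over all branches, projected to
  the interval. Floors whose images overlap are counted with multiplicity.\<close>

definition tower :: "real measure" where
  "tower = measure_of {c..d} (sets I) (\<lambda>E. \<integral>\<^sup>+J. (\<Sum>k<\<tau> J. emeasure (level J k) E) \<partial>count_space S)"

lemma sets_tower: "sets tower = sets I"
  using sets.sigma_sets_eq[of I] sets.space_closed[of I]
  by (simp add: tower_def space_restrict_space)

lemma emeasure_tower:
  assumes "E \<in> sets I"
  shows "emeasure tower E = (\<integral>\<^sup>+J. (\<Sum>k<\<tau> J. emeasure (level J k) E) \<partial>count_space S)"
  unfolding tower_def
proof (rule emeasure_measure_of_sigma[OF _ _ _ assms])
  show "sigma_algebra {c..d} (sets I)"
    using sets.sigma_algebra_axioms[of I] by (simp add: space_restrict_space)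
  show "positive (sets I) (\<lambda>E. \<integral>\<^sup>+J. (\<Sum>k<\<tau> J. emeasure (level J k) E) \<partial>count_space S)"
    by (simp add: positive_def)
  show "countably_additive (sets I) (\<lambda>E. \<integral>\<^sup>+J. (\<Sum>k<\<tau> J. emeasure (level J k) E) \<partial>count_space S)"
  proof (rule countably_additiveI)
    fix A :: "nat \<Rightarrow> real set" assume A: "range A \<subseteq> sets I" "disjoint_family A"
    have "(\<Sum>n. \<integral>\<^sup>+J. (\<Sum>k<\<tau> J. emeasure (level J k) (A n)) \<partial>count_space S)
        = (\<integral>\<^sup>+J. (\<Sum>n. \<Sum>k<\<tau> J. emeasure (level J k) (A n)) \<partial>count_space S)"
      by (rule nn_integral_suminf[symmetric]) simp
    also have "\<dots> = (\<integral>\<^sup>+J. (\<Sum>k<\<tau> J. emeasure (level J k) (\<Union>n. A n)) \<partial>count_space S)"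
    proof (rule nn_integral_cong)
      fix J
      have "(\<Sum>n. \<Sum>k<\<tau> J. emeasure (level J k) (A n)) = (\<Sum>k<\<tau> J. \<Sum>n. emeasure (level J k) (A n))"
        by (rule suminf_sum) simp
      also have "\<dots> = (\<Sum>k<\<tau> J. emeasure (level J k) (\<Union>n. A n))"
        using A by (intro sum.cong refl suminf_emeasure) (simp_all add: sets_level)
      finally show "(\<Sum>n. \<Sum>k<\<tau> J. emeasure (level J k) (A n)) = (\<Sum>k<\<tau> J. emeasure (level J k) (\<Union>n. A n))" .
    qed
    finally show "(\<Sum>n. \<integral>\<^sup>+J. (\<Sum>k<\<tau> J. emeasure (level J k) (A n)) \<partial>count_space S)
        = (\<integral>\<^sup>+J. (\<Sum>k<\<tau> J. emeasure (level J k) (\<Union>(range A))) \<partial>count_space S)" .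
  qed
qed

lemma emeasure_tower_nu:
  assumes "E \<in> sets I"
  shows "emeasure tower E = (\<integral>\<^sup>+J. (\<Sum>k<\<tau> J. emeasure nu ((f ^^ k) -` E \<inter> J)) \<partial>count_space S)"
  unfolding emeasure_tower[OF assms] using assms
  by (intro nn_integral_cong sum.cong refl emeasure_level) simp_all

lemma nn_integral_tower:
  assumes "u \<in> borel_measurable I"
  shows "(\<integral>\<^sup>+x. u x \<partial>tower) = (\<integral>\<^sup>+J. (\<Sum>k<\<tau> J. \<integral>\<^sup>+x. u ((f ^^ k) x) \<partial>restrict_space nu J) \<partial>count_space S)"
proof -
  have "u \<in> borel_measurable tower"
    using assms by (simp add: measurable_cong_sets[OF sets_tower refl])
  then have "(\<integral>\<^sup>+x. u x \<partial>tower) = (\<integral>\<^sup>+J. (\<Sum>k<\<tau> J. \<integral>\<^sup>+x. u x \<partial>level J k) \<partial>count_space S)"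
    using sets_tower by (intro nn_integral_count_space_mixture) (auto simp: sets_level emeasure_tower)
  also have "\<dots> = (\<integral>\<^sup>+J. (\<Sum>k<\<tau> J. \<integral>\<^sup>+x. u ((f ^^ k) x) \<partial>restrict_space nu J) \<partial>count_space S)"
    unfolding level_def
    by (intro nn_integral_cong sum.cong refl nn_integral_distr funpow_measurable_branch)
       (simp_all add: assms)
  finally show ?thesis .
qed

lemma tower_total: "emeasure tower {c..d} = Q"
proof -
  have E: "{c..d} \<in> sets I" by (simp add: in_sets_I)
  show ?thesis
    unfolding emeasure_tower_nu[OF E] Q_def
  proof (rule nn_integral_cong)
    fix J assume "J \<in> space (count_space S)"
    then have "(f ^^ k) -` {c..d} \<inter> J = J" for k
      using S_borel(2)[of J] funpow_in[of _ k] by auto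
    then show "(\<Sum>k<\<tau> J. emeasure nu ((f ^^ k) -` {c..d} \<inter> J)) = of_nat (\<tau> J) * emeasure nu J"
      by simp
  qed
qed

lemma emeasure_nu_split:
  assumes "B \<in> sets borel"
  shows "(\<integral>\<^sup>+J. emeasure nu (B \<inter> J) \<partial>count_space S) = emeasure nu (B \<inter> W)"
proof -
  have "(\<integral>\<^sup>+J. emeasure nu (B \<inter> J) \<partial>count_space S) = emeasure nu (\<Union>J\<in>S. B \<inter> J)"
  proof (rule emeasure_UN_countable[symmetric, OF _ S_countable])
    show "B \<inter> J \<in> sets nu" if "J \<in> S" for J
      unfolding in_sets_nu using S_borel(1)[OF that] assms that by auto
    show "disjoint_family_on (\<lambda>J. B \<inter> J) S"
      using S_disjoint by (auto simp: disjoint_family_on_def disjoint_def)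
  qed
  also have "(\<Union>J\<in>S. B \<inter> J) = B \<inter> W" by blast
  finally show ?thesis .
qed

lemma f_vimage_I: "E \<in> sets I \<Longrightarrow> f -` E \<inter> {c..d} \<in> sets I"
  using funpow_vimage_borel[of "{c..d}" E 1] by (simp add: in_sets_I Int_commute)

text \<open>Pulling back by \<open>f\<close> raises every floor by one, so the sums telescope to a
  missing bottom floor and an additional floor tau(J). These carry equal mass by
  \<open>F\<close>-invariance of \<open>nu\<close>. The finite base mass is added to both sides and
  cancelled, because \<open>ennreal\<close> subtraction truncates.\<close>

lemma tower_invariant:
  assumes E: "E \<in> sets I"
  shows "emeasure tower (f -` E \<inter> {c..d}) = emeasure tower E"
proof -
  let ?n = "\<lambda>k J. emeasure nu ((f ^^ k) -` E \<inter> J)"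
  have EB: "E \<in> sets borel" using E by (simp add: in_sets_I)
  have FE: "F -` E \<inter> W \<in> sets borel" by (rule F_vimage_borel[OF EB])
  have finite: "emeasure nu (E \<inter> W) \<noteq> \<infinity>"
    using prob_space.emeasure_le_1[OF prob_space_nu, of "E \<inter> W"] by (auto simp: top_unique)
  have shift: "emeasure nu ((f ^^ k) -` (f -` E \<inter> {c..d}) \<inter> J) = ?n (Suc k) J" if J: "J \<in> S" for k J
  proof -
    have "(f ^^ k) -` (f -` E \<inter> {c..d}) \<inter> J = (f ^^ Suc k) -` E \<inter> J"
      using S_borel(2)[OF J] funpow_in[of _ k] by auto
    then show ?thesis by simp
  qed
  have "emeasure tower (f -` E \<inter> {c..d}) + emeasure nu (E \<inter> W)
      = (\<integral>\<^sup>+J. (\<Sum>k<\<tau> J. ?n (Suc k) J) \<partial>count_space S) + (\<integral>\<^sup>+J. ?n 0 J \<partial>count_space S)"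
    unfolding emeasure_tower_nu[OF f_vimage_I[OF E]]
  proof (rule arg_cong2[where f = "(+)"])
    show "(\<integral>\<^sup>+J. (\<Sum>k<\<tau> J. emeasure nu ((f ^^ k) -` (f -` E \<inter> {c..d}) \<inter> J)) \<partial>count_space S)
        = (\<integral>\<^sup>+J. (\<Sum>k<\<tau> J. ?n (Suc k) J) \<partial>count_space S)"
      by (intro nn_integral_cong sum.cong refl shift) simp
    show "emeasure nu (E \<inter> W) = (\<integral>\<^sup>+J. ?n 0 J \<partial>count_space S)"
      using emeasure_nu_split[OF EB] by simp
  qed
  also have "\<dots> = (\<integral>\<^sup>+J. (\<Sum>k<\<tau> J. ?n (Suc k) J) + ?n 0 J \<partial>count_space S)"
    by (rule nn_integral_add[symmetric]) simp_all
  also have "\<dots> = (\<integral>\<^sup>+J. (\<Sum>k<\<tau> J. ?n k J) + ?n (\<tau> J) J \<partial>count_space S)"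
  proof (rule nn_integral_cong)
    fix J
    have "(\<Sum>k<\<tau> J. ?n (Suc k) J) + ?n 0 J = (\<Sum>k<Suc (\<tau> J). ?n k J)"
      by (simp only: sum.lessThan_Suc_shift add.commute)
    then show "(\<Sum>k<\<tau> J. ?n (Suc k) J) + ?n 0 J = (\<Sum>k<\<tau> J. ?n k J) + ?n (\<tau> J) J"
      by (simp only: sum.lessThan_Suc)
  qed
  also have "\<dots> = emeasure tower E + (\<integral>\<^sup>+J. ?n (\<tau> J) J \<partial>count_space S)"
    unfolding emeasure_tower_nu[OF E] by (rule nn_integral_add) simp_all
  also have "(\<integral>\<^sup>+J. ?n (\<tau> J) J \<partial>count_space S) = (\<integral>\<^sup>+J. emeasure nu ((F -` E \<inter> W) \<inter> J) \<partial>count_space S)"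
  proof (rule nn_integral_cong)
    fix J assume "J \<in> space (count_space S)"
    then have J: "J \<in> S" by simp
    then have "(F -` E \<inter> W) \<inter> J = (f ^^ \<tau> J) -` E \<inter> J"
      using F_vimage_branch[OF J, of E] by blast
    then show "?n (\<tau> J) J = emeasure nu ((F -` E \<inter> W) \<inter> J)" by simp
  qed
  also have "\<dots> = emeasure nu (F -` E \<inter> W)"
    using emeasure_nu_split[OF FE] by simp
  also have "\<dots> = emeasure nu (E \<inter> W)"
  proof -
    have "F -` E \<inter> W = F -` (E \<inter> W) \<inter> W" using F_W by auto
    moreover have "E \<inter> W \<in> sets nu" using EB by (simp add: in_sets_nu)
    ultimately show ?thesis using inv_erg_nu unfolding inv_erg_on_def by metis
  qed
  finally have "emeasure nu (E \<inter> W) + emeasure tower (f -` E \<inter> {c..d}) = emeasure nu (E \<inter> W) + emeasure tower E"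
    by (simp add: add.commute)
  then show ?thesis using finite by (simp add: ennreal_add_left_cancel)
qed

end

section \<open>Exponents of the lifted measure\<close>

definition eln_pos :: "real \<Rightarrow> ennreal" where
  "eln_pos y = e2ennreal (max 0 (eln y))"

definition eln_neg :: "real \<Rightarrow> ennreal" where
  "eln_neg y = e2ennreal (max 0 (- eln y))"

lemma e2ennreal_max_0: "e2ennreal (max 0 z) = e2ennreal z"
  by (cases "0 \<le> z") (simp_all add: max_absorb1 max_absorb2 e2ennreal_neg)

lemma eln_pos_eq: "0 < y \<Longrightarrow> eln_pos y = ennreal (ln y)"
  by (simp add: eln_pos_def e2ennreal_max_0 eln_def)

lemma eln_neg_eq: "0 < y \<Longrightarrow> eln_neg y = ennreal (- ln y)"
  by (simp add: eln_neg_def e2ennreal_max_0 eln_def)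

text \<open>Integrability of the negative part thus forces \<open>df\<close> to be nonzero almost
  everywhere.\<close>

lemma eln_neg_0: "eln_neg 0 = \<infinity>"
  by (simp add: eln_neg_def eln_def e2ennreal_max_0)

lemma eln_borel [measurable]: "eln \<in> borel_measurable borel"
  unfolding eln_def by measurable

lemma eln_pos_borel [measurable]: "eln_pos \<in> borel_measurable borel"
  unfolding eln_pos_def by measurable

lemma eln_neg_borel [measurable]: "eln_neg \<in> borel_measurable borel"
  unfolding eln_neg_def by measurable

lemma eint_eln: "eint M (\<lambda>x. eln (g x)) = enn2ereal (\<integral>\<^sup>+x. eln_pos (g x) \<partial>M) - enn2ereal (\<integral>\<^sup>+x. eln_neg (g x) \<partial>M)"
  by (simp add: eint_def eln_pos_def eln_neg_def)

lemma e2ennreal_max_cmult: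
  assumes "0 \<le> s"
  shows "e2ennreal (max 0 (ereal s * z)) = ennreal s * e2ennreal (max 0 z)"
proof (cases "s = 0")
  case False
  then have s: "0 < s" using assms by simp
  show ?thesis
    unfolding e2ennreal_max_0
  proof (cases z)
    case (real r)
    then show "e2ennreal (ereal s * z) = ennreal s * e2ennreal z"
      using s by (cases "0 \<le> r") (simp_all add: ennreal_mult ennreal_neg mult_nonneg_nonpos)
  next
    case PInf
    then show "e2ennreal (ereal s * z) = ennreal s * e2ennreal z"
      using s by (simp add: ennreal_mult_top)
  next
    case MInf
    then show "e2ennreal (ereal s * z) = ennreal s * e2ennreal z"
      using s by (simp add: e2ennreal_neg)
  qed
qed (simp add: max_def flip: zero_ereal_def)

text \<open>Both parts are finite, so infinity minus infinity cannot occur; the sign of t decides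
  whether the factor exchanges the positive and negative parts.\<close>

lemma eint_eln_cmult:
  assumes g: "g \<in> borel_measurable M"
    and fin: "(\<integral>\<^sup>+x. eln_pos (g x) \<partial>M) = ennreal p" "(\<integral>\<^sup>+x. eln_neg (g x) \<partial>M) = ennreal q"
    and pq: "0 \<le> p" "0 \<le> q"
  shows "eint M (\<lambda>x. ereal (- t) * eln (g x)) = ereal (- t * (p - q))"
proof (cases "0 \<le> t")
  case True
  have neg: "- (ereal (- t) * z) = ereal t * z" "ereal (- t) * z = ereal t * (- z)" for z
    by (cases z; simp)+
  have "(\<integral>\<^sup>+x. e2ennreal (max 0 (ereal (- t) * eln (g x))) \<partial>M) = ennreal t * ennreal q"
    unfolding neg(2) e2ennreal_max_cmult[OF True] eln_neg_def[symmetric]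
    using g fin by (subst nn_integral_cmult) auto
  moreover have "(\<integral>\<^sup>+x. e2ennreal (max 0 (- (ereal (- t) * eln (g x)))) \<partial>M) = ennreal t * ennreal p"
    unfolding neg(1) e2ennreal_max_cmult[OF True] eln_pos_def[symmetric]
    using g fin by (subst nn_integral_cmult) auto
  ultimately show ?thesis
    unfolding eint_def using True pq by (simp add: ennreal_mult[symmetric] enn2ereal_ennreal algebra_simps)
next
  case False
  then have t: "0 \<le> - t" by simp
  have neg: "- (ereal (- t) * z) = ereal (- t) * (- z)" for z
    by (cases z; simp)
  have "(\<integral>\<^sup>+x. e2ennreal (max 0 (ereal (- t) * eln (g x))) \<partial>M) = ennreal (- t) * ennreal p"
    unfolding e2ennreal_max_cmult[OF t] eln_pos_def[symmetric]
    using g fin by (subst nn_integral_cmult) auto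
  moreover have "(\<integral>\<^sup>+x. e2ennreal (max 0 (- (ereal (- t) * eln (g x)))) \<partial>M) = ennreal (- t) * ennreal q"
    unfolding neg e2ennreal_max_cmult[OF t] eln_neg_def[symmetric]
    using g fin by (subst nn_integral_cmult) auto
  moreover have "0 \<le> - (p * t)" "0 \<le> - (q * t)" using t pq by (simp_all add: mult_nonneg_nonpos)
  ultimately show ?thesis
    unfolding eint_def using t pq
    by (simp add: ennreal_mult[symmetric] enn2ereal_ennreal algebra_simps)
qed

context C1_interval_map
begin

text \<open>From ln y <= y - 1 and a bound of the continuous \<open>df\<close> on the compact
  interval. Taking B at least 1 allows division by B later.\<close>

lemma ln_df_bound: "\<exists>B\<ge>1. \<forall>x\<in>{c..d}. eln_pos \<bar>df x\<bar> \<le> ennreal B"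
proof -
  have "compact (df ` {c..d})" by (intro compact_continuous_image df_cont compact_Icc)
  then obtain b where b: "\<forall>y\<in>df ` {c..d}. norm y \<le> b" using compact_imp_bounded bounded_iff by blast
  have "eln_pos \<bar>df x\<bar> \<le> ennreal (max 1 b)" if "x \<in> {c..d}" for x
  proof (cases "df x = 0")
    case False
    have "ln \<bar>df x\<bar> \<le> \<bar>df x\<bar> - 1" using False by (intro ln_le_minus_one) simp
    also have "\<dots> \<le> max 1 b"
    proof -
      have "norm (df x) \<le> b" using b that by blast
      then show ?thesis by simp
    qed
    finally show ?thesis using False by (simp add: eln_pos_eq ennreal_leI)
  qed (simp add: eln_pos_def eln_def)
  then show ?thesis by (intro exI[of _ "max 1 b"]) simp
qed

text \<open>Only the positive part has to be bounded; an infinite negative part makes the exponent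
  minus infinity.\<close>

lemma lyap_le:
  assumes B: "\<forall>x\<in>{c..d}. eln_pos \<bar>df x\<bar> \<le> ennreal B" "0 \<le> B"
    and m: "prob_space m" "space m = {c..d}"
  shows "lyap df m \<le> ereal B"
proof -
  have "(\<integral>\<^sup>+x. eln_pos \<bar>df x\<bar> \<partial>m) \<le> (\<integral>\<^sup>+x. ennreal B \<partial>m)"
    using B m by (intro nn_integral_mono) simp
  also have "\<dots> = ennreal B" using prob_space.emeasure_space_1[OF m(1)] by simp
  finally have P: "enn2ereal (\<integral>\<^sup>+x. eln_pos \<bar>df x\<bar> \<partial>m) \<le> ereal B"
    using B(2) by (metis enn2ereal_ennreal less_eq_ennreal.rep_eq)
  have "enn2ereal (\<integral>\<^sup>+x. eln_pos \<bar>df x\<bar> \<partial>m) - enn2ereal (\<integral>\<^sup>+x. eln_neg \<bar>df x\<bar> \<partial>m)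
      \<le> enn2ereal (\<integral>\<^sup>+x. eln_pos \<bar>df x\<bar> \<partial>m)"
  proof -
    have "0 \<le> enn2ereal (\<integral>\<^sup>+x. eln_neg \<bar>df x\<bar> \<partial>m)" by simp
    then show ?thesis
      by (cases "enn2ereal (\<integral>\<^sup>+x. eln_pos \<bar>df x\<bar> \<partial>m)"; cases "enn2ereal (\<integral>\<^sup>+x. eln_neg \<bar>df x\<bar> \<partial>m)") auto
  qed
  with P show ?thesis unfolding lyap_def eint_eln by (rule order_trans[rotated])
qed

end

context inducing_scheme
begin

lemma slope_prod:
  assumes "J \<in> S" "x \<in> J"
  shows "slope J = (\<Prod>k<\<tau> J. \<bar>df ((f ^^ k) x)\<bar>)"
  using slope(1)[OF assms] by (simp add: dF_br_def abs_prod)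

text \<open>Branch J, a subset of \<open>W\<close>, is stretched by \<open>slope J\<close> to the
  full measure of \<open>W\<close>.\<close>

lemma slope_ge_1:
  assumes J: "J \<in> S"
  shows "1 \<le> slope J"
proof (rule ccontr)
  assume "\<not> 1 \<le> slope J"
  then have "ennreal (slope J) < 1" by (simp add: ennreal_less_one_iff)
  moreover have JW: "emeasure lborel J \<le> emeasure lborel W" using J by (intro emeasure_mono) auto
  ultimately have "ennreal (slope J) * emeasure lborel J < 1 * emeasure lborel W"
  proof -
    have "ennreal (slope J) * emeasure lborel J \<le> ennreal (slope J) * emeasure lborel W"
      using JW by (rule mult_left_mono) simp
    also have "\<dots> < 1 * emeasure lborel W"
      using base_pos emeasure_W_finite \<open>ennreal (slope J) < 1\<close> by (intro ennreal_mult_strict_right_mono) auto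
    finally show ?thesis .
  qed
  then show False using emeasure_branch[OF J] by simp
qed

text \<open>The chain rule in logarithmic form. It is stated additively because of truncated
  subtraction, and ln(slope J) embeds into \<open>ennreal\<close> because the slope is at least
  1.\<close>

lemma sum_eln:
  assumes J: "J \<in> S" and x: "x \<in> J"
  shows "(\<Sum>k<\<tau> J. eln_pos \<bar>df ((f ^^ k) x)\<bar>) = (\<Sum>k<\<tau> J. eln_neg \<bar>df ((f ^^ k) x)\<bar>) + ennreal (ln (slope J))"
proof -
  let ?l = "\<lambda>k. ln \<bar>df ((f ^^ k) x)\<bar>"
  have nz: "0 < \<bar>df ((f ^^ k) x)\<bar>" if "k < \<tau> J" for k using df_nonzero[OF J x that] by simp
  have pos: "(\<Sum>k<\<tau> J. eln_pos \<bar>df ((f ^^ k) x)\<bar>) = ennreal (\<Sum>k<\<tau> J. max 0 (?l k))"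
  proof -
    have "(\<Sum>k<\<tau> J. eln_pos \<bar>df ((f ^^ k) x)\<bar>) = (\<Sum>k<\<tau> J. ennreal (max 0 (?l k)))"
    proof (rule sum.cong)
      show "eln_pos \<bar>df ((f ^^ k) x)\<bar> = ennreal (max 0 (?l k))" if "k \<in> {..<\<tau> J}" for k
        using eln_pos_eq[OF nz[of k]] that by (simp add: max_def ennreal_neg)
    qed simp
    also have "\<dots> = ennreal (\<Sum>k<\<tau> J. max 0 (?l k))" by (rule sum_ennreal) simp
    finally show ?thesis .
  qed
  have neg: "(\<Sum>k<\<tau> J. eln_neg \<bar>df ((f ^^ k) x)\<bar>) = ennreal (\<Sum>k<\<tau> J. max 0 (- ?l k))"
  proof -
    have "(\<Sum>k<\<tau> J. eln_neg \<bar>df ((f ^^ k) x)\<bar>) = (\<Sum>k<\<tau> J. ennreal (max 0 (- ?l k)))"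
    proof (rule sum.cong)
      show "eln_neg \<bar>df ((f ^^ k) x)\<bar> = ennreal (max 0 (- ?l k))" if "k \<in> {..<\<tau> J}" for k
        using eln_neg_eq[OF nz[of k]] that by (simp add: max_def ennreal_neg)
    qed simp
    also have "\<dots> = ennreal (\<Sum>k<\<tau> J. max 0 (- ?l k))" by (rule sum_ennreal) simp
    finally show ?thesis .
  qed
  have "ln (slope J) = (\<Sum>k<\<tau> J. ?l k)"
    unfolding slope_prod[OF J x] by (rule ln_prod[OF finite_lessThan]) (rule less_imp_neq[OF nz, symmetric], simp)
  also have "\<dots> = (\<Sum>k<\<tau> J. max 0 (?l k)) - (\<Sum>k<\<tau> J. max 0 (- ?l k))"
  proof -
    have "y = max 0 y - max 0 (- y)" for y :: real by linarith
    then show ?thesis unfolding sum_subtractf[symmetric] by (intro sum.cong refl)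
  qed
  finally have "(\<Sum>k<\<tau> J. max 0 (?l k)) = (\<Sum>k<\<tau> J. max 0 (- ?l k)) + ln (slope J)" by simp
  then show ?thesis
    unfolding pos neg using slope_ge_1[OF J] by (subst ennreal_plus[symmetric]) (simp_all add: sum_nonneg)
qed

text \<open>Since \<open>nu\<close> gives J the mass 1 / \<open>slope J\<close>, this is the entropy
  of the partition \<open>S\<close> under \<open>nu\<close>, and also the integral of ln
  |dF|.\<close>

definition base_entropy :: ennreal where
  "base_entropy = (\<integral>\<^sup>+J. ennreal (ln (slope J)) * emeasure nu J \<partial>count_space S)"

lemma df_I [measurable]: "df \<in> borel_measurable I"
  by (rule df_borel)

text \<open>\<open>sum_eln\<close> integrated over every branch. The identity makes sense before
  either integral is known to be finite.\<close>

lemma tower_exponents: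
  "(\<integral>\<^sup>+x. eln_pos \<bar>df x\<bar> \<partial>tower) = (\<integral>\<^sup>+x. eln_neg \<bar>df x\<bar> \<partial>tower) + base_entropy"
proof -
  have pos: "(\<lambda>x. eln_pos \<bar>df x\<bar>) \<in> borel_measurable I" and neg: "(\<lambda>x. eln_neg \<bar>df x\<bar>) \<in> borel_measurable I"
    by measurable
  have comp: "(\<lambda>x. u ((f ^^ k) x)) \<in> borel_measurable (restrict_space nu J)"
    if "J \<in> S" "u \<in> borel_measurable I" for u :: "real \<Rightarrow> ennreal" and J k
    using measurable_compose[OF funpow_measurable_branch[OF that(1)] that(2)] .
  have "(\<integral>\<^sup>+x. eln_pos \<bar>df x\<bar> \<partial>tower)
      = (\<integral>\<^sup>+J. (\<Sum>k<\<tau> J. \<integral>\<^sup>+x. eln_neg \<bar>df ((f ^^ k) x)\<bar> \<partial>restrict_space nu J) + ennreal (ln (slope J)) * emeasure nu J \<partial>count_space S)"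
    unfolding nn_integral_tower[OF pos]
  proof (rule nn_integral_cong)
    fix J assume "J \<in> space (count_space S)"
    then have J: "J \<in> S" by simp
    have sp: "space (restrict_space nu J) = J"
      using branch_Int_space_nu[OF J] by (simp add: space_restrict_space)
    have "(\<Sum>k<\<tau> J. \<integral>\<^sup>+x. eln_pos \<bar>df ((f ^^ k) x)\<bar> \<partial>restrict_space nu J)
        = (\<integral>\<^sup>+x. (\<Sum>k<\<tau> J. eln_pos \<bar>df ((f ^^ k) x)\<bar>) \<partial>restrict_space nu J)"
      by (rule nn_integral_sum[symmetric]) (rule comp[OF J pos])
    also have "\<dots> = (\<integral>\<^sup>+x. (\<Sum>k<\<tau> J. eln_neg \<bar>df ((f ^^ k) x)\<bar>) + ennreal (ln (slope J)) \<partial>restrict_space nu J)"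
      by (intro nn_integral_cong) (simp add: sum_eln[OF J] sp)
    also have "\<dots> = (\<integral>\<^sup>+x. (\<Sum>k<\<tau> J. eln_neg \<bar>df ((f ^^ k) x)\<bar>) \<partial>restrict_space nu J) + (\<integral>\<^sup>+x. ennreal (ln (slope J)) \<partial>restrict_space nu J)"
      by (intro nn_integral_add borel_measurable_sum comp[OF J neg]) simp
    also have "(\<integral>\<^sup>+x. (\<Sum>k<\<tau> J. eln_neg \<bar>df ((f ^^ k) x)\<bar>) \<partial>restrict_space nu J) = (\<Sum>k<\<tau> J. \<integral>\<^sup>+x. eln_neg \<bar>df ((f ^^ k) x)\<bar> \<partial>restrict_space nu J)"
      by (rule nn_integral_sum) (rule comp[OF J neg])
    also have "(\<integral>\<^sup>+x. ennreal (ln (slope J)) \<partial>restrict_space nu J) = ennreal (ln (slope J)) * emeasure nu J"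
      using branch_nu[OF J] by (simp add: sp emeasure_restrict_space branch_Int_space_nu[OF J])
    finally show "(\<Sum>k<\<tau> J. \<integral>\<^sup>+x. eln_pos \<bar>df ((f ^^ k) x)\<bar> \<partial>restrict_space nu J)
        = (\<Sum>k<\<tau> J. \<integral>\<^sup>+x. eln_neg \<bar>df ((f ^^ k) x)\<bar> \<partial>restrict_space nu J) + ennreal (ln (slope J)) * emeasure nu J" .
  qed
  also have "\<dots> = (\<integral>\<^sup>+x. eln_neg \<bar>df x\<bar> \<partial>tower) + base_entropy"
    unfolding nn_integral_tower[OF neg] base_entropy_def by (rule nn_integral_add) simp_all
  finally show ?thesis .
qed

text \<open>If all slopes were 1, each branch would have the full measure of \<open>W\<close>, so
  there would be only one. All points would then share one itinerary, and (H2) would reduce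
  \<open>W\<close> to a point, against its positive measure.\<close>

lemma exists_expanding_branch: "\<exists>J\<in>S. 1 < slope J"
proof (rule ccontr)
  assume "\<not> ?thesis"
  then have eq: "emeasure lborel J = emeasure lborel W" if "J \<in> S" for J
    using emeasure_branch[OF that] slope_ge_1[OF that] that by (metis antisym_conv2 ennreal_1 mult_1)
  obtain J where J: "J \<in> S" using W_nonempty by blast
  have "S = {J}"
  proof (rule ccontr)
    assume "S \<noteq> {J}"
    then obtain K where K: "K \<in> S" "K \<noteq> J" using J by blast
    have "emeasure lborel J + emeasure lborel K = emeasure lborel (J \<union> K)"
      using mem_unique[OF J K(1)] K J S_borel by (intro plus_emeasure) auto
    also have "\<dots> \<le> emeasure lborel W" using J K by (intro emeasure_mono) auto
    finally have "emeasure lborel W + emeasure lborel W \<le> emeasure lborel W + 0"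
      using eq J K by simp
    then show False using base_pos emeasure_W_finite by (subst (asm) ennreal_add_left_cancel_le) auto
  qed
  then have WJ: "W = J" by simp
  have const: "(\<lambda>_. J) \<in> seqs S" using J by (simp add: seqs_def)
  have "x = code_map f \<tau> (\<lambda>_. J)" if "x \<in> J" for x
    using code_map_eq[OF const, of x] Fn_W[of x] that unfolding WJ by simp
  then have "J \<subseteq> {code_map f \<tau> (\<lambda>_. J)}" by blast
  then have "emeasure lborel J \<le> emeasure lborel {code_map f \<tau> (\<lambda>_. J)}" by (intro emeasure_mono) auto
  then show False using eq[OF J] base_pos by simp
qed

lemma base_entropy_pos: "0 < base_entropy"
proof -
  obtain J where J: "J \<in> S" "1 < slope J" using exists_expanding_branch by blast
  have "emeasure lborel J \<noteq> 0"
    using emeasure_branch[OF J(1)] base_pos by auto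
  then have "0 < emeasure nu J"
    using emeasure_nu[OF S_borel(1)[OF J(1)]] J emeasure_W_finite
    by (auto simp: Union_upper ennreal_zero_less_divide zero_less_iff_neq_zero)
  then have "0 < ennreal (ln (slope J)) * emeasure nu J"
    using J by (simp add: ennreal_zero_less_mult_iff)
  also have "\<dots> \<le> base_entropy"
    unfolding base_entropy_def using J(1) by (rule nn_integral_ge_point)
  finally show ?thesis .
qed

lemma Q_pos: "0 < Q"
proof -
  have "1 = emeasure nu W"
    using prob_space.emeasure_space_1[OF prob_space_nu] by (simp add: space_nu)
  also have "\<dots> = (\<integral>\<^sup>+J. emeasure nu J \<partial>count_space S)"
    using emeasure_nu_split[of UNIV] by simp
  also have "\<dots> \<le> Q"
    unfolding Q_def
  proof (rule nn_integral_mono)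
    fix J assume "J \<in> space (count_space S)"
    then have "1 \<le> \<tau> J" using tau_pos by simp
    then have "(1::ennreal) \<le> of_nat (\<tau> J)" by (metis of_nat_1 of_nat_mono)
    then have "1 * emeasure nu J \<le> of_nat (\<tau> J) * emeasure nu J" by (rule mult_right_mono) simp
    then show "emeasure nu J \<le> of_nat (\<tau> J) * emeasure nu J" by simp
  qed
  finally show ?thesis using zero_less_one order_less_le_trans by blast
qed

definition mu :: "real measure" where
  "mu = scale_measure (1 / Q) tower"

lemma sets_mu: "sets mu = sets I"
  by (simp add: mu_def sets_tower)

lemma space_mu: "space mu = {c..d}"
  using sets_eq_imp_space_eq[OF sets_mu] by (simp add: space_restrict_space)

lemma emeasure_mu: "emeasure mu E = emeasure tower E / Q"
  by (simp add: mu_def divide_ennreal_def mult.commute)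

lemma mu_lifted: "mu \<in> lifted_measures f {c..d} S \<tau>"
  unfolding lifted_measures_def
proof (intro CollectI conjI exI[of _ nu] ballI)
  show "sets mu = sets I" by (rule sets_mu)
  show "inv_erg_on F W nu" by (rule inv_erg_nu)
  show "Q_nu S \<tau> nu < \<infinity>" unfolding Q_nu_eq by (rule Q_finite)
  fix E assume "E \<in> sets mu"
  then show "emeasure mu E = (\<Sum>\<^sub>\<infinity>J\<in>S. \<Sum>k<\<tau> J. emeasure nu ((f ^^ k) -` E \<inter> J)) / Q_nu S \<tau> nu"
    by (simp add: emeasure_mu Q_nu_eq emeasure_tower_nu sets_mu infsum_ennreal_eq_nn_integral[OF S_countable])
qed

lemma mpt_mu: "mpt mu f"
proof -
  interpret prob_space mu
    using Q_pos Q_finite by (intro prob_spaceI) (simp add: space_mu emeasure_mu tower_total ennreal_divide_self)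
  have meas: "f \<in> mu \<rightarrow>\<^sub>M mu"
  proof (rule measurableI)
    show "f x \<in> space mu" if "x \<in> space mu" for x using that f_in by (simp add: space_mu)
    show "f -` E \<inter> space mu \<in> sets mu" if "E \<in> sets mu" for E
      using f_vimage_I that by (simp add: space_mu sets_mu)
  qed
  show ?thesis
  proof
    show "f \<in> mu \<rightarrow>\<^sub>M mu" by (rule meas)
    show "distr mu mu f = mu"
    proof (rule measure_eqI)
      fix E assume "E \<in> sets (distr mu mu f)"
      then have E: "E \<in> sets mu" by simp
      then show "emeasure (distr mu mu f) E = emeasure mu E"
        using tower_invariant[of E] by (simp add: emeasure_distr[OF meas] emeasure_mu space_mu sets_mu)
    qed simp
  qed
qed

lemma mu_absolutely_continuous: "absolutely_continuous (restrict_space lborel {c..d}) mu"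
  unfolding absolutely_continuous_def
proof
  fix E assume "E \<in> null_sets (restrict_space lborel {c..d})"
  then have E: "E \<in> sets I" "emeasure lborel E = 0"
    by (auto simp: null_sets_def sets_restrict_space_iff emeasure_restrict_space)
  have "emeasure nu ((f ^^ k) -` E \<inter> J) = 0" if "J \<in> S" "k < \<tau> J" for J k
  proof -
    have "J \<inter> (f ^^ k) -` E \<in> sets borel" "emeasure lborel (J \<inter> (f ^^ k) -` E) = 0"
      using funpow_vimage_borel[OF S_borel[OF that(1)], of E k] null_set_preimage[OF that(1), of k E] E that(2)
      by (simp_all add: in_sets_I)
    moreover have "J \<inter> (f ^^ k) -` E \<subseteq> W" using that(1) by blast
    ultimately show ?thesis using emeasure_nu by (simp add: Int_commute)
  qed
  then have "emeasure tower E = (\<integral>\<^sup>+J. 0 \<partial>count_space S)"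
    unfolding emeasure_tower_nu[OF E(1)] by (intro nn_integral_cong) (simp add: sum.neutral)
  then show "E \<in> null_sets mu" using E(1) by (simp add: null_sets_def sets_mu emeasure_mu)
qed

lemma mu_density: "\<exists>D. ac_invariant_measure c d f df mu D"
proof -
  let ?L = "restrict_space lborel {c..d}"
  interpret mu: mpt mu f by (rule mpt_mu)
  interpret L: finite_measure ?L
    by (rule finite_measureI) (simp add: space_restrict_space emeasure_restrict_space emeasure_lborel_Icc_eq)
  have sets: "sets mu = sets ?L" by (simp add: sets_mu sets_restrict_space)
  have "finite_measure mu" by unfold_locales
  from L.real_RN_deriv[OF this mu_absolutely_continuous sets] obtain D where
    D: "D \<in> borel_measurable ?L" "AE x in ?L. RN_deriv ?L mu x = ennreal (D x)" "\<And>x. 0 \<le> D x" by blast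
  have "density ?L D = density ?L (RN_deriv ?L mu)"
    using D by (intro density_cong) auto
  also have "\<dots> = mu" by (rule L.density_RN_deriv[OF mu_absolutely_continuous sets])
  finally have "mu = density ?L D" by simp
  moreover have "D \<in> borel_measurable I"
    using D(1) by (simp add: measurable_cong_sets[of ?L I] sets_restrict_space)
  ultimately show ?thesis
    using D(3) sets_mu by (intro exI[of _ D]) unfold_locales
qed

text \<open>The number l is \<open>base_entropy / Q\<close>. The positive part is at most B, and the
  negative part is smaller by this positive amount, so both are finite and their difference is a
  real l > 0.\<close>

lemma mu_exponent:
  "\<exists>l>0. ereal l \<le> ks_entropy f mu \<and> (\<forall>t. eint mu (\<lambda>x. ereal (- t) * eln \<bar>df x\<bar>) = ereal (- t * l))"
proof -
  interpret mu: mpt mu f by (rule mpt_mu)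
  obtain D where "ac_invariant_measure c d f df mu D" using mu_density by blast
  then interpret ac: ac_invariant_measure c d f df mu D .
  have dfm [measurable]: "df \<in> borel_measurable mu"
    by (simp add: measurable_cong_sets[OF sets_mu refl])
  let ?P = "\<integral>\<^sup>+x. eln_pos \<bar>df x\<bar> \<partial>mu" and ?N = "\<integral>\<^sup>+x. eln_neg \<bar>df x\<bar> \<partial>mu"
  have dft: "df \<in> borel_measurable tower"
    by (simp add: measurable_cong_sets[OF sets_tower refl])
  have scale: "(\<integral>\<^sup>+x. u \<bar>df x\<bar> \<partial>mu) = (\<integral>\<^sup>+x. u \<bar>df x\<bar> \<partial>tower) / Q" if "u \<in> borel_measurable borel" for u :: "real \<Rightarrow> ennreal"
    unfolding mu_def using dft that by (subst nn_integral_scale_measure) (auto simp: divide_ennreal_def mult.commute)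
  have PN: "?P = ?N + base_entropy / Q"
    unfolding scale[OF eln_pos_borel] scale[OF eln_neg_borel] tower_exponents
    by (simp add: divide_ennreal_def distrib_right)
  have H: "0 < base_entropy / Q"
    using base_entropy_pos Q_finite by (simp add: ennreal_zero_less_divide)
  obtain B where B: "B \<ge> 1" "\<forall>x\<in>{c..d}. eln_pos \<bar>df x\<bar> \<le> ennreal B" using ln_df_bound by blast
  have "?P \<le> (\<integral>\<^sup>+x. ennreal B \<partial>mu)" using B by (intro nn_integral_mono) (simp add: space_mu)
  also have "\<dots> = ennreal B" using mu.emeasure_space_1 by simp
  finally have "?P < \<top>" by (rule order_le_less_trans) simp
  then obtain p where p: "0 \<le> p" "?P = ennreal p" by (cases ?P) auto
  have "?N \<le> ?P" unfolding PN by simp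
  then have "?N < \<top>" using \<open>?P < \<top>\<close> by (rule order_le_less_trans)
  then obtain q where q: "0 \<le> q" "?N = ennreal q" by (cases ?N) auto
  have "q < p"
  proof -
    have "?N + 0 < ?N + base_entropy / Q"
      using H \<open>?N < \<top>\<close> unfolding ennreal_add_left_cancel_less by simp
    then have "?N < ?P" by (simp only: PN add_0_right)
    then show ?thesis using p q by (simp add: ennreal_less_iff)
  qed
  have nz: "AE x in mu. df x \<noteq> 0"
  proof -
    have "AE x in mu. eln_neg \<bar>df x\<bar> \<noteq> \<infinity>"
      by (rule nn_integral_PInf_AE) (use q in auto)
    then show ?thesis by eventually_elim (auto simp: eln_neg_0)
  qed
  have lp: "(\<integral>\<^sup>+x. ennreal (ln \<bar>df x\<bar>) \<partial>mu) = ennreal p"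
    unfolding p(2)[symmetric] using nz by (intro nn_integral_cong_AE) (auto elim!: eventually_mono simp: eln_pos_eq)
  have ln: "(\<integral>\<^sup>+x. ennreal (- ln \<bar>df x\<bar>) \<partial>mu) = ennreal q"
    unfolding q(2)[symmetric] using nz by (intro nn_integral_cong_AE) (auto elim!: eventually_mono simp: eln_neg_eq)
  have int: "integrable mu (\<lambda>x. ln \<bar>df x\<bar>)"
    unfolding real_integrable_def using lp ln by simp
  have "(\<integral>x. ln \<bar>df x\<bar> \<partial>mu) = p - q"
    unfolding real_lebesgue_integral_def[OF int] lp ln using p q by simp
  then have "ereal (p - q) \<le> ks_entropy f mu"
    using ac.rokhlin_inequality[OF nz int] by simp
  moreover have "eint mu (\<lambda>x. ereal (- t) * eln \<bar>df x\<bar>) = ereal (- t * (p - q))" for t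
    by (rule eint_eln_cmult) (use p q in auto)
  ultimately show ?thesis using \<open>q < p\<close> by (intro exI[of _ "p - q"]) auto
qed

end

section \<open>Pressure of the lifted measure against measures of zero entropy\<close>

theorem theorem6p4:
  fixes f df :: "real \<Rightarrow> real" and c d :: real
    and S :: "real set set" and \<tau> :: "real set \<Rightarrow> nat"
  assumes I_nondeg: "c < d"
    and f_maps: "f ` {c..d} \<subseteq> {c..d}"
    and f_deriv: "\<forall>x\<in>{c..d}. (f has_real_derivative df x) (at x within {c..d})"
    and df_cont: "continuous_on {c..d} df"
    and S_countable: "countable S"
    and S_disjoint: "disjoint S"
    and S_borel: "\<forall>J\<in>S. J \<in> sets borel \<and> J \<subseteq> {c..d}"
    and tau_pos: "\<forall>J\<in>S. 1 \<le> \<tau> J"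
    and H1: "\<forall>J\<in>S. (\<exists>U. openin (top_of_set {c..d}) U \<and> connected U \<and> J \<subseteq> U \<and>
                         (\<exists>g. homeomorphism U ((f ^^ \<tau> J) ` U) (f ^^ \<tau> J) g))
                    \<and> (f ^^ \<tau> J) ` J = \<Union>S"
    and H2: "\<forall>a\<in>seqs S. \<exists>!x. x \<in> code_set f \<tau> a"
    and H3: "\<forall>\<nu>. sets \<nu> = sets (shift_space S) \<and> prob_space \<nu> \<and>
                (\<forall>A\<in>sets \<nu>. emeasure \<nu> (shift -` A \<inter> seqs S) = emeasure \<nu> A) \<and>
                (\<forall>w\<in>lists S. emeasure \<nu> (cyl S w) > 0)
              \<longrightarrow> (AE a in \<nu>. code_map f \<tau> a \<in> \<Union>S)"
    and H4: "emeasure lborel (\<Union>S) > 0 \<and>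
             (\<exists>c1>0. \<exists>l1>1. \<forall>n::nat.
                (\<Sum>\<^sub>\<infinity>J\<in>{J\<in>S. n \<le> \<tau> J}. emeasure lborel J) \<le> ennreal (1 / (c1 * l1 ^ n)))"
    and H5: "\<exists>c2>0. \<exists>l2>1. \<forall>n\<ge>1. \<forall>w\<in>lists S. length w = n \<longrightarrow>
               (\<forall>x\<in>code_cyl f S \<tau> w. \<forall>y\<in>code_cyl f S \<tau> w. \<forall>i<n.
                  \<bar>dF_br f df \<tau> (w ! i) (F_word f \<tau> w i x) / dF_br f df \<tau> (w ! i) (F_word f \<tau> w i y) - 1\<bar>
                    \<le> c2 / l2 ^ n)"
    and zero_entropy_exp: "\<exists>c9>0. \<forall>\<mu>. inv_erg_on f {c..d} \<mu> \<and> ks_entropy f \<mu> = 0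
                              \<longrightarrow> lyap df \<mu> > ereal c9"
  shows "\<exists>a>0. \<exists>b>0. \<forall>t. - a < t \<and> t < 1 + b \<longrightarrow>
           \<not> (\<exists>\<mu>. inv_erg_on f {c..d} \<mu> \<and> ks_entropy f \<mu> = 0 \<and>
                  ks_entropy f \<mu> - ereal t * lyap df \<mu> =
                    P_L f {c..d} S \<tau> (\<lambda>x. ereal (- t) * eln \<bar>df x\<bar>))"
proof -
  have C1: "C1_interval_map c d f df"
    by (rule C1_interval_map.intro[OF f_maps bspec[OF f_deriv] df_cont])
  have inj: "inj_on (f ^^ \<tau> J) J" if J: "J \<in> S" for J
  proof -
    obtain U g where U: "J \<subseteq> U" "homeomorphism U ((f ^^ \<tau> J) ` U) (f ^^ \<tau> J) g"
      using bspec[OF H1 J, THEN conjunct1] by (elim exE conjE) (rule that)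
    then have "inj_on (f ^^ \<tau> J) U"
      by (intro inj_on_inverseI[where g = g]) (rule homeomorphism_apply1)
    then show ?thesis using U(1) by (rule inj_on_subset)
  qed
  interpret scheme: inducing_scheme c d f df S \<tau>
  proof (rule inducing_scheme.intro[OF C1], rule inducing_scheme_axioms.intro)
    show "(f ^^ \<tau> J) ` J = \<Union>S" if "J \<in> S" for J
      using bspec[OF H1 that, THEN conjunct2] .
    show "J \<in> sets borel" "J \<subseteq> {c..d}" "1 \<le> \<tau> J" if "J \<in> S" for J
      using bspec[OF S_borel that] bspec[OF tau_pos that] by simp_all
    show "\<exists>!x. x \<in> code_set f \<tau> a" if "a \<in> seqs S" for a using H2 that by (rule bspec)
  qed (rule S_countable S_disjoint inj H4[THEN conjunct1] H4[THEN conjunct2] H5; assumption?)+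
  obtain c9 where c9: "0 < c9"
    "\<And>m. inv_erg_on f {c..d} m \<Longrightarrow> ks_entropy f m = 0 \<Longrightarrow> ereal c9 < lyap df m"
    using zero_entropy_exp by blast
  obtain l where l: "0 < l" "ereal l \<le> ks_entropy f scheme.mu"
    "\<And>t. eint scheme.mu (\<lambda>x. ereal (- t) * eln \<bar>df x\<bar>) = ereal (- t * l)"
    using scheme.mu_exponent by blast
  obtain B where B: "1 \<le> B" "\<forall>x\<in>{c..d}. eln_pos \<bar>df x\<bar> \<le> ennreal B"
    using scheme.ln_df_bound by blast
  \<comment> \<open>Let v in (c9, B] be the exponent of a zero entropy measure. For t <= 0, t > -l/B
    gives -t v <= -t B < l <= (1 - t) l. For t > 1, t < 1 + c9/l gives (t - 1) l < c9 < t v. Both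
    contradict (1 - t) l <= -t v.\<close>
  have pos: "0 < l / B" "0 < c9 / l" using l(1) B(1) c9(1) by simp_all
  show ?thesis
  proof (rule exI[of _ "l / B"], rule conjI[OF pos(1)], rule exI[of _ "c9 / l"], rule conjI[OF pos(2)],
      intro allI impI notI)
    fix t assume t: "- (l / B) < t \<and> t < 1 + c9 / l"
    let ?P = "P_L f {c..d} S \<tau> (\<lambda>x. ereal (- t) * eln \<bar>df x\<bar>)"
    assume "\<exists>m. inv_erg_on f {c..d} m \<and> ks_entropy f m = 0 \<and> ks_entropy f m - ereal t * lyap df m = ?P"
    then obtain m where m: "inv_erg_on f {c..d} m" "ks_entropy f m = 0" "ks_entropy f m - ereal t * lyap df m = ?P"
      by (elim exE conjE) (rule that)
    have "prob_space m" "space m = {c..d}"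
      using m(1) sets_eq_imp_space_eq[of m "restrict_space borel {c..d}"]
      by (auto simp: inv_erg_on_def space_restrict_space)
    then have "lyap df m \<le> ereal B" using scheme.lyap_le[OF B(2)] B(1) by simp
    moreover have "ereal c9 < lyap df m" using c9(2) m by blast
    ultimately obtain v where v: "lyap df m = ereal v" "c9 < v" "v \<le> B" by (cases "lyap df m") auto
    have "ereal (l - t * l) = ereal l + ereal (- t * l)" by simp
    also have "\<dots> \<le> ks_entropy f scheme.mu + eint scheme.mu (\<lambda>x. ereal (- t) * eln \<bar>df x\<bar>)"
      unfolding l(3) using l(2) by (rule add_right_mono)
    also have "\<dots> \<le> ?P" unfolding P_L_def by (rule SUP_upper[OF scheme.mu_lifted])
    also have "?P = ereal (- t * v)" using m(2,3) v(1) by simp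
    finally have le: "l - t * l \<le> - t * v" by simp
    show False
    \<comment> \<open>For 0 < t <= 1 the signs alone decide: (1 - t) l is nonnegative and -t v is
      negative. The constants matter only outside this range.\<close>
    proof (cases "0 < t")
      case True
      have "(t - 1) * l < c9" using t l(1) by (simp add: field_simps)
      moreover have "t * c9 < t * v" using True v by simp
      ultimately show False
      proof (cases "t \<le> 1")
        case True': True
        have "0 \<le> (1 - t) * l" using True' l(1) by simp
        moreover have "0 < t * v" using True v(2) c9(1) by simp
        ultimately show ?thesis using le by (simp add: algebra_simps)
      next
        case False
        then have "c9 \<le> t * c9" using c9(1) by simp
        then show ?thesis using le \<open>(t - 1) * l < c9\<close> \<open>t * c9 < t * v\<close> by (simp add: algebra_simps)
      qed
    next
      case False
      have "- t * v \<le> - t * B" using False v by (intro mult_left_mono) auto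
      also have "\<dots> < l" using t B(1) by (simp add: field_simps)
      finally have "- t * v < l" .
      moreover have "0 \<le> - t * l" using False l(1) by (intro mult_nonneg_nonneg) auto
      ultimately show False using le by linarith
    qed
  qed
qed

end
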